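(* Let $\lambda=(p,q,r;a,b;x)$ with $p,q,r\in\mathbb{Z}$, $0<q\le p$, $p+q\le r$, $a,b\in\mathbb{R}$, $0<x<1$. Then $\lambda$ is a solution to the closed-form problem that comes from contiguous relations if and only if $\Phi(w;\lambda)$ vanishes identically as a polynomial in $w$, that is, if and only if $\lambda$ is a simultaneous root of the $r$ equations $$\Phi_k(\lambda)=0\qquad(k=0,1,\dots,r-1).$$
   Context: Put $f(w)={}_2F_1(pw+a,\,qw+b;\,rw;\,x)$ (Gauss hypergeometric series), meromorphic in $w\in\mathbb{C}$. $\lambda$ is a solution to the closed-form problem if $f(w+1)/f(w)\in\mathbb{C}(w)$. For integers $p,q,r$, composing Gauss's contiguous relations gives $${}_2F_1(\alpha+p,\beta+q;\gamma+r;z)=R_{p,q,r}(\alpha,\beta;\gamma;z)\,{}_2F_1(\alpha,\beta;\gamma;z)+Q_{p,q,r}(\alpha,\beta;\gamma;z)\,{}_2F_1(\alpha+1,\beta+1;\gamma+1;z)$$ with rational functions $R_{p,q,r},Q_{p,q,r}$ of $(\alpha,\beta;\gamma;z)$ uniquely determined by $(p,q,r)$. Put $Q(w):=Q_{p,q,r}(pw+a,qw+b;rw;x)$. A solution $\lambda$ is said to come from contiguous relations if $Q(w)$ vanishes identically in $\mathbb{C}(w)$ (so that the specialised three-term relation becomes $f(w+1)=R(w)f(w)$). For a power series $\varphi(z)=\sum_{j\ge0}c_jz^j$ and $k\ge0$ let $\langle\varphi(z)\rangle_k:=\sum_{j=0}^kc_jz^j$ (truncation always with respect to $z$). Write ${}_2F_1(\boldsymbol{a};z)={}_2F_1(a_1,a_2;a_3;z)$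 for $\boldsymbol{a}=(a_1,a_2;a_3)$. With $\boldsymbol{\alpha}^*(w):=((r-p)w-a,\,(r-q)w-b;\,rw)$, $\boldsymbol{v}:=(1,1;2)$ and $(t)_k=t(t+1)\cdots(t+k-1)$, put $$\Phi(w;\lambda):=(rw)_{r-1}\,\big\langle {}_2F_1(\boldsymbol{\alpha}^*(w);z)\cdot{}_2F_1(\boldsymbol{v}-\boldsymbol{\alpha}^*(w+1);z)\big\rangle_{r-q-1}\Big|_{z=x}.$$ This is a polynomial in $w$ of degree at most $r-1$, and $\Phi_k(\lambda)$ denotes its coefficients: $\Phi(w;\lambda)=\sum_{k=0}^{r-1}\Phi_k(\lambda)w^k$. *)

theory Defs
  imports
    "HOL-Complex_Analysis.Complex_Analysis"
    "HOL-Computational_Algebra.Computational_Algebra"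
begin

definition hyp2F1_fps :: "complex \<Rightarrow> complex \<Rightarrow> complex \<Rightarrow> complex fps" where
  "hyp2F1_fps \<alpha> \<beta> \<gamma> = fps_hypergeo [\<alpha>, \<beta>] [\<gamma>] 1"

text \<open>Meaningful for \<open>norm z < 1\<close> and \<open>\<gamma> \<notin> \<int>\<^sub>\<le>\<^sub>0\<close>.\<close>
definition hyp2F1 :: "complex \<Rightarrow> complex \<Rightarrow> complex \<Rightarrow> complex \<Rightarrow> complex" where
  "hyp2F1 \<alpha> \<beta> \<gamma> z = eval_fps (hyp2F1_fps \<alpha> \<beta> \<gamma>) z"

definition hyp_f :: "int \<Rightarrow> int \<Rightarrow> int \<Rightarrow> real \<Rightarrow> real \<Rightarrow> real \<Rightarrow> complex \<Rightarrow> complex" where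
  "hyp_f p q r a b x w =
     hyp2F1 (of_int p * w + of_real a) (of_int q * w + of_real b) (of_int r * w) (of_real x)"

text \<open>
  Membership of the meromorphic function \<open>f(w + 1) / f(w)\<close> in \<open>\<complex>(w)\<close>. Equality of
  meromorphic functions is equality outside a closed discrete set of points, which
  takes care of the poles and zeros.
\<close>
definition closed_form_solution :: "int \<Rightarrow> int \<Rightarrow> int \<Rightarrow> real \<Rightarrow> real \<Rightarrow> real \<Rightarrow> bool" where
  "closed_form_solution p q r a b x \<longleftrightarrow>
     (\<exists>P D :: complex poly. D \<noteq> 0 \<and>
        (\<forall>\<^sub>\<approx>w\<in>UNIV. hyp_f p q r a b x (w + 1) / hyp_f p q r a b x w = poly P w / poly D w))"

text \<open>
  Polynomials in the four variables \<open>\<alpha>, \<beta>, \<gamma>, z\<close>, from the outermost variable to the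
  innermost one, and the field \<open>\<complex>(\<alpha>, \<beta>, \<gamma>, z)\<close>.
\<close>
type_synonym poly4 = "complex poly poly poly poly"
type_synonym ratfun4 = "poly4 fract"

text \<open>Substitution in a \<open>\<complex>\<close>-algebra with structure map \<open>h\<close>.\<close>
definition subst4 ::
    "(complex \<Rightarrow> 'k :: comm_ring_1) \<Rightarrow> poly4 \<Rightarrow> 'k \<Rightarrow> 'k \<Rightarrow> 'k \<Rightarrow> 'k \<Rightarrow> 'k" where
  "subst4 h P \<alpha> \<beta> \<gamma> z =
     poly (map_poly (\<lambda>P1. poly (map_poly (\<lambda>P2. poly (map_poly (\<lambda>P3.
       poly (map_poly h P3) z) P2) \<gamma>) P1) \<beta>) P) \<alpha>"

definition eval4 :: "poly4 \<Rightarrow> complex \<Rightarrow> complex \<Rightarrow> complex \<Rightarrow> complex \<Rightarrow> complex" where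
  "eval4 P \<alpha> \<beta> \<gamma> z = subst4 (\<lambda>c. c) P \<alpha> \<beta> \<gamma> z"

text \<open>
  The three-term relation with coefficients \<open>R\<close> and \<open>Q\<close>, which are written with a common
  denominator.
\<close>
definition three_term_relation :: "int \<Rightarrow> int \<Rightarrow> int \<Rightarrow> ratfun4 \<Rightarrow> ratfun4 \<Rightarrow> bool" where
  "three_term_relation p q r R Q \<longleftrightarrow>
     (\<exists>A B D. D \<noteq> 0 \<and> R = Fract A D \<and> Q = Fract B D \<and>
        (\<forall>\<alpha> \<beta> \<gamma> z. norm z < 1 \<longrightarrow> \<gamma> \<notin> \<int>\<^sub>\<le>\<^sub>0 \<longrightarrow> \<gamma> + of_int r \<notin> \<int>\<^sub>\<le>\<^sub>0 \<longrightarrow> eval4 D \<alpha> \<beta> \<gamma> z \<noteq> 0 \<longrightarrow>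
           hyp2F1 (\<alpha> + of_int p) (\<beta> + of_int q) (\<gamma> + of_int r) z =
             eval4 A \<alpha> \<beta> \<gamma> z / eval4 D \<alpha> \<beta> \<gamma> z * hyp2F1 \<alpha> \<beta> \<gamma> z +
             eval4 B \<alpha> \<beta> \<gamma> z / eval4 D \<alpha> \<beta> \<gamma> z * hyp2F1 (\<alpha> + 1) (\<beta> + 1) (\<gamma> + 1) z))"

definition contiguous_Q :: "int \<Rightarrow> int \<Rightarrow> int \<Rightarrow> ratfun4" where
  "contiguous_Q p q r = (THE Q. \<exists>R. three_term_relation p q r R Q)"

definition subst_line ::
    "int \<Rightarrow> int \<Rightarrow> int \<Rightarrow> real \<Rightarrow> real \<Rightarrow> real \<Rightarrow> poly4 \<Rightarrow> complex poly" where
  "subst_line p q r a b x P =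
     subst4 (\<lambda>c. [:c:]) P [:of_real a, of_int p:] [:of_real b, of_int q:] [:0, of_int r:] [:of_real x:]"

text \<open>
  \<open>Q(w) = Q(p w + a, q w + b; r w; x)\<close> vanishes in \<open>\<complex>(w)\<close>. The substitution makes sense
  only for a fraction whose denominator does not become zero, and its result does not
  depend on the choice of such a fraction.
\<close>
definition from_contiguous_relations :: "int \<Rightarrow> int \<Rightarrow> int \<Rightarrow> real \<Rightarrow> real \<Rightarrow> real \<Rightarrow> bool" where
  "from_contiguous_relations p q r a b x \<longleftrightarrow>
     (\<exists>N D. contiguous_Q p q r = Fract N D \<and>
        subst_line p q r a b x D \<noteq> 0 \<and>
        Fract (subst_line p q r a b x N) (subst_line p q r a b x D) = 0)"

text \<open>The terms of \<open>\<phi>\<close> up to and including \<open>z\<^sup>k\<close>.\<close>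
definition truncation :: "nat \<Rightarrow> complex fps \<Rightarrow> complex poly" where
  "truncation k \<phi> = truncate_fps (Suc k) \<phi>"

definition alpha_star ::
    "int \<Rightarrow> int \<Rightarrow> int \<Rightarrow> real \<Rightarrow> real \<Rightarrow> complex \<Rightarrow> complex \<times> complex \<times> complex" where
  "alpha_star p q r a b w =
     (of_int (r - p) * w - of_real a, of_int (r - q) * w - of_real b, of_int r * w)"

definition Phi_fun ::
    "int \<Rightarrow> int \<Rightarrow> int \<Rightarrow> real \<Rightarrow> real \<Rightarrow> real \<Rightarrow> complex \<Rightarrow> complex" where
  "Phi_fun p q r a b x w =
     (let (\<alpha>, \<beta>, \<gamma>) = alpha_star p q r a b w;
          (\<alpha>', \<beta>', \<gamma>') = alpha_star p q r a b (w + 1)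
      in pochhammer (of_int r * w) (nat (r - 1)) *
         poly (truncation (nat (r - q - 1))
                 (hyp2F1_fps \<alpha> \<beta> \<gamma> * hyp2F1_fps (1 - \<alpha>') (1 - \<beta>') (2 - \<gamma>')))
              (of_real x))"

text \<open>
  The defining formula divides by the Pochhammer symbols of \<open>r w\<close> and \<open>2 - r (w + 1)\<close>,
  so it is used only where \<open>r w\<close> is not an integer; this determines the polynomial.
\<close>
definition Phi :: "int \<Rightarrow> int \<Rightarrow> int \<Rightarrow> real \<Rightarrow> real \<Rightarrow> real \<Rightarrow> complex poly" where
  "Phi p q r a b x =
     (THE P. \<forall>w. of_int r * w \<notin> \<int> \<longrightarrow> poly P w = Phi_fun p q r a b x w)"

end

theory Submission
  imports Defs "HOL-Real_Asymp.Real_Asymp"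
begin

text \<open>
  Write \<open>y\<close> for a solution family of the contiguous relations and \<open>y\<^sub>1\<close> for its shift by \<open>(1, 1, 1)\<close>.
  The shift \<open>(p, q, r)\<close> is composed of \<open>q\<close> shifts by \<open>(1, 1, 2)\<close>, \<open>p - q\<close> shifts by \<open>(1, 0, 1)\<close> and
  \<open>r - p - q\<close> shifts by \<open>(0, 0, 1)\<close>. Each of these raises the degree in \<open>z\<close> by one only, so the
  composed relation reads \<open>D z\<^bsup>r - 1\<^esup> y' = U y + (1 - z) P y\<^sub>1\<close> with \<open>D\<close> free of \<open>z\<close> and \<open>deg\<^sub>z P \<le> r - q - 1\<close>.
  Apply it to the family of \<open>F(\<alpha>, \<beta>; \<gamma>; z) = (1 - z)\<^bsup>\<gamma> - \<alpha> - \<beta>\<^esup> F(\<gamma> - \<alpha>, \<gamma> - \<beta>; \<gamma>; z)\<close> and to the one of the second local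
  solution \<open>z\<^bsup>1 - \<gamma>\<^esup> F(\<alpha> - \<gamma> + 1, \<beta> - \<gamma> + 1; 2 - \<gamma>; z)\<close>, and eliminate \<open>U\<close>. The factor of \<open>P\<close> is then a
  Wronskian, which is constant, and modulo \<open>z\<^sup>r\<close> the other side is a multiple of
  \<open>F(\<alpha>\<^sup>*(w); z) F(v - \<alpha>\<^sup>*(w + 1); z)\<close>. Hence \<open>P\<close> is, up to explicit factors, the truncated product that
  defines \<open>\<Phi>\<close>, and comparing degrees in \<open>w\<close> bounds the degree of \<open>\<Phi>\<close>.
\<close>

section \<open>Contiguous relations of formal hypergeometric series\<close>

text \<open>Everything is reduced to one polynomial in w, \<open>lineP\<close>. On the line, Q is
  \<open>lineP\<close> up to nonzero factors because 0 < x < 1; \<open>Phi\<close> and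
  \<open>lineP\<close> agree up to nonzero polynomial factors; and once \<open>lineP\<close> is
  zero, the closed form is automatic. The local solutions carry complex powers of z and 1 - z. A
  linear relation does not see a common factor, so these powers are divided out and formal Laurent
  series suffice; hence the recursion is proved for families over an arbitrary integral domain. Q is
  given by a definite description, so uniqueness of the three-term relation is needed as well. It is
  tested at \<alpha> = - n, where the series terminate and degrees can be counted. Poles and
  vanishing Pochhammer denominators are avoided by proving identities in w at non-real points, where
  no parameter is an integer. The conditions 0 < q, q \<le> p and p + q \<le> r say that the numbers
  of steps are non-negative, one step (1, 1, 2) being reserved for the end.\<close>

lemma hyp2F1_fps_nth:
  "fps_nth (hyp2F1_fps a b c) n = pochhammer a n * pochhammer b n / (pochhammer c n * fact n)"
  by (simp add: hyp2F1_fps_def)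

text \<open>Splitting off the constant term leaves successor indices, at which multiplication by
  \<open>fps_X\<close> is a plain index shift.\<close>

lemma fps_eqI_0_Suc:
  assumes "fps_nth f 0 = fps_nth g 0" "\<And>n. fps_nth f (Suc n) = fps_nth g (Suc n)"
  shows "f = g"
  by (rule fps_ext) (use assms in \<open>metis not0_implies_Suc\<close>)

lemma add_of_nat_nonzero:
  assumes "(c :: complex) \<notin> \<int>\<^sub>\<le>\<^sub>0"
  shows "c + of_nat n \<noteq> 0"
  using assms plus_of_nat_eq_0_imp by blast

lemma add_of_nat_notin_nonpos_Ints:
  assumes "(c :: complex) \<notin> \<int>\<^sub>\<le>\<^sub>0"
  shows "c + of_nat n \<notin> \<int>\<^sub>\<le>\<^sub>0"
  using assms by (metis add_diff_cancel_right' nonpos_Ints_diff_Nats of_nat_in_Nats)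

context
  fixes a b c :: complex
  assumes c: "c \<notin> \<int>\<^sub>\<le>\<^sub>0"
begin

private lemma nonzero:
  "c \<noteq> 0" "c + 1 \<noteq> 0" "c + of_nat n \<noteq> 0" "c + 1 + of_nat n \<noteq> 0" "pochhammer
      (c + 1) n \<noteq> 0"
proof -
  show "c + of_nat n \<noteq> 0" for n by (rule add_of_nat_nonzero[OF c])
  from this[of 0] this[of 1] this[of "Suc n"]
  show "c \<noteq> 0" "c + 1 \<noteq> 0" "c + 1 + of_nat n \<noteq> 0" by (simp_all add: add_ac)
  show "pochhammer (c + 1) n \<noteq> 0"
    using add_of_nat_nonzero[OF add_of_nat_notin_nonpos_Ints[OF c, of 1]] by (auto simp:
        pochhammer_eq_0_iff eq_neg_iff_add_eq_0)

qed

private lemma pochhammer_rules: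
  "pochhammer c n = c * pochhammer (c + 1) n / (c + of_nat n)"
  "pochhammer (c + 2) n = pochhammer (c + 1) n * (c + 1 + of_nat n) / (c + 1)"
  "pochhammer x (Suc n) = x * pochhammer (x + 1) n"
  "pochhammer (x + 1) (Suc n) = pochhammer (x + 1) n * (x + 1 + of_nat n)"
proof -
  show "pochhammer (x + 1) (Suc n) = pochhammer (x + 1) n * (x + 1 + of_nat n)" for x
    by (rule pochhammer_Suc)
  show P: "pochhammer x (Suc n) = x * pochhammer (x + 1) n" for x
    by (rule pochhammer_rec)
  show "pochhammer c n = c * pochhammer (c + 1) n / (c + of_nat n)"
    using P[of c] pochhammer_Suc[of c n] nonzero(3)[of n] by (simp add: eq_divide_eq)
  show "pochhammer (c + 2) n = pochhammer (c + 1) n * (c + 1 + of_nat n) / (c + 1)"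
    using P[of "c + 1"] pochhammer_Suc[of "c + 1" n] nonzero(2) by (simp add: eq_divide_eq mult_ac add_ac)
qed

text \<open>All neighbouring series are measured against one reference coefficient
  \<open>T n\<close>, that of F(a + 1, b + 1; c + 1). A contiguous relation then becomes an identity
  of rational functions in n, settled by clearing denominators. The last two rules stay at index n
  because these series also occur behind a factor \<open>fps_X\<close>, which lowers the
  index.\<close>

private lemma nth_rules:
  defines "T \<equiv> fps_nth (hyp2F1_fps (a + 1) (b + 1) (c + 1))"
  shows "fps_nth (hyp2F1_fps a b c) (Suc n) = a * b / (c * (of_nat n + 1)) * T n"
    "fps_nth (hyp2F1_fps (a + 1) (b + 1) (c + 1)) (Suc n) =
       (a + 1 + of_nat n) * (b + 1 + of_nat n) / ((c + 1 + of_nat n) * (of_nat n + 1)) * T n"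
    "fps_nth (hyp2F1_fps (a + 1) b (c + 1)) (Suc n) =
       (a + 1 + of_nat n) * b / ((c + 1 + of_nat n) * (of_nat n + 1)) * T n"
    "fps_nth (hyp2F1_fps a (b + 1) (c + 1)) (Suc n) =
       a * (b + 1 + of_nat n) / ((c + 1 + of_nat n) * (of_nat n + 1)) * T n"
    "fps_nth (hyp2F1_fps a b (c + 1)) (Suc n) = a * b / ((c + 1 + of_nat n) * (of_nat n + 1)) * T n"
    "fps_nth (hyp2F1_fps (a + 1) b c) (Suc n) = (a + 1 + of_nat n) * b / (c * (of_nat n + 1)) * T n"
    "fps_nth (hyp2F1_fps (a + 1) (b + 1) c) (Suc n) =
       (a + 1 + of_nat n) * (b + 1 + of_nat n) / (c * (of_nat n + 1)) * T n"
    "fps_nth (hyp2F1_fps (a + 1) (b + 1) c) n = (c + of_nat n) / c * T n"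
    "fps_nth (hyp2F1_fps (a + 1) (b + 1) (c + 2)) n = (c + 1) / (c + 1 + of_nat n) * T n"
  using nonzero(1,2) nonzero(3-)[of n]
  unfolding T_def hyp2F1_fps_nth fact_Suc of_nat_mult of_nat_Suc pochhammer_rules(1,2)[of n]
      pochhammer_rules(4)
    pochhammer_rules(3)[of a] pochhammer_rules(3)[of b] pochhammer_rules(3)[of c]
  by (simp_all only: times_divide_times_eq times_divide_eq_left times_divide_eq_right
      divide_divide_eq_left divide_divide_eq_right mult_ac add.commute[of 1 "of_nat n"])

text \<open>This relation and the next two are the ones collected in
  \<open>contiguous_family\<close>. They tie the shifts (1, 1, 2), (1, 0, 1) and (0, 0, 1) to F and
  F(a + 1, b + 1; c + 1), the latter always with the factor 1 - z.\<close>

lemma hyp2F1_fps_shift_112: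
  "fps_const (c * (c + 1)) * (hyp2F1_fps a b c - (1 - fps_X) * hyp2F1_fps (a + 1) (b + 1) (c + 1)) =
     fps_const ((c - a) * (c - b)) * (fps_X * hyp2F1_fps (a + 1) (b + 1) (c + 2))" (is "?L = ?R")
proof (rule fps_eqI_0_Suc)
  fix n
  show "fps_nth ?L (Suc n) = fps_nth ?R (Suc n)"
    using nonzero(1,2) nonzero(3-)[of n] of_nat_neq_0[where 'a = complex and n = n]
    unfolding left_diff_distrib[of 1 fps_X] fps_X_mult_nth fps_mult_left_const_nth fps_add_nth
        fps_sub_nth fps_deriv_nth
      mult_1_left Suc_eq_plus1[symmetric] nat.distinct if_False diff_Suc_1 nth_rules(1-7)
          nth_rules(8,9)[of n] of_nat_Suc
    by (simp add: divide_simps add.commute[of 1 "of_nat n"], (algebra)?)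
qed (use nonzero in \<open>simp add: hyp2F1_fps_nth ring_distribs\<close>)

lemma hyp2F1_fps_shift_101:
  "fps_const c * hyp2F1_fps a b c =
     fps_const (c - b) * hyp2F1_fps (a + 1) b (c + 1) + fps_const b * ((1 - fps_X) * hyp2F1_fps (a + 1)
         (b + 1) (c + 1))" (is "?L = ?R")
proof (rule fps_eqI_0_Suc)
  fix n
  show "fps_nth ?L (Suc n) = fps_nth ?R (Suc n)"
    using nonzero(1,2) nonzero(3-)[of n] of_nat_neq_0[where 'a = complex and n = n]
    unfolding left_diff_distrib[of 1 fps_X] fps_X_mult_nth fps_mult_left_const_nth fps_add_nth
        fps_sub_nth fps_deriv_nth
      mult_1_left Suc_eq_plus1[symmetric] nat.distinct if_False diff_Suc_1 nth_rules(1-7)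
          nth_rules(8,9)[of n] of_nat_Suc
    by (simp add: divide_simps add.commute[of 1 "of_nat n"], (algebra)?)
qed (use nonzero in \<open>simp add: hyp2F1_fps_nth ring_distribs\<close>)

lemma hyp2F1_fps_shift_001:
  "fps_const ((c - a) * (c - b)) * hyp2F1_fps a b (c + 1) =
     fps_const (c * (c - a - b)) * hyp2F1_fps a b c + fps_const (a * b) * ((1 - fps_X) * hyp2F1_fps (a +
         1) (b + 1) (c + 1))" (is "?L = ?R")
proof (rule fps_eqI_0_Suc)
  fix n
  show "fps_nth ?L (Suc n) = fps_nth ?R (Suc n)"
    using nonzero(1,2) nonzero(3-)[of n] of_nat_neq_0[where 'a = complex and n = n]
    unfolding left_diff_distrib[of 1 fps_X] fps_X_mult_nth fps_mult_left_const_nth fps_add_nth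
        fps_sub_nth fps_deriv_nth
      mult_1_left Suc_eq_plus1[symmetric] nat.distinct if_False diff_Suc_1 nth_rules(1-7)
          nth_rules(8,9)[of n] of_nat_Suc
    by (simp add: divide_simps add.commute[of 1 "of_nat n"], (algebra)?)
qed (use nonzero in \<open>simp add: hyp2F1_fps_nth ring_distribs\<close>)

text \<open>The form that the (1, 1, 2) relation takes when the upper parameters are replaced by
  their complements to c; \<open>hyp2F1_fps_shift_011\<close> is the counterpart for (1, 0, 1). Both
  serve the family obtained from Euler's transformation.\<close>

lemma hyp2F1_fps_shift_112':
  "fps_const (c * (c + 1)) * (hyp2F1_fps a b c - hyp2F1_fps a b (c + 1)) =
     fps_const (a * b) * (fps_X * hyp2F1_fps (a + 1) (b + 1) (c + 2))" (is "?L = ?R")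
proof (rule fps_eqI_0_Suc)
  fix n
  show "fps_nth ?L (Suc n) = fps_nth ?R (Suc n)"
    using nonzero(1,2) nonzero(3-)[of n] of_nat_neq_0[where 'a = complex and n = n]
    unfolding left_diff_distrib[of 1 fps_X] fps_X_mult_nth fps_mult_left_const_nth fps_add_nth
        fps_sub_nth fps_deriv_nth
      mult_1_left Suc_eq_plus1[symmetric] nat.distinct if_False diff_Suc_1 nth_rules(1-7)
          nth_rules(8,9)[of n] of_nat_Suc
    by (simp add: divide_simps add.commute[of 1 "of_nat n"], (algebra)?)
qed (use nonzero in \<open>simp add: hyp2F1_fps_nth ring_distribs\<close>)

lemma hyp2F1_fps_shift_011:
  "fps_const c * hyp2F1_fps a b c =
     fps_const b * hyp2F1_fps a (b + 1) (c + 1) + fps_const (c - b) * hyp2F1_fps a b (c + 1)" (is "?L = ?R")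
proof (rule fps_eqI_0_Suc)
  fix n
  show "fps_nth ?L (Suc n) = fps_nth ?R (Suc n)"
    using nonzero(1,2) nonzero(3-)[of n] of_nat_neq_0[where 'a = complex and n = n]
    unfolding left_diff_distrib[of 1 fps_X] fps_X_mult_nth fps_mult_left_const_nth fps_add_nth
        fps_sub_nth fps_deriv_nth
      mult_1_left Suc_eq_plus1[symmetric] nat.distinct if_False diff_Suc_1 nth_rules(1-7)
          nth_rules(8,9)[of n] of_nat_Suc
    by (simp add: divide_simps add.commute[of 1 "of_nat n"], (algebra)?)
qed (use nonzero in \<open>simp add: hyp2F1_fps_nth ring_distribs\<close>)

text \<open>This and \<open>hyp2F1_fps_shift_110\<close> serve the second local solution. Its
  parameters a - c + 1, b - c + 1, 2 - c move differently: a shift (1, 0, 1) lowers the last two,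
  and a shift (0, 0, 1) lowers all three.\<close>

lemma hyp2F1_fps_shift_010:
  "fps_const (c - a - 1) * (fps_X * hyp2F1_fps (a + 1) (b + 1) (c + 1)) =
     fps_const c * (hyp2F1_fps (a + 1) b c - (1 - fps_X) * hyp2F1_fps (a + 1) (b + 1) c)" (is "?L = ?R")
proof (rule fps_eqI_0_Suc)
  fix n
  show "fps_nth ?L (Suc n) = fps_nth ?R (Suc n)"
    using nonzero(1,2) nonzero(3-)[of n] of_nat_neq_0[where 'a = complex and n = n]
    unfolding left_diff_distrib[of 1 fps_X] fps_X_mult_nth fps_mult_left_const_nth fps_add_nth
        fps_sub_nth fps_deriv_nth
      mult_1_left Suc_eq_plus1[symmetric] nat.distinct if_False diff_Suc_1 nth_rules(1-7)
          nth_rules(8,9)[of n] of_nat_Suc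
    by (simp add: divide_simps add.commute[of 1 "of_nat n"], (algebra)?)
qed (use nonzero in \<open>simp add: hyp2F1_fps_nth ring_distribs\<close>)

lemma hyp2F1_fps_shift_110:
  "fps_const c * hyp2F1_fps a b c =
     fps_const (c - 1 - a - b) * (fps_X * hyp2F1_fps (a + 1) (b + 1) (c + 1)) + fps_const c * ((1 -
         fps_X) * hyp2F1_fps (a + 1) (b + 1) c)" (is "?L = ?R")
proof (rule fps_eqI_0_Suc)
  fix n
  show "fps_nth ?L (Suc n) = fps_nth ?R (Suc n)"
    using nonzero(1,2) nonzero(3-)[of n] of_nat_neq_0[where 'a = complex and n = n]
    unfolding left_diff_distrib[of 1 fps_X] fps_X_mult_nth fps_mult_left_const_nth fps_add_nth
        fps_sub_nth fps_deriv_nth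
      mult_1_left Suc_eq_plus1[symmetric] nat.distinct if_False diff_Suc_1 nth_rules(1-7)
          nth_rules(8,9)[of n] of_nat_Suc
    by (simp add: divide_simps add.commute[of 1 "of_nat n"], (algebra)?)
qed (use nonzero in \<open>simp add: hyp2F1_fps_nth ring_distribs\<close>)

text \<open>The Euler operator multiplies the n-th coefficient by n = (c + n) - c, and raising c
  divides that coefficient by (c + n) / c. This provides the derivatives of the raised series in the
  Wronskian.\<close>

lemma hyp2F1_fps_Euler_001:
  "fps_X * fps_deriv (hyp2F1_fps a b (c + 1)) =
     fps_const c * (hyp2F1_fps a b c - hyp2F1_fps a b (c + 1))" (is "?L = ?R")
proof (rule fps_eqI_0_Suc)
  fix n
  show "fps_nth ?L (Suc n) = fps_nth ?R (Suc n)"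
    using nonzero(1,2) nonzero(3-)[of n] of_nat_neq_0[where 'a = complex and n = n]
    unfolding left_diff_distrib[of 1 fps_X] fps_X_mult_nth fps_mult_left_const_nth fps_add_nth
        fps_sub_nth fps_deriv_nth
      mult_1_left Suc_eq_plus1[symmetric] nat.distinct if_False diff_Suc_1 nth_rules(1-7)
          nth_rules(8,9)[of n] of_nat_Suc
    by (simp add: divide_simps add.commute[of 1 "of_nat n"], (algebra)?)
qed (use nonzero in \<open>simp add: hyp2F1_fps_nth ring_distribs\<close>)

end

lemma fps_deriv_hyp2F1_fps:
  assumes "c \<notin> \<int>\<^sub>\<le>\<^sub>0"
  shows "fps_const c * fps_deriv (hyp2F1_fps a b c) = fps_const (a * b) * hyp2F1_fps (a + 1) (b + 1) (c +
      1)"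
proof (rule fps_ext)
  fix n
  have "c \<noteq> 0" "c + 1 + of_nat n \<noteq> 0" using add_of_nat_nonzero[OF assms, of 0]
      add_of_nat_nonzero[OF assms, of "Suc n"]
    by (simp_all add: add_ac)
  thus "fps_nth (fps_const c * fps_deriv (hyp2F1_fps a b c)) n = fps_nth (fps_const (a * b) * hyp2F1_fps
      (a + 1) (b + 1) (c + 1)) n"
    using of_nat_neq_0[where 'a = complex and n = n]
    by (simp add: hyp2F1_fps_nth pochhammer_rec fact_Suc del: of_nat_Suc)
qed

section \<open>The three-term relation of a shift\<close>

text \<open>A family stands for one solution at all non-negative shifts of its parameters. Keeping
  only denominator-free relations lets the same recursion act on numbers, power series and Laurent
  series.\<close>

definition contiguous_family ::
    "'k :: idom \<Rightarrow> 'k \<Rightarrow> 'k \<Rightarrow> 'k \<Rightarrow> (nat \<Rightarrow> nat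
        \<Rightarrow> nat \<Rightarrow> 'k) \<Rightarrow> bool" where
  "contiguous_family \<alpha> \<beta> \<gamma> z y \<longleftrightarrow>
     (\<forall>i j k. let a = \<alpha> + of_nat i; b = \<beta> + of_nat j; c = \<gamma> + of_nat k in
        c * (c + 1) * (y i j k - (1 - z) * y (Suc i) (Suc j) (Suc k)) =
          (c - a) * (c - b) * (z * y (Suc i) (Suc j) (Suc (Suc k))) \<and>
        c * y i j k = (c - b) * y (Suc i) j (Suc k) + b * ((1 - z) * y (Suc i) (Suc j) (Suc k)) \<and>
        (c - a) * (c - b) * y i j (Suc k) =
          c * (c - a - b) * y i j k + a * b * ((1 - z) * y (Suc i) (Suc j) (Suc k)))"

lemma contiguous_family_shift:
  assumes "contiguous_family \<alpha> \<beta> \<gamma> z y"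
  shows "contiguous_family (\<alpha> + of_nat l) (\<beta> + of_nat m) (\<gamma> + of_nat n) z (\<lambda>i
      j k. y (l + i) (m + j) (n + k))"
  unfolding contiguous_family_def
proof (intro allI)
  fix i j k
  show "let a = \<alpha> + of_nat l + of_nat i; b = \<beta> + of_nat m + of_nat j; c = \<gamma> + of_nat
      n + of_nat k in
        c * (c + 1) * (y (l + i) (m + j) (n + k) - (1 - z) * y (l + Suc i) (m + Suc j) (n + Suc k)) =
          (c - a) * (c - b) * (z * y (l + Suc i) (m + Suc j) (n + Suc (Suc k))) \<and>
        c * y (l + i) (m + j) (n + k) = (c - b) * y (l + Suc i) (m + j) (n + Suc k) + b * ((1 - z) * y (l
            + Suc i) (m + Suc j) (n + Suc k)) \<and>
        (c - a) * (c - b) * y (l + i) (m + j) (n + Suc k) =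
          c * (c - a - b) * y (l + i) (m + j) (n + k) + a * b * ((1 - z) * y (l + Suc i) (m + Suc j) (n +
              Suc k))"
    using assms[unfolded contiguous_family_def, rule_format, of "l + i" "m + j" "n + k"]
    by (simp add: Let_def add.assoc)
qed

context
  fixes a b c z :: "'k :: idom" and y
  assumes y: "contiguous_family a b c z y"
begin

lemma contiguous_family_112:
  "(c - a) * (c - b) * (z * y 1 1 2) = c * (c + 1) * (y 0 0 0 - (1 - z) * y 1 1 1)"
  and contiguous_family_101: "(c - b) * y 1 0 1 = c * y 0 0 0 - b * ((1 - z) * y 1 1 1)"
  and contiguous_family_001:
    "(c - a) * (c - b) * y 0 0 1 = c * (c - a - b) * y 0 0 0 + a * b * ((1 - z) * y 1 1 1)"
  using y[unfolded contiguous_family_def, rule_format, of 0 0 0]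
  by (simp_all add: Let_def numeral_2_eq_2)

text \<open>For the hypergeometric series this is the differential equation in disguise: up to
  constants, \<open>y 1 1 1\<close> and \<open>y 2 2 2\<close> are then the first and second
  derivatives of \<open>y 0 0 0\<close>.\<close>

lemma contiguous_family_222:
  "z * ((1 - z) * ((a + 1) * (b + 1) * y 2 2 2)) =
     c * (c + 1) * y 0 0 0 - (c + 1) * (c - (a + b + 1) * z) * y 1 1 1"
proof -
  have "(c - a) * (c - b) * y 1 1 2 = (c + 1) * (c - a - b - 1) * y 1 1 1 + (a + 1) * (b + 1) * ((1 - z)
      * y 2 2 2)"
    using y[unfolded contiguous_family_def, rule_format, of 1 1 1]
    by (simp add: Let_def numeral_2_eq_2 algebra_simps)
  hence "(c - a) * (c - b) * (z * y 1 1 2) =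
      (c + 1) * (c - a - b - 1) * z * y 1 1 1 + (a + 1) * (b + 1) * (z * (1 - z) * y 2 2 2)"
    by algebra
  with contiguous_family_112 show ?thesis by algebra
qed

text \<open>After a step (1, 0, 1) the new base pair is \<open>y 1 0 1\<close>,
  \<open>y 2 1 2\<close>; with \<open>contiguous_family_101\<close> this gives the matrix of the
  step over the old pair. \<open>contiguous_family_223\<close> does the same for (1, 1, 2).\<close>

lemma contiguous_family_212:
  "(c - b) * (a + 1) * (z * y 2 1 2) = (c + 1) * ((c - b * z) * y 1 1 1 - c * y 0 0 0)"
proof -
  have "(c - b) * y 2 1 2 = (c + 1) * y 1 1 1 - (b + 1) * ((1 - z) * y 2 2 2)"
    using y[unfolded contiguous_family_def, rule_format, of 1 1 1]
    by (simp add: Let_def numeral_2_eq_2 algebra_simps)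
  thus ?thesis using contiguous_family_222 by algebra
qed

lemma contiguous_family_223:
  "(c - a) * (c - b) * (a + 1) * (b + 1) * (z * (z * y 2 2 3)) =
     (c + 1) * (c + 2) * (((a + 1) * (b + 1) * z + (c + 1) * (c - (a + b + 1) * z)) * y 1 1 1
       - c * (c + 1) * y 0 0 0)"
proof -
  have "(c - a) * (c - b) * (z * y 2 2 3) = (c + 1) * (c + 2) * (y 1 1 1 - (1 - z) * y 2 2 2)"
    using y[unfolded contiguous_family_def, rule_format, of 1 1 1]
    by (simp add: Let_def numeral_2_eq_2 numeral_3_eq_3 algebra_simps)
  thus ?thesis using contiguous_family_222 by algebra
qed

end

text \<open>
  A list of steps describes the shift that applies its elements and then a final step \<open>(1, 1, 2)\<close>.
  The coefficients are obtained by prepending a step, so the parameters of the recursive calls are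
  the shifted ones.
\<close>

datatype contiguous_step = Step101 | Step112 | Step001

text \<open>Each clause multiplies by the matrix of one step. The coefficient of the shifted
  solution is stored without its factor 1 - z, which persists through the recursion; taking it out
  keeps the degree of \<open>coefP\<close> in z at the number of steps.\<close>

fun coefU coefP :: "contiguous_step list \<Rightarrow> 'k :: idom \<Rightarrow> 'k \<Rightarrow> 'k
    \<Rightarrow> 'k \<Rightarrow> 'k" where
  "coefU [] a b c z = c * (c + 1)"
| "coefU (Step101 # ss) a b c z =
     c * ((a + 1) * z * coefU ss (a + 1) b (c + 1) z - (1 - z) * (c + 1) * coefP ss (a + 1) b (c + 1) z)"
| "coefU (Step112 # ss) a b c z =
     c * (c + 1) * ((a + 1) * (b + 1) * z * coefU ss (a + 1) (b + 1) (c + 2) z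
       - (1 - z) * (c + 1) * (c + 2) * coefP ss (a + 1) (b + 1) (c + 2) z)"
| "coefU (Step001 # ss) a b c z =
     c * ((c - a - b) * z * coefU ss a b (c + 1) z + (1 - z) * (c + 1) * coefP ss a b (c + 1) z)"
| "coefP [] a b c z = - (c * (c + 1))"
| "coefP (Step101 # ss) a b c z =
     (c + 1) * (c - b * z) * coefP ss (a + 1) b (c + 1) z - (a + 1) * b * z * coefU ss (a + 1) b (c + 1) z"
| "coefP (Step112 # ss) a b c z =
     (c + 1) * (c + 2) * ((a + 1) * (b + 1) * z + (c + 1) * (c - (a + b + 1) * z)) *
         coefP ss (a + 1) (b + 1) (c + 2) z
       - (a + 1) * (b + 1) * c * (c + 1) * z * coefU ss (a + 1) (b + 1) (c + 2) z"
| "coefP (Step001 # ss) a b c z =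
     a * b * z * coefU ss a b (c + 1) z - c * (c + 1) * (1 - z) * coefP ss a b (c + 1) z"

fun coefD :: "contiguous_step list \<Rightarrow> 'k :: idom \<Rightarrow> 'k \<Rightarrow> 'k
    \<Rightarrow> 'k" where
  "coefD [] a b c = (c - a) * (c - b)"
| "coefD (Step101 # ss) a b c = (c - b) * (a + 1) * coefD ss (a + 1) b (c + 1)"
| "coefD (Step112 # ss) a b c =
     (c - a) * (c - b) * (a + 1) * (b + 1) * coefD ss (a + 1) (b + 1) (c + 2)"
| "coefD (Step001 # ss) a b c = (c - a) * (c - b) * coefD ss a b (c + 1)"

fun shiftA shiftB shiftC :: "contiguous_step list \<Rightarrow> nat" where
  "shiftA [] = 1"
| "shiftA (Step101 # ss) = Suc (shiftA ss)"
| "shiftA (Step112 # ss) = Suc (shiftA ss)"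
| "shiftA (Step001 # ss) = shiftA ss"
| "shiftB [] = 1"
| "shiftB (Step101 # ss) = shiftB ss"
| "shiftB (Step112 # ss) = Suc (shiftB ss)"
| "shiftB (Step001 # ss) = shiftB ss"
| "shiftC [] = 2"
| "shiftC (Step101 # ss) = Suc (shiftC ss)"
| "shiftC (Step112 # ss) = Suc (Suc (shiftC ss))"
| "shiftC (Step001 # ss) = Suc (shiftC ss)"

lemma contiguous_steps_induct [case_names Nil Step101 Step112 Step001]:
  assumes "P []" "\<And>ss. P ss \<Longrightarrow> P (Step101 # ss)" "\<And>ss. P ss \<Longrightarrow> P
      (Step112 # ss)"
    "\<And>ss. P ss \<Longrightarrow> P (Step001 # ss)"
  shows "P ss"
proof (induction ss)
  case (Cons s ss)
  thus ?case by (cases s) (use assms in auto)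
qed (rule assms)

lemma shiftC_pos: "shiftC ss = Suc (shiftC ss - 1)"
  by (induction ss rule: contiguous_steps_induct) auto

lemma contiguous_family_relation:
  assumes "contiguous_family a b c z y"
  shows "coefD ss a b c * (z ^ (shiftC ss - 1) * y (shiftA ss) (shiftB ss) (shiftC ss)) =
           coefU ss a b c z * y 0 0 0 + (1 - z) * coefP ss a b c z * y 1 1 1"
  using assms
proof (induction ss a b c arbitrary: y rule: coefD.induct)
  case (1 a b c y)
  thus ?case using contiguous_family_112[of a b c z y] by (simp add: algebra_simps)
next
  case (2 ss a b c y)
  note y = 2(2)
  let ?U = "coefU ss (a + 1) b (c + 1) z" and ?P = "coefP ss (a + 1) b (c + 1) z"
  let ?D = "coefD ss (a + 1) b (c + 1)" and ?y = "y (Suc (shiftA ss)) (shiftB ss) (Suc (shiftC ss))"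
  have "?D * (z ^ (shiftC ss - 1) * ?y) = ?U * y 1 0 1 + (1 - z) * ?P * y 2 1 2"
    using 2(1)[OF contiguous_family_shift[OF y, of 1 0 1, simplified]] by (simp add: numeral_2_eq_2)
  \<comment> \<open>The multiplier consists of the factors with which \<open>y 1 0 1\<close> and
    \<open>y 2 1 2\<close> occur in the elementary relations, so both can be replaced by the old
    base pair.\<close>
  hence "(c - b) * (a + 1) * ?D * (z ^ Suc (shiftC ss - 1) * ?y) =
      (a + 1) * z * ?U * ((c - b) * y 1 0 1) + (1 - z) * ?P * ((c - b) * (a + 1) * (z * y 2 1 2))"
    by (drule_tac arg_cong[where f = "\<lambda>t. (c - b) * (a + 1) * (z) * t"]) (simp add: algebra_simps)
  thus ?case using shiftC_pos[of ss]
    unfolding contiguous_family_212[OF y] contiguous_family_101[OF y]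
    by (simp add: algebra_simps)
next
  case (3 ss a b c y)
  note y = 3(2)
  let ?U = "coefU ss (a + 1) (b + 1) (c + 2) z" and ?P = "coefP ss (a + 1) (b + 1) (c + 2) z"
  let ?D = "coefD ss (a + 1) (b + 1) (c + 2)"
  let ?y = "y (Suc (shiftA ss)) (Suc (shiftB ss)) (Suc (Suc (shiftC ss)))"
  have "?D * (z ^ (shiftC ss - 1) * ?y) = ?U * y 1 1 2 + (1 - z) * ?P * y 2 2 3"
    using 3(1)[OF contiguous_family_shift[OF y, of 1 1 2, simplified]]
    by (simp add: numeral_2_eq_2 numeral_3_eq_3)
  \<comment> \<open>Here z enters squared, since only z^2 times \<open>y 2 2 3\<close> is
    expressible without denominators; this matches the growth of \<open>shiftC\<close> by
    two.\<close>
  hence "(c - a) * (c - b) * (a + 1) * (b + 1) * ?D * (z ^ Suc (Suc (shiftC ss - 1)) * ?y) =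
      (a + 1) * (b + 1) * z * ?U * ((c - a) * (c - b) * (z * y 1 1 2)) +
      (1 - z) * ?P * ((c - a) * (c - b) * (a + 1) * (b + 1) * (z * (z * y 2 2 3)))"
    by (drule_tac arg_cong[where f = "\<lambda>t. (c - a) * (c - b) * (a + 1) * (b + 1) * (z * z) * t"])
        (simp add: algebra_simps)
  thus ?case using shiftC_pos[of ss]
    unfolding contiguous_family_223[OF y] contiguous_family_112[OF y]
    by (simp add: algebra_simps)
next
  case (4 ss a b c y)
  note y = 4(2)
  let ?U = "coefU ss a b (c + 1) z" and ?P = "coefP ss a b (c + 1) z"
  let ?D = "coefD ss a b (c + 1)" and ?y = "y (shiftA ss) (shiftB ss) (Suc (shiftC ss))"
  have "?D * (z ^ (shiftC ss - 1) * ?y) = ?U * y 0 0 1 + (1 - z) * ?P * y 1 1 2"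
    using 4(1)[OF contiguous_family_shift[OF y, of 0 0 1, simplified]] by (simp add: numeral_2_eq_2)
  hence "(c - a) * (c - b) * ?D * (z ^ Suc (shiftC ss - 1) * ?y) =
      z * ?U * ((c - a) * (c - b) * y 0 0 1) + (1 - z) * ?P * ((c - a) * (c - b) * (z * y 1 1 2))"
    by (drule_tac arg_cong[where f = "\<lambda>t. (c - a) * (c - b) * (z) * t"]) (simp add: algebra_simps)
  thus ?case using shiftC_pos[of ss]
    unfolding contiguous_family_112[OF y] contiguous_family_001[OF y]
    by (simp add: algebra_simps)
qed

text \<open>The coefficients are built from ring operations and small integers, so one definition
  serves the generic variables, the line and the formal series.\<close>

lemma coef_hom:
  fixes \<phi> :: "'k :: idom \<Rightarrow> 'l :: idom"
  assumes "\<And>x y. \<phi> (x + y) = \<phi> x + \<phi> y" "\<And>x y. \<phi> (x * y) = \<phi> x *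
      \<phi> y" "\<phi> 1 = 1"
  shows "\<phi> (coefU ss a b c z) = coefU ss (\<phi> a) (\<phi> b) (\<phi> c) (\<phi> z)"
    and "\<phi> (coefP ss a b c z) = coefP ss (\<phi> a) (\<phi> b) (\<phi> c) (\<phi> z)"
    and "\<phi> (coefD ss a b c) = coefD ss (\<phi> a) (\<phi> b) (\<phi> c)"
proof -
  have 2: "\<phi> 2 = 2" using assms(1)[of 1 1] assms(3) by simp
  have 0: "\<phi> 0 = 0" using assms(1)[of 0 0] by (metis add.right_neutral add_left_cancel)
  have m: "\<phi> (- x) = - \<phi> x" for x using assms(1)[of x "- x"] 0 by (simp add:
      eq_neg_iff_add_eq_0 add.commute)
  have d: "\<phi> (x - y) = \<phi> x - \<phi> y" for x y using assms(1)[of x "- y"] m by simp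
  show "\<phi> (coefU ss a b c z) = coefU ss (\<phi> a) (\<phi> b) (\<phi> c) (\<phi> z)"
    and "\<phi> (coefP ss a b c z) = coefP ss (\<phi> a) (\<phi> b) (\<phi> c) (\<phi> z)"
    by (induction ss a b c z and ss a b c z rule: coefU_coefP.induct) (simp_all only: coefU.simps
        coefP.simps assms 2 m d)
  show "\<phi> (coefD ss a b c) = coefD ss (\<phi> a) (\<phi> b) (\<phi> c)"
    by (induction ss a b c rule: coefD.induct) (simp_all only: coefD.simps assms 2 m d)
qed

text \<open>The common degree of the coefficients in \<open>(a, b, c)\<close>; their degree in \<open>z\<close> is the number of steps.\<close>

fun coef_degree :: "contiguous_step list \<Rightarrow> nat" where
  "coef_degree [] = 2"
| "coef_degree (Step101 # ss) = coef_degree ss + 2"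
| "coef_degree (Step112 # ss) = coef_degree ss + 4"
| "coef_degree (Step001 # ss) = coef_degree ss + 2"

lemma degree_bounds:
  fixes p q :: "'a :: idom poly"
  shows "degree p \<le> m \<Longrightarrow> degree q \<le> n \<Longrightarrow> degree (p * q) \<le> m + n"
    "degree p \<le> m \<Longrightarrow> degree q \<le> n \<Longrightarrow> degree (p + q) \<le> max m n"
    "degree p \<le> m \<Longrightarrow> degree q \<le> n \<Longrightarrow> degree (p - q) \<le> max m n"
    "degree p \<le> m \<Longrightarrow> degree (- p) \<le> m"
    "degree (1 :: 'a poly) \<le> 0" "degree (2 :: 'a poly) \<le> 0"
  by (auto intro: degree_add_le degree_diff_le order.trans[OF degree_mult_le])

text \<open>Two weights in one induction: s = 0 and t = 1 give the degree in z, while s = 1 and t =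
  0 give the degree in w along the line.\<close>

lemma degree_coef:
  fixes a b c z :: "'a :: idom poly"
  assumes "degree a \<le> s" "degree b \<le> s" "degree c \<le> s" "degree z \<le> t"
  shows "degree (coefU ss a b c z) \<le> s * coef_degree ss + t * length ss \<and>
         degree (coefP ss a b c z) \<le> s * coef_degree ss + t * length ss"
  using assms
proof (induction ss a b c rule: coefD.induct)
  case (1 a b c)
  show ?case unfolding coefU.simps coefP.simps
    by (intro conjI; rule order.trans, (rule degree_bounds 1)+, simp)
next
  case (2 ss a b c)
  have "degree (a + 1) \<le> s" "degree (c + 1) \<le> s" using 2 by (auto intro!: degree_add_le)
  note IH = 2(1)[OF this(1) 2(3) this(2) 2(5)]
  show ?case unfolding coefU.simps coefP.simps
    by (intro conjI; rule order.trans, (rule degree_bounds 2(2-) IH[THEN conjunct1] IH[THEN conjunct2])+,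
        simp add: algebra_simps)
next
  case (3 ss a b c)
  have "degree (a + 1) \<le> s" "degree (b + 1) \<le> s" "degree (c + 2) \<le> s" using 3 by (auto
      intro!: degree_add_le)
  note IH = 3(1)[OF this 3(5)]
  show ?case unfolding coefU.simps coefP.simps
    by (intro conjI; rule order.trans, (rule degree_bounds 3(2-) IH[THEN conjunct1] IH[THEN conjunct2])+,
        simp add: algebra_simps)
next
  case (4 ss a b c)
  have "degree (c + 1) \<le> s" using 4 by (auto intro!: degree_add_le)
  note IH = 4(1)[OF 4(2,3) this 4(5)]
  show ?case unfolding coefU.simps coefP.simps
    by (intro conjI; rule order.trans, (rule degree_bounds 4(2-) IH[THEN conjunct1] IH[THEN conjunct2])+,
        simp add: algebra_simps)
qed

text \<open>An exact degree is required, because this factor multiplies \<open>Phi\<close> in the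
  relation from which the degree of \<open>Phi\<close> is bounded.\<close>

lemma degree_coefD:
  fixes a b c :: "'a :: idom poly"
  assumes "degree a = 1" "degree b = 1" "degree (c - a) = 1" "degree (c - b) = 1"
  shows "degree (coefD ss a b c) = coef_degree ss"
proof -
  have plus1: "degree (p + 1) = 1" if "degree p = 1" for p :: "'a poly"
    using that degree_add_eq_left[of 1 p] by simp
  have nz: "p \<noteq> 0" if "degree p = 1" for p :: "'a poly" using that by auto
  have "coefD ss a b c \<noteq> 0 \<and> degree (coefD ss a b c) = coef_degree ss"
    using assms
  proof (induction ss a b c rule: coefD.induct)
    case (1 a b c)
    thus ?case using nz[of "c - a"] nz[of "c - b"] by (simp add: degree_mult_eq)
  next
    case (2 ss a b c)
    have "c + 1 - (a + 1) = c - a" "c + 1 - b = (c - b) + 1" by simp_all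
    with 2 show ?case using plus1[of a] plus1[of "c - b"] nz[of "a + 1"] nz[of "c - b"] by (simp add:
        degree_mult_eq)
  next
    case (3 ss a b c)
    have "c + 2 - (a + 1) = (c - a) + 1" "c + 2 - (b + 1) = (c - b) + 1" by simp_all
    with 3 show ?case using plus1[of a] plus1[of b] nz[of "a + 1"] nz[of "b + 1"] nz[of "c - a"] nz[of "c
        - b"]
        plus1[of "c - a"] plus1[of "c - b"]
      by (simp add: degree_mult_eq)
  next
    case (4 ss a b c)
    have "c + 1 - a = (c - a) + 1" "c + 1 - b = (c - b) + 1" by simp_all
    with 4 show ?case using nz[of "c - a"] nz[of "c - b"] plus1[of "c - a"] plus1[of "c - b"] by (simp
        add: degree_mult_eq)
  qed
  thus ?thesis ..
qed

section \<open>Elimination of the first coefficient\<close>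

text \<open>Once the derivatives are expressed through the four series themselves, the derivative of
  the left-hand side cancels; the constant is read off at z = 0. By Euler's transformation, F(1 - a,
  1 - b; 2 - c) belongs to the second local solution.\<close>

lemma hyp2F1_fps_wronskian:
  assumes c: "c \<notin> \<int>"
  shows "fps_const (c * (1 - c)) * ((1 - fps_X) * (hyp2F1_fps a b c * hyp2F1_fps (1 - a) (1 - b) (1 - c))) -
         fps_const ((c - a) * (c - b)) * (fps_X * (hyp2F1_fps a b (c + 1) * hyp2F1_fps (1 - a) (1 - b) (2
             - c))) =
         fps_const (c * (1 - c))" (is "?L = _")
proof -
  have nn: "c \<notin> \<int>\<^sub>\<le>\<^sub>0" "1 - c \<notin> \<int>\<^sub>\<le>\<^sub>0"
  proof -
    show "c \<notin> \<int>\<^sub>\<le>\<^sub>0" using c nonpos_Ints_subset_Ints by blast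
    have "1 - c \<notin> \<int>" using c by (metis Ints_1 Ints_diff diff_diff_eq2 add_diff_cancel_left')
    thus "1 - c \<notin> \<int>\<^sub>\<le>\<^sub>0" using nonpos_Ints_subset_Ints by blast
  qed
  have "c \<noteq> 0" "1 - c \<noteq> 0" using c by auto
  define F F1 G G1 where "F = hyp2F1_fps a b c" and "F1 = hyp2F1_fps a b (c + 1)"
    and "G = hyp2F1_fps (1 - a) (1 - b) (1 - c)" and "G1 = hyp2F1_fps (1 - a) (1 - b) (2 - c)"
  define A B C where "A = fps_const a" and "B = fps_const b" and "C = fps_const c"
  define F11 G11 where "F11 = hyp2F1_fps (a + 1) (b + 1) (c + 1)"
    and "G11 = hyp2F1_fps (1 - a + 1) (1 - b + 1) (1 - c + 1)"
  have G1: "hyp2F1_fps (1 - a) (1 - b) (1 - c + 1) = G1" by (simp add: G1_def add.commute)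
  note defs = F_def F1_def G_def G1_def A_def B_def C_def
  have hom: "fps_const (x * y) = fps_const x * fps_const y" "fps_const (x + y) = fps_const x + fps_const y"
    "fps_const (x - y) = fps_const x - fps_const y" for x y :: complex by simp_all
  \<comment> \<open>Eliminating F(a + 1, b + 1; c + 1) between the derivative formula and the (0, 0,
    1) relation leaves only series that occur in the claim.\<close>
  have dF: "C * ((1 - fps_X) * fps_deriv F) = (C - A) * (C - B) * F1 - C * (C - A - B) * F"
  proof -
    have "C * fps_deriv F = A * B * F11"
      using fps_deriv_hyp2F1_fps[OF nn(1), of a b] unfolding A_def B_def C_def F_def F11_def hom .
    moreover have "(C - A) * (C - B) * F1 = C * (C - A - B) * F + A * B * ((1 - fps_X) * F11)"
      using hyp2F1_fps_shift_001[OF nn(1), of a b] unfolding A_def B_def C_def F_def F1_def F11_def hom .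
    ultimately show ?thesis by algebra
  qed
  have dG: "(1 - C) * ((1 - fps_X) * fps_deriv G) = (C - A) * (C - B) * G1 + (1 - C) * (1 + C - A - B) * G"
  proof -
    have "(1 - C) * fps_deriv G = (1 - A) * (1 - B) * G11"
      using fps_deriv_hyp2F1_fps[OF nn(2), of "1 - a" "1 - b"]
      unfolding A_def B_def C_def G_def G11_def hom fps_const_1_eq_1 .
    moreover have "(1 - C - (1 - A)) * (1 - C - (1 - B)) * G1 =
        (1 - C) * (1 - C - (1 - A) - (1 - B)) * G + (1 - A) * (1 - B) * ((1 - fps_X) * G11)"
      using hyp2F1_fps_shift_001[OF nn(2), of "1 - a" "1 - b"]
      unfolding G1 unfolding A_def B_def C_def G_def G11_def hom fps_const_1_eq_1 .
    ultimately show ?thesis by algebra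
  qed
  have dF1: "fps_X * fps_deriv F1 = C * (F - F1)"
    using hyp2F1_fps_Euler_001[OF nn(1), of a b] unfolding defs .
  have dG1: "fps_X * fps_deriv G1 = (1 - C) * (G - G1)"
    using hyp2F1_fps_Euler_001[OF nn(2), of "1 - a" "1 - b"] unfolding G1 unfolding G_def C_def hom
        fps_const_1_eq_1 .
  have [simp]: "fps_deriv A = 0" "fps_deriv B = 0" "fps_deriv C = 0" by (simp_all add: A_def B_def C_def)
  have "fps_deriv (C * (1 - C) * ((1 - fps_X) * (F * G)) - (C - A) * (C - B) * (fps_X * (F1 * G1))) =
      C * (1 - C) * ((1 - fps_X) * (F * fps_deriv G + fps_deriv F * G) - F * G) -
      (C - A) * (C - B) * (fps_X * (F1 * fps_deriv G1 + fps_deriv F1 * G1) + F1 * G1)"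
    by simp
  also have "\<dots> = (1 - C) * G * (C * ((1 - fps_X) * fps_deriv F)) + C * F * ((1 - C) * ((1 - fps_X)
      * fps_deriv G))
      - C * (1 - C) * (F * G) - (C - A) * (C - B) * (F1 * G1 + G1 * (fps_X * fps_deriv F1) + F1 * (fps_X
          * fps_deriv G1))"
    by algebra
  also have "\<dots> = 0" unfolding dF dG dF1 dG1 by algebra
  finally have "fps_deriv ?L = 0" by (simp only: defs hom fps_const_1_eq_1)
  hence "?L = fps_const (fps_nth ?L 0)" by (simp only: fps_deriv_eq_0_iff)
  also have "fps_nth ?L 0 = c * (1 - c)" by (simp add: hyp2F1_fps_nth)
  finally show ?thesis .
qed

lemma fls_const_hom:
  "fls_const (x * y) = fls_const x * fls_const (y :: 'a :: comm_ring_1)" "fls_const (x + y) = fls_const x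
      + fls_const y"
  "fls_const (x - y) = fls_const x - fls_const y" "fls_const (of_nat n) = (of_nat n :: 'a fls)"
  by (simp_all add: fls_plus_const fls_minus_const fls_of_nat)

lemma fps_to_fls_hom:
  "fps_to_fls (f * g) = fps_to_fls f * fps_to_fls (g :: 'a :: comm_ring_1 fps)"
  "fps_to_fls fps_X = (fls_X :: 'a fls)" "fps_to_fls (1 :: 'a fps) = 1"
  by (simp_all add: fls_times_fps_to_fls)

text \<open>
  By Euler's transformation the next family is \<open>F(\<alpha>, \<beta>; \<gamma>; z)\<close> divided by the power
  \<open>(1 - z)\<^bsup>\<gamma> - \<alpha> - \<beta>\<^esup>\<close> of the base point; only integer powers of \<open>1 - z\<close> remain.
\<close>

lemma contiguous_family_dual:
  fixes \<alpha> \<beta> \<gamma> :: complex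
  assumes \<gamma>: "\<gamma> \<notin> \<int>\<^sub>\<le>\<^sub>0"
  defines "y \<equiv> (\<lambda>i j k. (1 - fls_X) ^ k / (1 - fls_X) ^ (i + j) *
              fps_to_fls (hyp2F1_fps (\<gamma> + of_nat k - (\<alpha> + of_nat i)) (\<gamma> + of_nat k -
                  (\<beta> + of_nat j)) (\<gamma> + of_nat k)))"
  shows "contiguous_family (fls_const \<alpha>) (fls_const \<beta>) (fls_const \<gamma>) fls_X y"
  unfolding contiguous_family_def Let_def
proof (intro allI)
  fix i j k
  define a b c where "a = \<gamma> + of_nat k - (\<alpha> + of_nat i)" and "b = \<gamma> + of_nat k -
      (\<beta> + of_nat j)"
    and "c = \<gamma> + of_nat k"
  define w :: "complex fls" where "w = 1 - fls_X"
  \<comment> \<open>The lowest power of \<open>w\<close> among the five members, so that each is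
    \<open>V\<close> times a non-negative power of \<open>w\<close> and a series.\<close>
  define V where "V = w ^ k / w ^ Suc (i + j)"
  define h where "h i j k = fps_to_fls (hyp2F1_fps (a + of_nat i) (b + of_nat j) (c + of_nat k))" for i j k
  have w: "w \<noteq> 0"
  proof
    assume "w = 0"
    hence "fls_nth w 0 = 0" by simp
    thus False by (simp add: w_def)
  qed
  have y: "y i j k = w * V * h 0 0 0" "y (Suc i) (Suc j) (Suc k) = V * h 0 0 1"
    "y (Suc i) (Suc j) (Suc (Suc k)) = w * V * h 1 1 2" "y (Suc i) j (Suc k) = w * V * h 0 1 1"
    "y i j (Suc k) = w * w * V * h 1 1 1"
    unfolding y_def w_def[symmetric] V_def h_def a_def b_def c_def using w by (simp_all add: algebra_simps)
  have c: "c \<notin> \<int>\<^sub>\<le>\<^sub>0" unfolding c_def using \<gamma> by (rule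
      add_of_nat_notin_nonpos_Ints)
  define A B C where "A = fls_const a" and "B = fls_const b" and "C = fls_const c"
  \<comment> \<open>Here \<open>a\<close> and \<open>b\<close> are the parameters of the transformed
    series; those of the family are their complements to \<open>c\<close>.\<close>
  have pars: "fls_const \<alpha> + of_nat i = C - A" "fls_const \<beta> + of_nat j = C - B" "fls_const
      \<gamma> + of_nat k = C"
    unfolding A_def B_def C_def a_def b_def c_def fls_const_hom by simp_all
  have h: "hyp2F1_fps a b c = hyp2F1_fps (a + of_nat 0) (b + of_nat 0) (c + of_nat 0)"
    "hyp2F1_fps a b (c + 1) = hyp2F1_fps (a + of_nat 0) (b + of_nat 0) (c + of_nat 1)"
    "hyp2F1_fps a (b + 1) (c + 1) = hyp2F1_fps (a + of_nat 0) (b + of_nat 1) (c + of_nat 1)"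
    "hyp2F1_fps (a + 1) (b + 1) (c + 1) = hyp2F1_fps (a + of_nat 1) (b + of_nat 1) (c + of_nat 1)"
    "hyp2F1_fps (a + 1) (b + 1) (c + 2) = hyp2F1_fps (a + of_nat 1) (b + of_nat 1) (c + of_nat 2)"
    by simp_all
  note rel = hyp2F1_fps_shift_112'[OF c, of a b] hyp2F1_fps_shift_011[OF c, of a b]
      hyp2F1_fps_shift_001[OF c, of a b]
  note rel = rel[unfolded h, THEN arg_cong[where f = fps_to_fls], unfolded fps_to_fls_hom fps_to_fls_plus
      fps_to_fls_minus fps_const_to_fls fls_const_hom(1-3) fls_const_1, folded h_def A_def B_def C_def
          w_def]
  show "(fls_const \<gamma> + of_nat k) * (fls_const \<gamma> + of_nat k + 1) * (y i j k - (1 - fls_X) *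
      y (Suc i) (Suc j) (Suc k)) =
        (fls_const \<gamma> + of_nat k - (fls_const \<alpha> + of_nat i)) * (fls_const \<gamma> + of_nat
            k - (fls_const \<beta> + of_nat j)) *
        (fls_X * y (Suc i) (Suc j) (Suc (Suc k))) \<and>
        (fls_const \<gamma> + of_nat k) * y i j k =
        (fls_const \<gamma> + of_nat k - (fls_const \<beta> + of_nat j)) * y (Suc i) j (Suc k) +
        (fls_const \<beta> + of_nat j) * ((1 - fls_X) * y (Suc i) (Suc j) (Suc k)) \<and>
        (fls_const \<gamma> + of_nat k - (fls_const \<alpha> + of_nat i)) * (fls_const \<gamma> + of_nat
            k - (fls_const \<beta> + of_nat j)) * y i j (Suc k) =
        (fls_const \<gamma> + of_nat k) * (fls_const \<gamma> + of_nat k - (fls_const \<alpha> + of_nat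
            i) - (fls_const \<beta> + of_nat j)) * y i j k +
        (fls_const \<alpha> + of_nat i) * (fls_const \<beta> + of_nat j) * ((1 - fls_X) * y (Suc i) (Suc
            j) (Suc k))"
    unfolding pars y w_def[symmetric] using rel by (intro conjI) algebra+
qed

text \<open>
  The normalisation that makes \<open>z\<^bsup>1 - \<gamma>\<^esup> F(\<alpha> - \<gamma> + 1, \<beta> - \<gamma> + 1; 2 - \<gamma>; z)\<close> satisfy the same contiguous
  relations as \<open>F(\<alpha>, \<beta>; \<gamma>; z)\<close>. The factor \<open>z\<^bsup>1 - \<gamma>\<^esup>\<close> of the base point is dropped below.
\<close>

definition gamma_factor :: "complex \<Rightarrow> complex \<Rightarrow> complex \<Rightarrow> complex" where
  "gamma_factor a b c =
     Gamma c * Gamma (a - c + 1) * Gamma (b - c + 1) / (Gamma a * Gamma b * Gamma (2 - c))"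

text \<open>All three ratios follow from the functional equation of Gamma; non-integral arguments
  keep every Gamma value nonzero and away from the poles.\<close>

lemma gamma_factor_shift:
  assumes "a \<notin> \<int>" "b \<notin> \<int>" "c \<notin> \<int>" "c - a \<notin> \<int>" "c - b
      \<notin> \<int>"
  shows "a * b * gamma_factor (a + 1) (b + 1) (c + 1) = c * (1 - c) * gamma_factor a b c"
    and "a * (b - c) * gamma_factor (a + 1) b (c + 1) = c * (1 - c) * gamma_factor a b c"
    and "(a - c) * (b - c) * gamma_factor a b (c + 1) = c * (1 - c) * gamma_factor a b c"
    and "gamma_factor a b c \<noteq> 0"
proof -
  have plus1: "Gamma (t + 1) = t * Gamma t" "Gamma t \<noteq> 0" "t \<noteq> 0" if "t \<notin> \<int>"
      for t :: complex
  proof -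
    have "t \<notin> \<int>\<^sub>\<le>\<^sub>0" using that nonpos_Ints_subset_Ints by blast
    thus "Gamma (t + 1) = t * Gamma t" "Gamma t \<noteq> 0" "t \<noteq> 0"
      by (auto simp: Gamma_plus1 Gamma_eq_zero_iff)
  qed
  have "a - c \<notin> \<int>" "b - c \<notin> \<int>" "1 - c \<notin> \<int>"
    using assms Ints_minus[of "a - c"] Ints_minus[of "b - c"] Ints_diff[of 1 "1 - c"] by auto
  note P = this[THEN plus1(1)] assms(1-3)[THEN plus1(1)] this[THEN plus1(2)] assms(1-3)[THEN plus1(2)]
    this[THEN plus1(3)] assms(1-3)[THEN plus1(3)]
  have arg: "a + 1 - (c + 1) + 1 = a - c + 1" "b + 1 - (c + 1) + 1 = b - c + 1" "2 - c = (1 - c) + 1"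
    "2 - (c + 1) = 1 - c" "a - (c + 1) + 1 = a - c" "b - (c + 1) + 1 = b - c" by simp_all
  show "a * b * gamma_factor (a + 1) (b + 1) (c + 1) = c * (1 - c) * gamma_factor a b c"
    and "a * (b - c) * gamma_factor (a + 1) b (c + 1) = c * (1 - c) * gamma_factor a b c"
    and "(a - c) * (b - c) * gamma_factor a b (c + 1) = c * (1 - c) * gamma_factor a b c"
    and "gamma_factor a b c \<noteq> 0"
    unfolding gamma_factor_def arg P(1-6) using P(7-) by (simp_all add: divide_simps)
qed

lemma Ints_add_of_nat_iff: "x + of_nat n \<in> \<int> \<longleftrightarrow> (x :: complex) \<in> \<int>"
  by (metis Ints_add Ints_diff Ints_of_nat add_diff_cancel_right')

lemma contiguous_family_second:
  fixes \<alpha> \<beta> \<gamma> :: complex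
  assumes "\<alpha> \<notin> \<int>" "\<beta> \<notin> \<int>" "\<gamma> \<notin> \<int>" "\<gamma> -
      \<alpha> \<notin> \<int>" "\<gamma> - \<beta> \<notin> \<int>"
  defines "y \<equiv> (\<lambda>i j k. fls_const (gamma_factor (\<alpha> + of_nat i) (\<beta> + of_nat j)
      (\<gamma> + of_nat k)) / fls_X ^ k *
              fps_to_fls (hyp2F1_fps (\<alpha> + of_nat i - (\<gamma> + of_nat k) + 1) (\<beta> + of_nat
                  j - (\<gamma> + of_nat k) + 1) (2 - (\<gamma> + of_nat k))))"
  shows "contiguous_family (fls_const \<alpha>) (fls_const \<beta>) (fls_const \<gamma>) fls_X y"
  unfolding contiguous_family_def Let_def
proof (intro allI)
  fix i j k
  define a b c where "a = \<alpha> + of_nat i" and "b = \<beta> + of_nat j" and "c = \<gamma> + of_nat k"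
  have "c - a + of_nat i = \<gamma> - \<alpha> + of_nat k" "c - b + of_nat j = \<gamma> - \<beta> +
      of_nat k"
    by (simp_all add: a_def b_def c_def)
  hence "c - a \<notin> \<int>" "c - b \<notin> \<int>" using assms(4,5) by (metis Ints_add_of_nat_iff)+
  moreover have "a \<notin> \<int>" "b \<notin> \<int>" "c \<notin> \<int>"
    using assms(1-3) by (simp_all add: a_def b_def c_def Ints_add_of_nat_iff)
  ultimately have gen: "a \<notin> \<int>" "b \<notin> \<int>" "c \<notin> \<int>" "c - a \<notin>
      \<int>" "c - b \<notin> \<int>" by blast+
  have gen1: "a + 1 \<notin> \<int>" "b + 1 \<notin> \<int>" "c + 1 \<notin> \<int>" "c + 1 - (a + 1)
      \<notin> \<int>" "c + 1 - (b + 1) \<notin> \<int>"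
    using gen Ints_add_of_nat_iff[of _ 1] by simp_all
  define N N1 N2 N101 N001 where "N = gamma_factor a b c" and "N1 = gamma_factor (a + 1) (b + 1) (c + 1)"
    and "N2 = gamma_factor (a + 1) (b + 1) (c + 2)" and "N101 = gamma_factor (a + 1) b (c + 1)"
    and "N001 = gamma_factor a b (c + 1)"
  note N_defs = N_def N1_def N2_def N101_def N001_def
  define X :: "complex fls" where "X = fls_X"
  have X: "X \<noteq> 0" by (simp add: X_def)
  \<comment> \<open>The lowest power of z among the five members, reached at the shift (1, 1,
    2).\<close>
  define V where "V = 1 / X ^ Suc (Suc k)"
  define h where "h i j k = fps_to_fls (hyp2F1_fps (a - c + of_nat i) (b - c + of_nat j) (- c + of_nat
      k))" for i j k
  have y: "y i j k = fls_const N * (fls_X * fls_X * V * h 1 1 2)" "y (Suc i) (Suc j) (Suc k) = fls_const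
      N1 * (fls_X * V * h 1 1 1)"
    "y (Suc i) (Suc j) (Suc (Suc k)) = fls_const N2 * (V * h 0 0 0)"
    "y (Suc i) j (Suc k) = fls_const N101 * (fls_X * V * h 1 0 1)"
    "y i j (Suc k) = fls_const N001 * (fls_X * V * h 0 0 1)"
  proof -
    have arg: "\<alpha> + of_nat i = a" "\<alpha> + of_nat (Suc i) = a + 1" "\<beta> + of_nat j = b"
        "\<beta> + of_nat (Suc j) = b + 1"
      "\<gamma> + of_nat k = c" "\<gamma> + of_nat (Suc k) = c + 1" "\<gamma> + of_nat (Suc (Suc k)) = c
          + 2"
      "t + 1 - (c + 1) + 1 = t - c + of_nat 1" "a - (c + 1) + 1 = a - c + of_nat 0" "b - (c + 1) + 1 = b
          - c + of_nat 0" "t - c + 1 = t - c + of_nat 1"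
      "t + 1 - (c + 2) + 1 = t - c + of_nat 0" "2 - c = - c + of_nat 2" "2 - (c + 1) = - c + of_nat 1"
      "2 - (c + 2) = - c + of_nat 0" for t
      by (simp_all add: a_def b_def c_def)
    have V: "t / X ^ k = t * (X * X * V)" "t / X ^ Suc k = t * (X * V)" "t / X ^ Suc (Suc k) = t * V" for t
      using X by (simp_all add: V_def)
    show "y i j k = fls_const N * (fls_X * fls_X * V * h 1 1 2)"
      "y (Suc i) (Suc j) (Suc k) = fls_const N1 * (fls_X * V * h 1 1 1)"
      "y (Suc i) (Suc j) (Suc (Suc k)) = fls_const N2 * (V * h 0 0 0)"
      "y (Suc i) j (Suc k) = fls_const N101 * (fls_X * V * h 1 0 1)"
      "y i j (Suc k) = fls_const N001 * (fls_X * V * h 0 0 1)"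
      unfolding y_def X_def[symmetric] V arg N_defs h_def by (simp_all only: mult.assoc)
  qed
  define A B C where "A = fls_const a" and "B = fls_const b" and "C = fls_const c"
  have pars: "fls_const \<alpha> + of_nat i = A" "fls_const \<beta> + of_nat j = B" "fls_const \<gamma> +
      of_nat k = C"
    unfolding A_def B_def C_def a_def b_def c_def fls_const_hom by simp_all
  have AB: "A \<noteq> 0" "B \<noteq> 0" using gen by (auto simp: A_def B_def)
  have "- c \<notin> \<int>" "- c + 1 \<notin> \<int>"
    using gen(3) Ints_add_of_nat_iff[of "- c" 1] by (simp_all add: minus_in_Ints_iff)
  hence nn: "- c \<notin> \<int>\<^sub>\<le>\<^sub>0" "- c + 1 \<notin> \<int>\<^sub>\<le>\<^sub>0" using
      nonpos_Ints_subset_Ints by blast+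
  have "(a - c) * (b - c) * N2 = (c + 1) * (- c) * N1"
    using gamma_factor_shift(3)[OF gen1] unfolding N_defs by (simp add: algebra_simps)
  note N = gamma_factor_shift(1-3)[OF gen, folded N_defs] this
  note N = N[THEN arg_cong[where f = fls_const], unfolded fls_const_hom(1-3) fls_const_1
      fls_const_uminus, folded A_def B_def C_def]
  have h: "hyp2F1_fps (a - c) (b - c) (- c) = hyp2F1_fps (a - c + of_nat 0) (b - c + of_nat 0) (- c +
      of_nat 0)"
    "hyp2F1_fps (a - c) (b - c) (- c + 1) = hyp2F1_fps (a - c + of_nat 0) (b - c + of_nat 0) (- c +
        of_nat 1)"
    "hyp2F1_fps (a - c + 1) (b - c) (- c + 1) = hyp2F1_fps (a - c + of_nat 1) (b - c + of_nat 0) (- c +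
        of_nat 1)"
    "hyp2F1_fps (a - c + 1) (b - c + 1) (- c + 1) = hyp2F1_fps (a - c + of_nat 1) (b - c + of_nat 1) (- c
        + of_nat 1)"
    "hyp2F1_fps (a - c + 1) (b - c + 1) (- c + 2) = hyp2F1_fps (a - c + of_nat 1) (b - c + of_nat 1) (- c
        + of_nat 2)"
    "- c + 1 + 1 = - c + 2"
    by simp_all
  note rel = hyp2F1_fps_shift_112[OF nn(1), of "a - c" "b - c"] hyp2F1_fps_shift_010[OF nn(2), of "a - c"
      "b - c"]
    hyp2F1_fps_shift_110[OF nn(2), of "a - c" "b - c"]
  note rel = rel[unfolded h(6), unfolded h(1-5), THEN arg_cong[where f = fps_to_fls], unfolded
      fps_to_fls_hom fps_to_fls_plus
      fps_to_fls_minus fps_const_to_fls fls_const_hom(1-3) fls_const_1 fls_const_uminus, folded h_def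
          A_def B_def C_def]
  show "(fls_const \<gamma> + of_nat k) * (fls_const \<gamma> + of_nat k + 1) * (y i j k - (1 - fls_X) *
      y (Suc i) (Suc j) (Suc k)) =
        (fls_const \<gamma> + of_nat k - (fls_const \<alpha> + of_nat i)) * (fls_const \<gamma> + of_nat
            k - (fls_const \<beta> + of_nat j)) *
        (fls_X * y (Suc i) (Suc j) (Suc (Suc k))) \<and>
        (fls_const \<gamma> + of_nat k) * y i j k =
        (fls_const \<gamma> + of_nat k - (fls_const \<beta> + of_nat j)) * y (Suc i) j (Suc k) +
        (fls_const \<beta> + of_nat j) * ((1 - fls_X) * y (Suc i) (Suc j) (Suc k)) \<and>
        (fls_const \<gamma> + of_nat k - (fls_const \<alpha> + of_nat i)) * (fls_const \<gamma> + of_nat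
            k - (fls_const \<beta> + of_nat j)) * y i j (Suc k) =
        (fls_const \<gamma> + of_nat k) * (fls_const \<gamma> + of_nat k - (fls_const \<alpha> + of_nat
            i) - (fls_const \<beta> + of_nat j)) * y i j k +
        (fls_const \<alpha> + of_nat i) * (fls_const \<beta> + of_nat j) * ((1 - fls_X) * y (Suc i) (Suc
            j) (Suc k))"
    unfolding pars y
  proof (intro conjI)
    let ?L = "C * (C + 1) * (fls_const N * (fls_X * fls_X * V * h 1 1 2) -
        (1 - fls_X) * (fls_const N1 * (fls_X * V * h 1 1 1)))"
    let ?R = "(C - A) * (C - B) * (fls_X * (fls_const N2 * (V * h 0 0 0)))"
    have rel1: "A * B * (fls_X * h 1 1 2) = C * (1 - C) * ((1 - fls_X) * h 1 1 1 - h 0 0 0)"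
      using rel(1) by algebra
    \<comment> \<open>The factor \<open>A * B\<close> makes the ratio of the normalisations
      applicable and is cancelled at the end, \<open>a\<close> and \<open>b\<close> being
      nonzero.\<close>
    have "A * B * ?L = C * (C + 1) * (fls_X * V) *
        (fls_const N * (A * B * (fls_X * h 1 1 2)) - (1 - fls_X) * h 1 1 1 * (A * B * fls_const N1))"
      by algebra
    also have "\<dots> = - C * (C + 1) * (fls_X * V) * h 0 0 0 * (C * (1 - C) * fls_const N)"
      unfolding rel1 N(1) by algebra
    also have "\<dots> = A * B * (fls_X * V * h 0 0 0) * ((C + 1) * (- C) * fls_const N1)"
      unfolding N(1)[symmetric] by algebra
    also have "\<dots> = A * B * ?R"
      unfolding N(4)[symmetric] by algebra
    finally show "?L = ?R" using AB by simp
  next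
    let ?L = "C * (fls_const N * (fls_X * fls_X * V * h 1 1 2))"
    let ?R = "(C - B) * (fls_const N101 * (fls_X * V * h 1 0 1)) + B * ((1 - fls_X) * (fls_const N1 *
        (fls_X * V * h 1 1 1)))"
    have rel2: "A * (fls_X * h 1 1 2) = (1 - C) * ((1 - fls_X) * h 1 1 1 - h 1 0 1)"
      using rel(2) by algebra
    have "A * ?L = C * (fls_const N * (fls_X * V)) * (A * (fls_X * h 1 1 2))" by algebra
    also have "\<dots> = (fls_X * V) * ((1 - fls_X) * h 1 1 1 - h 1 0 1) * (C * (1 - C) * fls_const N)"
      unfolding rel2 by algebra
    also have "\<dots> = (fls_X * V) * ((1 - fls_X) * h 1 1 1 * (A * B * fls_const N1) - h 1 0 1 * (A *
        (B - C) * fls_const N101))"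
      unfolding N(1,2) by algebra
    also have "\<dots> = A * ?R" by algebra
    finally show "?L = ?R" using AB by simp
  next
    have rel3: "(C - A - B) * (fls_X * h 1 1 2) = (1 - C) * (h 0 0 1 - (1 - fls_X) * h 1 1 1)"
      using rel(3) by algebra
    have "C * (C - A - B) * (fls_const N * (fls_X * fls_X * V * h 1 1 2)) +
        A * B * ((1 - fls_X) * (fls_const N1 * (fls_X * V * h 1 1 1))) =
        (fls_X * V) * (C * fls_const N * ((C - A - B) * (fls_X * h 1 1 2)) + (1 - fls_X) * h 1 1 1 * (A *
            B * fls_const N1))"
      by algebra
    also have "\<dots> = (fls_X * V) * h 0 0 1 * (C * (1 - C) * fls_const N)"
      unfolding rel3 N(1) by algebra
    also have "\<dots> = (C - A) * (C - B) * (fls_const N001 * (fls_X * V * h 0 0 1))"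
      unfolding N(3)[symmetric] by algebra
    finally show "(C - A) * (C - B) * (fls_const N001 * (fls_X * V * h 0 0 1)) =
        C * (C - A - B) * (fls_const N * (fls_X * fls_X * V * h 1 1 2)) +
        A * B * ((1 - fls_X) * (fls_const N1 * (fls_X * V * h 1 1 1)))" ..
  qed
qed

text \<open>Keeps an error term divisible by z^r away from the coefficients up to the truncation
  order.\<close>

lemma length_less_shiftC: "length ss < shiftC ss"
  by (induction ss rule: contiguous_steps_induct) auto

text \<open>Makes the exponent of 1 - z in the Euler-transformed relation non-negative.\<close>

lemma shiftA_shiftB_le_shiftC: "shiftA ss + shiftB ss \<le> shiftC ss"
  by (induction ss rule: contiguous_steps_induct) auto

lemma coefP_eq_truncation:
  fixes \<alpha> \<beta> \<gamma> :: complex and ss :: "contiguous_step list"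
  assumes gen: "\<alpha> \<notin> \<int>" "\<beta> \<notin> \<int>" "\<gamma> \<notin> \<int>" "\<gamma>
      - \<alpha> \<notin> \<int>" "\<gamma> - \<beta> \<notin> \<int>"
  defines "\<alpha>' \<equiv> \<alpha> + of_nat (shiftA ss)" and "\<beta>' \<equiv> \<beta> + of_nat
      (shiftB ss)" and "\<gamma>' \<equiv> \<gamma> + of_nat (shiftC ss)"
  shows "smult (gamma_factor (\<alpha> + 1) (\<beta> + 1) (\<gamma> + 1)) (coefP ss [:\<alpha>:]
      [:\<beta>:] [:\<gamma>:] [:0, 1:]) =
    smult (coefD ss \<alpha> \<beta> \<gamma> * gamma_factor \<alpha>' \<beta>' \<gamma>')
      (truncation (length ss) (hyp2F1_fps (\<gamma> - \<alpha>) (\<gamma> - \<beta>) \<gamma> *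
          hyp2F1_fps (\<alpha>' - \<gamma>' + 1) (\<beta>' - \<gamma>' + 1) (2 - \<gamma>')))"
proof -
  define p q r where "p = shiftA ss" and "q = shiftB ss" and "r = shiftC ss"
  define H0 H1 Hr G G1 Gr where "H0 = hyp2F1_fps (\<gamma> - \<alpha>) (\<gamma> - \<beta>) \<gamma>" and
      "H1 = hyp2F1_fps (\<gamma> - \<alpha>) (\<gamma> - \<beta>) (\<gamma> + 1)"
    and "Hr = hyp2F1_fps (\<gamma>' - \<alpha>') (\<gamma>' - \<beta>') \<gamma>'"
    and "G = hyp2F1_fps (\<alpha> - \<gamma> + 1) (\<beta> - \<gamma> + 1) (2 - \<gamma>)" and "G1 =
        hyp2F1_fps (\<alpha> - \<gamma> + 1) (\<beta> - \<gamma> + 1) (1 - \<gamma>)"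
    and "Gr = hyp2F1_fps (\<alpha>' - \<gamma>' + 1) (\<beta>' - \<gamma>' + 1) (2 - \<gamma>')"
  define N N1 Nr where "N = gamma_factor \<alpha> \<beta> \<gamma>" and "N1 = gamma_factor (\<alpha> + 1)
      (\<beta> + 1) (\<gamma> + 1)"
    and "Nr = gamma_factor \<alpha>' \<beta>' \<gamma>'"
  define D where "D = coefD ss \<alpha> \<beta> \<gamma>"
  define U P where "U = coefU ss [:\<alpha>:] [:\<beta>:] [:\<gamma>:] [:0, 1:]" and "P = coefP ss
      [:\<alpha>:] [:\<beta>:] [:\<gamma>:] [:0, 1:]"
  let ?\<phi> = "\<lambda>p :: complex poly. fps_to_fls (fps_of_poly p)"
  have \<phi>: "?\<phi> (s + t) = ?\<phi> s + ?\<phi> t" "?\<phi> (s * t) = ?\<phi> s * ?\<phi> t"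
      "?\<phi> 1 = 1" for s t
    by (simp_all add: fps_of_poly_add fps_of_poly_mult fls_times_fps_to_fls)
  have \<phi>': "?\<phi> [:c:] = fls_const c" "?\<phi> [:0, 1:] = fls_X" for c
    by (simp_all add: fps_of_poly_pCons)
  have coefs: "coefU ss (fls_const \<alpha>) (fls_const \<beta>) (fls_const \<gamma>) fls_X = ?\<phi> U"
    "coefP ss (fls_const \<alpha>) (fls_const \<beta>) (fls_const \<gamma>) fls_X = ?\<phi> P"
    "coefD ss (fls_const \<alpha>) (fls_const \<beta>) (fls_const \<gamma>) = fls_const D"
    unfolding U_def P_def D_def coef_hom[where \<phi> = ?\<phi>, OF \<phi>]
     coef_hom(3)[where \<phi> = fls_const, OF fls_const_hom(2,1) fls_const_1] by (simp_all only: \<phi>')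
  define X w :: "complex fls" where "X = fls_X" and "w = 1 - fls_X"
  have nz: "X \<noteq> 0" "w \<noteq> 0"
  proof -
    show "X \<noteq> 0" by (simp add: X_def)
    have "fls_nth w 0 = 1" by (simp add: w_def)
    thus "w \<noteq> 0" by auto
  qed
  have \<gamma>: "\<gamma> \<notin> \<int>\<^sub>\<le>\<^sub>0" using gen(3) nonpos_Ints_subset_Ints by
      blast
  have arg: "\<gamma> + of_nat 1 - (\<alpha> + of_nat 1) = \<gamma> - \<alpha>" "\<gamma> + of_nat 1 -
      (\<beta> + of_nat 1) = \<gamma> - \<beta>"
     "\<alpha> + of_nat 1 - (\<gamma> + of_nat 1) + 1 = \<alpha> - \<gamma> + 1"
     "\<beta> + of_nat 1 - (\<gamma> + of_nat 1) + 1 = \<beta> - \<gamma> + 1"  "2 - (\<gamma> + of_nat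
         1) = 1 - \<gamma>"
     "\<alpha> + of_nat 0 = \<alpha>" "\<beta> + of_nat 0 = \<beta>" "\<gamma> + of_nat 0 = \<gamma>"
         "(of_nat 1 :: complex) = 1" by simp_all
  obtain m where m: "r = Suc m" unfolding r_def using shiftC_pos by blast
  have "fls_const D * (X ^ (r - 1) * (w ^ r / w ^ (p + q) * fps_to_fls Hr)) =
      ?\<phi> U * (w ^ 0 / w ^ (0 + 0) * fps_to_fls H0) + w * ?\<phi> P * (w ^ 1 / w ^ (1 + 1) *
          fps_to_fls H1)"
    using contiguous_family_relation[OF contiguous_family_dual[OF \<gamma>, of \<alpha> \<beta>], of ss]
    unfolding coefs unfolding w_def[symmetric] unfolding p_def[symmetric] q_def[symmetric]
        r_def[symmetric] \<alpha>'_def[folded p_def, symmetric] \<beta>'_def[folded q_def, symmetric]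
      \<gamma>'_def[folded r_def, symmetric] X_def[symmetric] unfolding arg(1-8) unfolding arg(9)
          unfolding H0_def[symmetric] H1_def[symmetric] Hr_def[symmetric] .
  moreover have w_power: "w ^ r / w ^ (p + q) = w ^ (r - (p + q))"
    using nz shiftA_shiftB_le_shiftC[of ss] by (simp add: p_def q_def r_def power_diff)
  \<comment> \<open>The member at (1, 1, 1) carries the power -1 of 1 - z, which absorbs the factor
    in front of \<open>P\<close>.\<close>
  ultimately have E1: "fls_const D * (X ^ m * (w ^ (r - (p + q)) * fps_to_fls Hr)) = ?\<phi> U *
      fps_to_fls H0 + ?\<phi> P * fps_to_fls H1"
    using nz unfolding w_power by (simp add: m)
  have "fls_const D * (X ^ (r - 1) * (fls_const Nr / X ^ r * fps_to_fls Gr)) =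
      ?\<phi> U * (fls_const N / X ^ 0 * fps_to_fls G) + w * ?\<phi> P * (fls_const N1 / X ^ 1 *
          fps_to_fls G1)"
    using contiguous_family_relation[OF contiguous_family_second[OF gen], of ss]
    unfolding coefs unfolding w_def[symmetric] unfolding p_def[symmetric] q_def[symmetric]
        r_def[symmetric] \<alpha>'_def[folded p_def, symmetric] \<beta>'_def[folded q_def, symmetric]
      \<gamma>'_def[folded r_def, symmetric] X_def[symmetric] unfolding arg(1-8) unfolding arg(9)
          unfolding G_def[symmetric] G1_def[symmetric] Gr_def[symmetric]
      N_def[symmetric] N1_def[symmetric] Nr_def[symmetric] .
  hence E2: "fls_const D * (fls_const Nr * fps_to_fls Gr) =
      X * (?\<phi> U * (fls_const N * fps_to_fls G)) + w * ?\<phi> P * (fls_const N1 * fps_to_fls G1)"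
    using nz by (simp add: m field_simps)
  define Z where "Z = fps_const D * (1 - fps_X) ^ (r - (p + q)) * Hr * fps_const N * G"
  \<comment> \<open>The second relation times \<open>H0\<close> minus the first times z,
    \<open>N\<close> and \<open>G\<close>: the terms with \<open>U\<close> cancel, and
    \<open>Z\<close> collects what is multiplied by z^r.\<close>
  have "fls_const D * (fls_const Nr * fps_to_fls Gr) * fps_to_fls H0 - X * X ^ m * fps_to_fls Z =
     ?\<phi> P * (w * fls_const N1 * fps_to_fls G1 * fps_to_fls H0 - X * fls_const N * fps_to_fls G *
         fps_to_fls H1)"
  proof -
    have "fps_to_fls Z = fls_const D * w ^ (r - (p + q)) * fps_to_fls Hr * fls_const N * fps_to_fls G"
      by (simp add: Z_def w_def fps_to_fls_hom fps_to_fls_power)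
    hence "X * X ^ m * fps_to_fls Z =
        X * fls_const N * fps_to_fls G * (fls_const D * (X ^ m * (w ^ (r - (p + q)) * fps_to_fls Hr)))"
      by (simp only: mult_ac)
    thus ?thesis unfolding E1 E2 by (simp add: algebra_simps)
  qed
  hence "fps_to_fls (fps_const D * (fps_const Nr * Gr) * H0 - fps_X ^ r * Z) =
    fps_to_fls (fps_of_poly P * ((1 - fps_X) * fps_const N1 * G1 * H0 - fps_X * fps_const N * G * H1))"
    by (simp add: X_def w_def fps_to_fls_hom fps_to_fls_power m)
  hence "fps_const D * (fps_const Nr * Gr) * H0 - fps_X ^ r * Z =
    fps_of_poly P * ((1 - fps_X) * fps_const N1 * G1 * H0 - fps_X * fps_const N * G * H1)"
    by (simp only: fps_to_fls_eq_iff)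
  also have "(1 - fps_X) * fps_const N1 * G1 * H0 - fps_X * fps_const N * G * H1 = fps_const N1"
  proof -
    have eq: "1 - (\<gamma> - \<alpha>) = \<alpha> - \<gamma> + 1" "1 - (\<gamma> - \<beta>) = \<beta> -
        \<gamma> + 1" "\<gamma> - (\<gamma> - \<alpha>) = \<alpha>" "\<gamma> - (\<gamma> - \<beta>) =
            \<beta>"
      by simp_all
    \<comment> \<open>The Wronskian is taken at the upper parameters \<gamma> - \<alpha> and
      \<gamma> - \<beta>, whose complements to \<gamma> are \<alpha> and \<beta>.\<close>
    have W: "fps_const (\<gamma> * (1 - \<gamma>)) * ((1 - fps_X) * (H0 * G1)) - fps_const (\<alpha> *
        \<beta>) * (fps_X * (H1 * G)) = fps_const (\<gamma> * (1 - \<gamma>))"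
      using hyp2F1_fps_wronskian[OF gen(3), of "\<gamma> - \<alpha>" "\<gamma> - \<beta>"]
      unfolding eq H0_def[symmetric] H1_def[symmetric] G_def[symmetric] G1_def[symmetric] .
    have nz: "\<alpha> * \<beta> \<noteq> 0" using gen by auto
    have N: "fps_const (\<alpha> * \<beta>) * fps_const N1 = fps_const (\<gamma> * (1 - \<gamma>)) *
        fps_const N"
      using gamma_factor_shift(1)[OF gen] by (simp add: N_def N1_def)
    have "fps_const (\<alpha> * \<beta>) * ((1 - fps_X) * fps_const N1 * G1 * H0 - fps_X * fps_const N *
        G * H1) =
      fps_const (\<alpha> * \<beta>) * fps_const N1 * ((1 - fps_X) * (H0 * G1)) - fps_const N *
          (fps_const (\<alpha> * \<beta>) * (fps_X * (H1 * G)))"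
      by algebra
    also have "\<dots> = fps_const N * (fps_const (\<gamma> * (1 - \<gamma>)) * ((1 - fps_X) * (H0 * G1))
        - fps_const (\<alpha> * \<beta>) * (fps_X * (H1 * G)))"
      unfolding N by algebra
    also have "\<dots> = fps_const (\<alpha> * \<beta>) * fps_const N1" unfolding W N by (simp only:
        mult.commute)
    finally show ?thesis using nz by (metis fps_const_eq_0_iff mult_left_cancel)
  qed
  finally have *: "fps_const D * (fps_const Nr * Gr) * H0 - fps_X ^ r * Z = fps_of_poly P * fps_const N1" .
  \<comment> \<open>Up to the number of steps, the index is below \<open>r\<close> and the error
    term is invisible; beyond it, both sides are zero by the degree bound in z.\<close>
  have "coeff (smult N1 P) k = coeff (smult (D * Nr) (truncation (length ss) (H0 * Gr))) k" for k
  proof (cases "k \<le> length ss")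
    case True
    hence "k < r" using length_less_shiftC[of ss] by (simp add: r_def)
    have "N1 * coeff P k = fps_nth (fps_of_poly P * fps_const N1) k" by simp
    also have "\<dots> = fps_nth (fps_const (D * Nr) * (H0 * Gr) - fps_X ^ r * Z) k"
      unfolding *[symmetric] by (simp add: mult_ac)
    also have "\<dots> = D * Nr * fps_nth (H0 * Gr) k" using \<open>k < r\<close> by (simp add:
        fps_X_power_mult_nth)
    finally show ?thesis using True by (simp add: truncation_def coeff_truncate_fps)
  next
    case False
    have "degree P \<le> length ss" unfolding P_def
      using degree_coef[of "[:\<alpha>:]" 0 "[:\<beta>:]" "[:\<gamma>:]" "[:0, 1:]" 1 ss] by simp
    thus ?thesis using False by (simp add: truncation_def coeff_truncate_fps coeff_eq_0)
  qed
  thus ?thesis unfolding P_def N1_def D_def Nr_def H0_def Gr_def by (rule poly_eqI)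
qed

section \<open>Uniqueness of the coefficients\<close>

definition ring_hom_fun :: "('a :: comm_ring_1 \<Rightarrow> 'b :: comm_ring_1) \<Rightarrow> bool" where
  "ring_hom_fun h \<longleftrightarrow> h 0 = 0 \<and> h 1 = 1 \<and> (\<forall>x y. h (x + y) = h x + h
      y) \<and> (\<forall>x y. h (x * y) = h x * h y)"

lemma ring_hom_funD:
  assumes "ring_hom_fun h"
  shows "h 0 = 0" "h 1 = 1" "h (x + y) = h x + h y" "h (x * y) = h x * h y" "h (- x) = - h x"
    "h (x - y) = h x - h y" "h (x ^ n) = h x ^ n"
proof -
  show *: "h 0 = 0" "h 1 = 1" "h (x + y) = h x + h y" "h (x * y) = h x * h y" for x y
    using assms by (auto simp: ring_hom_fun_def)
  have "h x + h (- x) = 0" for x using *(1) *(3)[of x "- x"] by simp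
  thus m: "h (- x) = - h x" for x by (metis add_eq_0_iff)
  show "h (x - y) = h x - h y" using *(3)[of x "- y"] m by simp
  show "h (x ^ n) = h x ^ n" by (induction n) (auto simp: *)
qed

lemma ring_hom_fun_poly_map_poly:
  assumes "ring_hom_fun h"
  shows "ring_hom_fun (\<lambda>p. poly (map_poly h p) x)"
proof -
  note h = ring_hom_funD[OF assms]
  have pCons: "poly (map_poly h (pCons a p)) x = h a + x * poly (map_poly h p) x" for a p
    by (simp add: map_poly_pCons h)
  have add: "poly (map_poly h (p + q)) x = poly (map_poly h p) x + poly (map_poly h q) x" for p q
    by (induction p q rule: poly_induct2) (simp_all add: pCons h algebra_simps)
  have smult: "poly (map_poly h (smult a p)) x = h a * poly (map_poly h p) x" for a p
    by (induction p) (simp_all add: pCons h algebra_simps)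
  have "poly (map_poly h (p * q)) x = poly (map_poly h p) x * poly (map_poly h q) x" for p q
    by (induction p) (simp_all add: pCons add smult h algebra_simps)
  thus ?thesis using add pCons[of 1 0] by (simp add: ring_hom_fun_def h one_pCons)
qed

lemma ring_hom_fun_subst4: "ring_hom_fun h \<Longrightarrow> ring_hom_fun (\<lambda>P. subst4 h P
    \<alpha> \<beta> \<gamma> z)"
  unfolding subst4_def by (intro ring_hom_fun_poly_map_poly)

lemma hom_poly_map_poly:
  assumes "ring_hom_fun \<phi>" "h 0 = 0"
  shows "\<phi> (poly (map_poly h p) x) = poly (map_poly (\<lambda>a. \<phi> (h a)) p) (\<phi> x)"
  using assms by (induction p) (simp_all add: map_poly_pCons ring_hom_funD)

lemma hom_subst4:
  assumes "ring_hom_fun \<phi>" "h 0 = 0"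
  shows "\<phi> (subst4 h P \<alpha> \<beta> \<gamma> z) = subst4 (\<lambda>c. \<phi> (h c)) P (\<phi>
      \<alpha>) (\<phi> \<beta>) (\<phi> \<gamma>) (\<phi> z)"
  unfolding subst4_def using assms by (simp add: hom_poly_map_poly)

definition "var\<alpha> = ([:0, 1:] :: poly4)"
definition "var\<beta> = ([:[:0, 1:]:] :: poly4)"
definition "var\<gamma> = ([:[:[:0, 1:]:]:] :: poly4)"
definition "var_z = ([:[:[:[:0, 1:]:]:]:] :: poly4)"

lemma subst4_vars:
  assumes "ring_hom_fun h"
  shows "subst4 h var\<alpha> \<alpha> \<beta> \<gamma> z = \<alpha>" "subst4 h var\<beta> \<alpha>
      \<beta> \<gamma> z = \<beta>" "subst4 h var\<gamma> \<alpha> \<beta> \<gamma> z = \<gamma>"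
    "subst4 h var_z \<alpha> \<beta> \<gamma> z = z"
  unfolding subst4_def var\<alpha>_def var\<beta>_def var\<gamma>_def var_z_def
  using ring_hom_funD(1,2)[OF assms] by (simp_all add: map_poly_pCons one_pCons)

lemma map_poly_coeffs_zero:
  fixes e :: "'a :: zero \<Rightarrow> 'b :: idom"
  assumes "e 0 = 0" "infinite S" "\<And>x. x \<in> S \<Longrightarrow> poly (map_poly e p) x = 0"
  shows "e (coeff p i) = 0"
proof -
  have "infinite {x. poly (map_poly e p) x = 0}"
    using assms(2,3) by (metis (mono_tags, lifting) infinite_super mem_Collect_eq subsetI)
  hence "map_poly e p = 0" using poly_roots_finite by blast
  thus ?thesis using coeff_map_poly[where f = e and p = p and n = i, OF assms(1)] by simp
qed

lemma infinite_ball_complex: "infinite {z :: complex. norm z < 1}"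
proof -
  have "{z :: complex. norm z < 1} = ball 0 1" by (auto simp: ball_def)
  thus ?thesis using uncountable_ball[of 1 "0 :: complex"] uncountable_infinite by simp
qed

lemma infinite_diff_countable: "countable A \<Longrightarrow> infinite (- A :: complex set)"
  by (metis Diff_infinite_finite Compl_eq_Diff_UNIV countable_finite uncountable_UNIV_complex
      uncountable_minus_countable)

lemma countable_Ints_shift: "countable {x :: complex. x - c \<in> \<int>}"
proof -
  have "{x :: complex. x - c \<in> \<int>} = (\<lambda>n. of_int n + c) ` UNIV"
    by (auto elim!: Ints_cases simp: image_def algebra_simps)
  thus ?thesis by simp
qed

text \<open>The points \<alpha> = - n with n > d form an infinite set and determine a polynomial in
  \<alpha>. The other variables are then peeled off from the outside inwards, each coefficient
  vanishing at infinitely many points.\<close>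

lemma eval4_zeroI:
  assumes "\<And>\<beta> \<gamma> z n. \<beta> \<notin> \<int> \<Longrightarrow> \<gamma> \<notin> \<int>
      \<Longrightarrow> \<beta> - \<gamma> \<notin> \<int> \<Longrightarrow> norm z < 1 \<Longrightarrow>
          n > d \<Longrightarrow> eval4 P (- of_nat n) \<beta> \<gamma> z = 0"
  shows "P = 0"
proof -
  define E1 where "E1 z = (\<lambda>P3. poly (map_poly (\<lambda>c :: complex. c) P3) z)" for z
  define E2 where "E2 z \<gamma> = (\<lambda>P2. poly (map_poly (E1 z) P2) \<gamma>)" for z \<gamma>
  define E3 where "E3 z \<gamma> \<beta> = (\<lambda>P1. poly (map_poly (E2 z \<gamma>) P1) \<beta>)" for
      z \<gamma> \<beta>
  have E0: "E1 z 0 = 0" "E2 z \<gamma> 0 = 0" "E3 z \<gamma> \<beta> 0 = 0" for z \<beta> \<gamma>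
    by (simp_all add: E1_def E2_def E3_def)
  have inf1: "infinite ((\<lambda>n. - of_nat n :: complex) ` {d<..})"
    by (subst finite_image_iff) (auto simp: inj_on_def infinite_Ioi)
  have inf2: "infinite {\<beta> :: complex. \<beta> \<notin> \<int> \<and> \<beta> - \<gamma> \<notin>
      \<int>}" for \<gamma>
    using infinite_diff_countable[of "{x. x - 0 \<in> \<int>} \<union> {x. x - \<gamma> \<in> \<int>}"]
        countable_Ints_shift[of 0] countable_Ints_shift[of \<gamma>]
    by (simp add: Compl_eq)
  have inf3: "infinite {\<gamma> :: complex. \<gamma> \<notin> \<int>}"
    using infinite_diff_countable[of "{x. x - 0 \<in> \<int>}"] countable_Ints_shift[of 0]
    by (simp add: Compl_eq)
  have 1: "E3 z \<gamma> \<beta> (coeff P i) = 0"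
    if "\<beta> \<notin> \<int>" "\<gamma> \<notin> \<int>" "\<beta> - \<gamma> \<notin> \<int>" "norm z
        < 1" for \<beta> \<gamma> z i
    by (rule map_poly_coeffs_zero[where e = "E3 z \<gamma> \<beta>", OF E0(3) inf1])
      (use assms that in \<open>auto simp: eval4_def subst4_def E1_def E2_def E3_def\<close>)
  have 2: "E2 z \<gamma> (coeff (coeff P i) j) = 0" if "\<gamma> \<notin> \<int>" "norm z < 1" for
      \<gamma> z i j
    by (rule map_poly_coeffs_zero[where e = "E2 z \<gamma>", OF E0(2) inf2[of \<gamma>]]) (use 1 that in
        \<open>auto simp: E3_def\<close>)
  have 3: "E1 z (coeff (coeff (coeff P i) j) k) = 0" if "norm z < 1" for z i j k
    by (rule map_poly_coeffs_zero[where e = "E1 z", OF E0(1) inf3]) (use 2 that in \<open>auto simp: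
        E2_def\<close>)
  have "coeff (coeff (coeff (coeff P i) j) k) l = 0" for i j k l
    by (rule map_poly_coeffs_zero[where e = "\<lambda>c. c", OF _ infinite_ball_complex]) (use 3 in
        \<open>auto simp: E1_def\<close>)
  thus ?thesis by (intro poly_eqI) simp
qed

text \<open>Substituting constants for the outer variables cannot raise the degree in z, so the
  bound is uniform in them. The index \<open>s\<close> records the values substituted in the inner
  layers.\<close>

lemma degree_poly_map_poly_bounded:
  assumes "\<And>s. h s 0 = 0" "\<And>x. \<exists>d. \<forall>s. degree (h s x) \<le> d"
  shows "\<exists>d. \<forall>s c. degree (poly (map_poly (h s) p) [:c :: complex:]) \<le> d"
proof (induction p)
  case (pCons a p)
  obtain d1 where "\<forall>s. degree (h s a) \<le> d1" using assms(2) by blast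
  moreover obtain d2 where "\<forall>s c. degree (poly (map_poly (h s) p) [:c:]) \<le> d2" using pCons by
      blast
  ultimately have le: "degree (h s a) \<le> max d1 d2" "degree (poly (map_poly (h s) p) [:c:]) \<le> max
      d1 d2" for s c
    by (meson max.coboundedI1 max.coboundedI2)+
  have "degree (poly (map_poly (h s) (pCons a p)) [:c:]) \<le> max d1 d2" for s c
    using degree_add_le[OF le(1) order.trans[OF degree_smult_le le(2)]]
    by (simp add: map_poly_pCons assms(1))
  thus ?case by blast
qed auto

definition eval4_z :: "poly4 \<Rightarrow> complex \<Rightarrow> complex \<Rightarrow> complex
    \<Rightarrow> complex poly" where
  "eval4_z P \<alpha> \<beta> \<gamma> = subst4 (\<lambda>c. [:c:]) P [:\<alpha>:] [:\<beta>:]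
      [:\<gamma>:] [:0, 1:]"

lemma ring_hom_fun_const_poly: "ring_hom_fun (\<lambda>c :: complex. [:c:])"
  by (simp add: ring_hom_fun_def one_pCons)

lemma ring_hom_fun_poly: "ring_hom_fun (\<lambda>p. poly p (z :: complex))"
  by (simp add: ring_hom_fun_def)

lemma poly_eval4_z: "poly (eval4_z P \<alpha> \<beta> \<gamma>) z = eval4 P \<alpha> \<beta> \<gamma> z"
  unfolding eval4_z_def eval4_def by (simp add: hom_subst4[OF ring_hom_fun_poly])

lemma degree_eval4_z_bounded: "\<exists>d. \<forall>\<alpha> \<beta> \<gamma>. degree (eval4_z P \<alpha>
    \<beta> \<gamma>) \<le> d"
proof -
  define h1 where "h1 = (\<lambda>(s :: unit) P3. poly (map_poly (\<lambda>c :: complex. [:c:]) P3) [:0,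
      1:])"
  define h2 where "h2 = (\<lambda>(s, \<gamma> :: complex) P2. poly (map_poly (h1 s) P2) [:\<gamma>:])"
  define h3 where "h3 = (\<lambda>(s, \<beta> :: complex) P1. poly (map_poly (h2 s) P1) [:\<beta>:])"
  have 0: "h1 s 0 = 0" "h2 t 0 = 0" "h3 u 0 = 0" for s t u by (auto simp: h1_def h2_def h3_def split:
      prod.splits)
  have 1: "\<exists>d. \<forall>s. degree (h1 s x) \<le> d" for x by auto
  have 2: "\<exists>d. \<forall>s. degree (h2 s x) \<le> d" for x
    using degree_poly_map_poly_bounded[where h = h1, OF 0(1) 1, of x] by (auto simp: h2_def)
  have 3: "\<exists>d. \<forall>s. degree (h3 s x) \<le> d" for x
    using degree_poly_map_poly_bounded[where h = h2, OF 0(2) 2, of x] by (auto simp: h3_def)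
  show ?thesis
    using degree_poly_map_poly_bounded[where h = h3, OF 0(3) 3, of P]
    by (auto simp: eval4_z_def subst4_def h1_def h2_def h3_def)
qed

section \<open>Terminating series and linear independence\<close>

definition hyp_poly :: "nat \<Rightarrow> complex \<Rightarrow> complex \<Rightarrow> complex poly" where
  "hyp_poly n b c = truncate_fps (Suc n) (hyp2F1_fps (- of_nat n) b c)"

lemma fps_of_poly_hyp_poly: "fps_of_poly (hyp_poly n b c) = hyp2F1_fps (- of_nat n) b c"
  unfolding hyp_poly_def
  by (rule fps_ext) (auto simp: hyp2F1_fps_nth pochhammer_of_nat_eq_0_lemma)

lemma hyp2F1_eq_hyp_poly: "hyp2F1 (- of_nat n) b c z = poly (hyp_poly n b c) z"
  unfolding hyp2F1_def fps_of_poly_hyp_poly[symmetric] by simp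

lemma degree_hyp_poly:
  assumes "b \<notin> \<int>" "c \<notin> \<int>"
  shows "degree (hyp_poly n b c) = n"
proof (rule antisym)
  show "degree (hyp_poly n b c) \<le> n"
    unfolding hyp_poly_def using degree_truncate_fps[of "Suc n"] by (simp add: less_Suc_eq_le)
  have "pochhammer b n \<noteq> 0" "pochhammer c n \<noteq> 0"
    using assms by (auto simp: pochhammer_eq_0_iff)
  moreover have "pochhammer (- of_nat n :: complex) n \<noteq> 0" by (auto simp: pochhammer_eq_0_iff)
  ultimately have "coeff (hyp_poly n b c) n \<noteq> 0"
    by (simp add: hyp_poly_def coeff_truncate_fps hyp2F1_fps_nth)
  thus "n \<le> degree (hyp_poly n b c)" by (rule le_degree)
qed

lemma contiguous_family_hyp2F1_fps:
  assumes \<gamma>: "\<gamma> \<notin> \<int>\<^sub>\<le>\<^sub>0"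
  shows "contiguous_family (fps_const \<alpha>) (fps_const \<beta>) (fps_const \<gamma>) fps_X
    (\<lambda>i j k. hyp2F1_fps (\<alpha> + of_nat i) (\<beta> + of_nat j) (\<gamma> + of_nat k))"
  unfolding contiguous_family_def Let_def
proof (intro allI)
  fix i j k
  define a b c where "a = \<alpha> + of_nat i" and "b = \<beta> + of_nat j" and "c = \<gamma> + of_nat k"
  have c: "c \<notin> \<int>\<^sub>\<le>\<^sub>0" unfolding c_def using \<gamma> by (rule
      add_of_nat_notin_nonpos_Ints)
  have pars: "fps_const \<alpha> + of_nat i = fps_const a" "fps_const \<beta> + of_nat j = fps_const b"
      "fps_const \<gamma> + of_nat k = fps_const c"
    by (simp_all add: a_def b_def c_def fps_of_nat[symmetric])
  have args: "\<alpha> + of_nat i = a" "\<beta> + of_nat j = b" "\<gamma> + of_nat k = c" "\<alpha> +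
      of_nat (Suc i) = a + 1" "\<beta> + of_nat (Suc j) = b + 1"
    "\<gamma> + of_nat (Suc k) = c + 1" "\<gamma> + of_nat (Suc (Suc k)) = c + 2"
    by (simp_all add: a_def b_def c_def)
  have hom: "fps_const (x * y) = fps_const x * fps_const y" "fps_const (x + y) = fps_const x + fps_const y"
    "fps_const (x - y) = fps_const x - fps_const y" for x y :: complex by simp_all
  show "(fps_const \<gamma> + of_nat k) * (fps_const \<gamma> + of_nat k + 1) *
       (hyp2F1_fps (\<alpha> + of_nat i) (\<beta> + of_nat j) (\<gamma> + of_nat k) -
        (1 - fps_X) * hyp2F1_fps (\<alpha> + of_nat (Suc i)) (\<beta> + of_nat (Suc j)) (\<gamma> +
            of_nat (Suc k))) =
       (fps_const \<gamma> + of_nat k - (fps_const \<alpha> + of_nat i)) * (fps_const \<gamma> + of_nat k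
           - (fps_const \<beta> + of_nat j)) *
       (fps_X * hyp2F1_fps (\<alpha> + of_nat (Suc i)) (\<beta> + of_nat (Suc j)) (\<gamma> + of_nat (Suc
           (Suc k)))) \<and>
       (fps_const \<gamma> + of_nat k) * hyp2F1_fps (\<alpha> + of_nat i) (\<beta> + of_nat j) (\<gamma>
           + of_nat k) =
       (fps_const \<gamma> + of_nat k - (fps_const \<beta> + of_nat j)) * hyp2F1_fps (\<alpha> + of_nat
           (Suc i)) (\<beta> + of_nat j) (\<gamma> + of_nat (Suc k)) +
       (fps_const \<beta> + of_nat j) * ((1 - fps_X) * hyp2F1_fps (\<alpha> + of_nat (Suc i)) (\<beta> +
           of_nat (Suc j)) (\<gamma> + of_nat (Suc k))) \<and>
       (fps_const \<gamma> + of_nat k - (fps_const \<alpha> + of_nat i)) * (fps_const \<gamma> + of_nat k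
           - (fps_const \<beta> + of_nat j)) *
       hyp2F1_fps (\<alpha> + of_nat i) (\<beta> + of_nat j) (\<gamma> + of_nat (Suc k)) =
       (fps_const \<gamma> + of_nat k) * (fps_const \<gamma> + of_nat k - (fps_const \<alpha> + of_nat i)
           - (fps_const \<beta> + of_nat j)) *
       hyp2F1_fps (\<alpha> + of_nat i) (\<beta> + of_nat j) (\<gamma> + of_nat k) +
       (fps_const \<alpha> + of_nat i) * (fps_const \<beta> + of_nat j) *
       ((1 - fps_X) * hyp2F1_fps (\<alpha> + of_nat (Suc i)) (\<beta> + of_nat (Suc j)) (\<gamma> +
           of_nat (Suc k)))"
    unfolding pars args
    using hyp2F1_fps_shift_112[OF c, of a b] hyp2F1_fps_shift_101[OF c, of a b] hyp2F1_fps_shift_001[OF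
        c, of a b]
    unfolding hom fps_const_1_eq_1 by blast
qed

text \<open>
  For \<open>\<alpha> = - n\<close> the two series are coprime polynomials of degrees \<open>n\<close> and \<open>n - 1\<close>. In a linear relation
  the first one divides the second coefficient, whose degree does not depend on \<open>n\<close>.
\<close>

lemma poly_dvd_mult_cancel:
  fixes p q s :: "complex poly"
  assumes "p dvd s * q" "p \<noteq> 0" "\<And>z. poly p z = 0 \<Longrightarrow> poly q z \<noteq> 0"
  shows "p dvd s"
  using assms
proof (induction "degree p" arbitrary: p s)
  case 0
  hence "is_unit p" by (simp add: is_unit_iff_degree)
  thus ?case by (rule unit_imp_dvd)
next
  case (Suc n)
  have "\<not> constant (poly p)" using Suc(2) by (simp add: constant_degree)
  then obtain z where z: "poly p z = 0" using fundamental_theorem_of_algebra by blast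
  then obtain p' where p': "p = [:- z, 1:] * p'" unfolding poly_eq_0_iff_dvd by (elim dvdE)
  obtain t where "s * q = p * t" using Suc(3) by (elim dvdE)
  hence "poly s z * poly q z = 0" using z by (metis mult_zero_left poly_mult)
  hence "poly s z = 0" using Suc(5)[OF z] by simp
  then obtain s' where s': "s = [:- z, 1:] * s'" unfolding poly_eq_0_iff_dvd by (elim dvdE)
  have nz: "p' \<noteq> 0" using Suc(4) p' by auto
  have "degree p = Suc (degree p')" unfolding p' using nz by (subst degree_mult_eq) auto
  moreover have "[:- z, 1:] * p' dvd [:- z, 1:] * (s' * q)"
    using Suc(3) unfolding p' s' by (simp only: mult.assoc)
  hence "p' dvd s' * q" using dvd_times_left_cancel_iff[of "[:- z, 1:]" p' "s' * q"] by simp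
  ultimately have "p' dvd s'"
    using Suc(1)[of p' s'] Suc(2,5) nz by (simp add: p')
  thus ?case unfolding p' s' by (rule mult_dvd_mono[OF dvd_refl])
qed

lemma poly_hyp_poly_0: "poly (hyp_poly n b c) 0 = 1"
  by (simp add: hyp_poly_def poly_0_coeff_0 coeff_truncate_fps hyp2F1_fps_nth)

text \<open>A weak form of the Chu-Vandermonde formula. At z = 1 the (1, 0, 1) relation loses its
  term with 1 - z, so lowering n and raising c changes the value only by the factor (c - b) /
  c.\<close>

lemma poly_hyp_poly_1:
  assumes "c \<notin> \<int>" "b - c \<notin> \<int>"
  shows "poly (hyp_poly n b c) 1 \<noteq> 0"
  using assms
proof (induction n arbitrary: c)
  case 0
  have "hyp_poly 0 b c = 1"
    by (rule poly_eqI) (simp add: hyp_poly_def coeff_truncate_fps hyp2F1_fps_nth)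
  thus ?case by simp
next
  case (Suc n)
  have c: "c \<notin> \<int>\<^sub>\<le>\<^sub>0" using Suc(2) nonpos_Ints_subset_Ints by blast
  have eq: "- of_nat (Suc n) + 1 = (- of_nat n :: complex)" by simp
  have "fps_of_poly ([:c:] * hyp_poly (Suc n) b c) =
      fps_of_poly ([:c - b:] * hyp_poly n b (c + 1) + [:b:] * ((1 - [:0, 1:]) * hyp_poly n (b + 1) (c +
          1)))"
    using hyp2F1_fps_shift_101[OF c, of "- of_nat (Suc n)" b, unfolded eq]
    by (simp only: fps_of_poly_hyp_poly fps_of_poly_mult fps_of_poly_add fps_of_poly_diff fps_of_poly_const
        fps_of_poly_1 fps_of_poly_fps_X)
  hence "poly ([:c:] * hyp_poly (Suc n) b c) 1 =
      poly ([:c - b:] * hyp_poly n b (c + 1) + [:b:] * ((1 - [:0, 1:]) * hyp_poly n (b + 1) (c + 1))) 1"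
    by (simp only: fps_of_poly_eq_iff)
  moreover have "poly (hyp_poly n b (c + 1)) 1 \<noteq> 0"
    using Suc.IH[of "c + 1"] Suc.prems Ints_add_of_nat_iff[of c 1] Ints_add_of_nat_iff[of "b - (c + 1)"
        1] by simp
  moreover have "c - b \<noteq> 0" using Suc.prems by auto
  ultimately show ?case by (auto simp: right_minus_eq)
qed

text \<open>Descent by \<open>contiguous_family_222\<close>: a common root is neither 0 nor 1, so it
  would also be a root of the next shifted polynomial, and eventually of the constant 1.\<close>

lemma hyp_poly_no_common_root:
  assumes gen: "b \<notin> \<int>" "c \<notin> \<int>" "b - c \<notin> \<int>"
  assumes root: "poly (hyp_poly (Suc n) b c) z = 0"
  shows "poly (hyp_poly n (b + 1) (c + 1)) z \<noteq> 0"
  using assms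
proof (induction n arbitrary: b c)
  case 0
  have "hyp_poly 0 (b + 1) (c + 1) = 1"
    by (rule poly_eqI) (simp add: hyp_poly_def coeff_truncate_fps hyp2F1_fps_nth)
  thus ?case by simp
next
  case (Suc n)
  have c: "c \<notin> \<int>\<^sub>\<le>\<^sub>0" using Suc.prems(2) nonpos_Ints_subset_Ints by blast
  have z: "z \<noteq> 0" "z \<noteq> 1"
    using poly_hyp_poly_0[of "Suc (Suc n)" b c] poly_hyp_poly_1[of c b "Suc (Suc n)"] Suc.prems by auto
  define a :: complex where "a = - of_nat (Suc (Suc n))"
  have a: "- of_nat (Suc (Suc n)) = a" "- of_nat (Suc n) = a + 1" "- of_nat n = a + 2" by (simp_all add:
      a_def)
  define A B C where "A = [:a:]" and "B = [:b:]" and "C = [:c:]"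
  have "fps_of_poly ([:0, 1:] * ((1 - [:0, 1:]) * ((A + 1) * (B + 1) * hyp_poly n (b + 2) (c + 2)))) =
     fps_of_poly (C * (C + 1) * hyp_poly (Suc (Suc n)) b c -
       (C + 1) * (C - (A + B + 1) * [:0, 1:]) * hyp_poly (Suc n) (b + 1) (c + 1))"
    using contiguous_family_222[OF contiguous_family_hyp2F1_fps[OF c, of a b]]
    by (simp only: fps_of_poly_hyp_poly fps_of_poly_mult fps_of_poly_add fps_of_poly_diff fps_of_poly_const
        fps_of_poly_1 fps_of_poly_fps_X a A_def B_def C_def of_nat_numeral of_nat_1 of_nat_0 add_0_right)
  hence "poly ([:0, 1:] * ((1 - [:0, 1:]) * ((A + 1) * (B + 1) * hyp_poly n (b + 2) (c + 2)))) z =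
     poly (C * (C + 1) * hyp_poly (Suc (Suc n)) b c -
       (C + 1) * (C - (A + B + 1) * [:0, 1:]) * hyp_poly (Suc n) (b + 1) (c + 1)) z"
    by (simp only: fps_of_poly_eq_iff)
  note rel = this
  show ?case
  proof
    assume *: "poly (hyp_poly (Suc n) (b + 1) (c + 1)) z = 0"
    have rel: "z * ((1 - z) * ((a + 1) * (b + 1) * poly (hyp_poly n (b + 2) (c + 2)) z)) = 0"
      using rel Suc.prems(4) * by (simp add: A_def B_def C_def)
    have "b + 1 \<noteq> 0" using Suc.prems(1) by (metis Ints_0 Ints_add_of_nat_iff of_nat_1)
    moreover have "a + 1 \<noteq> 0" unfolding a(2)[symmetric] neg_equal_0_iff_equal by (rule of_nat_neq_0)
    ultimately have "poly (hyp_poly n (b + 1 + 1) (c + 1 + 1)) z = 0"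
      using rel z * by (simp add: add.assoc)
    moreover have "poly (hyp_poly n (b + 1 + 1) (c + 1 + 1)) z \<noteq> 0"
      using Suc.IH[of "b + 1" "c + 1"] Suc.prems Ints_add_of_nat_iff[of b 1] Ints_add_of_nat_iff[of c 1]
          * by simp
    ultimately show False by simp
  qed
qed

lemma hyp2F1_linearly_independent:
  assumes "\<And>\<alpha> \<beta> \<gamma> z. norm z < 1 \<Longrightarrow> \<gamma> \<notin> \<int>
      \<Longrightarrow>
     eval4 A \<alpha> \<beta> \<gamma> z * hyp2F1 \<alpha> \<beta> \<gamma> z + eval4 B \<alpha> \<beta>
         \<gamma> z * hyp2F1 (\<alpha> + 1) (\<beta> + 1) (\<gamma> + 1) z = 0"
  shows "A = 0" "B = 0"
proof -
  \<comment> \<open>The bound is uniform in the parameters and can be fixed before n is chosen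
    larger.\<close>
  obtain d where d: "\<And>\<alpha> \<beta> \<gamma>. degree (eval4_z B \<alpha> \<beta> \<gamma>) \<le> d"
    using degree_eval4_z_bounded by blast
  have zero: "eval4_z A (- of_nat n) \<beta> \<gamma> = 0 \<and> eval4_z B (- of_nat n) \<beta> \<gamma>
      = 0"
    if gen: "\<beta> \<notin> \<int>" "\<gamma> \<notin> \<int>" "\<beta> - \<gamma> \<notin> \<int>" and
        n: "n > d" for n \<beta> \<gamma>
  proof -
    obtain m where m: "n = Suc m" using n by (cases n) auto
    let ?A = "eval4_z A (- of_nat n) \<beta> \<gamma>" and ?B = "eval4_z B (- of_nat n) \<beta> \<gamma>"
    let ?p = "hyp_poly n \<beta> \<gamma>" and ?q = "hyp_poly m (\<beta> + 1) (\<gamma> + 1)"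
    have eq: "- of_nat n + 1 = (- of_nat m :: complex)" by (simp add: m)
    have "poly (?A * ?p + ?B * ?q) z = 0" if "norm z < 1" for z
      using assms[OF that gen(2), of "- of_nat n" \<beta>]
      unfolding eq hyp2F1_eq_hyp_poly by (simp add: poly_eval4_z)
    hence "{z. norm z < 1} \<subseteq> {z. poly (?A * ?p + ?B * ?q) z = 0}" by blast
    hence "infinite {z. poly (?A * ?p + ?B * ?q) z = 0}"
      using infinite_ball_complex by (rule infinite_super)
    hence *: "?A * ?p + ?B * ?q = 0" by (rule contrapos_np) (rule poly_roots_finite)
    have p: "degree ?p = n" using gen(1,2) by (rule degree_hyp_poly)
    hence p0: "?p \<noteq> 0" using n by (metis degree_0 not_less0)
    have "?B * ?q = ?p * (- ?A)" using * by (simp add: eq_neg_iff_add_eq_0 add.commute mult.commute)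
    hence "?p dvd ?B * ?q" by (rule dvdI)
    hence "?p dvd ?B"
    proof (rule poly_dvd_mult_cancel[OF _ p0])
      fix z
      assume "poly ?p z = 0"
      thus "poly ?q z \<noteq> 0" unfolding m by (rule hyp_poly_no_common_root[OF gen])
    qed
    hence "?B = 0 \<or> n \<le> degree ?B" using dvd_imp_degree_le[of ?p ?B] unfolding p by blast
    hence B: "?B = 0" using d[of "- of_nat n" \<beta> \<gamma>] n by linarith
    have "?A * ?p = 0" using * unfolding B by simp
    thus ?thesis using B p0 unfolding mult_eq_0_iff by blast
  qed
  show "A = 0" "B = 0"
  proof -
    have *: "eval4 A (- of_nat n) \<beta> \<gamma> z = 0 \<and> eval4 B (- of_nat n) \<beta> \<gamma> z = 0"
      if "\<beta> \<notin> \<int>" "\<gamma> \<notin> \<int>" "\<beta> - \<gamma> \<notin> \<int>" "n >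
          d" for \<beta> \<gamma> z n
      using zero[OF that] poly_eval4_z[of A "- of_nat n" \<beta> \<gamma> z] poly_eval4_z[of B "- of_nat
          n" \<beta> \<gamma> z]
      by (metis poly_0)
    show "A = 0"
      by (rule eval4_zeroI[of d]) (rule conjunct1[OF *])
    show "B = 0"
      by (rule eval4_zeroI[of d]) (rule conjunct2[OF *])
  qed
qed

lemma three_term_relation_unique:
  assumes "three_term_relation p q r R Q" "three_term_relation p q r R' Q'"
  shows "Q = Q'"
proof -
  from assms(1)[unfolded three_term_relation_def] obtain A B D where D: "D \<noteq> 0" and Q: "Q = Fract
      B D"
    and rel: "\<forall>\<alpha> \<beta> \<gamma> z. norm z < 1 \<longrightarrow> \<gamma> \<notin>
        \<int>\<^sub>\<le>\<^sub>0 \<longrightarrow> \<gamma> + of_int r \<notin>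
            \<int>\<^sub>\<le>\<^sub>0 \<longrightarrow> eval4 D \<alpha> \<beta> \<gamma> z \<noteq> 0
                \<longrightarrow>
           hyp2F1 (\<alpha> + of_int p) (\<beta> + of_int q) (\<gamma> + of_int r) z =
             eval4 A \<alpha> \<beta> \<gamma> z / eval4 D \<alpha> \<beta> \<gamma> z * hyp2F1 \<alpha>
                 \<beta> \<gamma> z +
             eval4 B \<alpha> \<beta> \<gamma> z / eval4 D \<alpha> \<beta> \<gamma> z * hyp2F1 (\<alpha>
                 + 1) (\<beta> + 1) (\<gamma> + 1) z"
    by (elim exE conjE)
  from assms(2)[unfolded three_term_relation_def] obtain A' B' D' where D': "D' \<noteq> 0" and Q': "Q' =
      Fract B' D'"
    and rel': "\<forall>\<alpha> \<beta> \<gamma> z. norm z < 1 \<longrightarrow> \<gamma> \<notin>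
        \<int>\<^sub>\<le>\<^sub>0 \<longrightarrow> \<gamma> + of_int r \<notin>
            \<int>\<^sub>\<le>\<^sub>0 \<longrightarrow> eval4 D' \<alpha> \<beta> \<gamma> z \<noteq> 0
                \<longrightarrow>
           hyp2F1 (\<alpha> + of_int p) (\<beta> + of_int q) (\<gamma> + of_int r) z =
             eval4 A' \<alpha> \<beta> \<gamma> z / eval4 D' \<alpha> \<beta> \<gamma> z * hyp2F1
                 \<alpha> \<beta> \<gamma> z +
             eval4 B' \<alpha> \<beta> \<gamma> z / eval4 D' \<alpha> \<beta> \<gamma> z * hyp2F1
                 (\<alpha> + 1) (\<beta> + 1) (\<gamma> + 1) z"
    by (elim exE conjE)
  have hom: "ring_hom_fun (\<lambda>P. eval4 P \<alpha> \<beta> \<gamma> z)" for \<alpha> \<beta> \<gamma> z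
    unfolding eval4_def by (rule ring_hom_fun_subst4) (simp add: ring_hom_fun_def)
  \<comment> \<open>The extra factor \<open>D * D'\<close> makes the relation hold trivially at
    points where a denominator vanishes, so it is available on the whole range required for
    independence.\<close>
  have "(B * D' - B' * D) * (D * D') = 0"
  proof (rule hyp2F1_linearly_independent(2)[where A = "(A * D' - A' * D) * (D * D')"])
    fix \<alpha> \<beta> \<gamma> z :: complex
    assume *: "norm z < 1" "\<gamma> \<notin> \<int>"
    let ?e = "\<lambda>P. eval4 P \<alpha> \<beta> \<gamma> z"
    have "\<gamma> + of_int r \<notin> \<int>" using *(2) by (metis Ints_diff Ints_of_int
        add_diff_cancel_right')
    hence "\<gamma> \<notin> \<int>\<^sub>\<le>\<^sub>0" "\<gamma> + of_int r \<notin>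
        \<int>\<^sub>\<le>\<^sub>0" using *(2) nonpos_Ints_subset_Ints by blast+
    note rel = rel[rule_format, OF *(1) this] and rel' = rel'[rule_format, OF *(1) this]
    show "?e ((A * D' - A' * D) * (D * D')) * hyp2F1 \<alpha> \<beta> \<gamma> z +
       ?e ((B * D' - B' * D) * (D * D')) * hyp2F1 (\<alpha> + 1) (\<beta> + 1) (\<gamma> + 1) z = 0"
    proof (cases "?e D = 0 \<or> ?e D' = 0")
      case False
      hence "?e A / ?e D * hyp2F1 \<alpha> \<beta> \<gamma> z + ?e B / ?e D * hyp2F1 (\<alpha> + 1)
          (\<beta> + 1) (\<gamma> + 1) z =
        ?e A' / ?e D' * hyp2F1 \<alpha> \<beta> \<gamma> z + ?e B' / ?e D' * hyp2F1 (\<alpha> + 1)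
            (\<beta> + 1) (\<gamma> + 1) z"
        using rel[of \<alpha> \<beta>] rel'[of \<alpha> \<beta>] by simp
      hence "(?e A * hyp2F1 \<alpha> \<beta> \<gamma> z + ?e B * hyp2F1 (\<alpha> + 1) (\<beta> + 1)
          (\<gamma> + 1) z) * ?e D' =
          (?e A' * hyp2F1 \<alpha> \<beta> \<gamma> z + ?e B' * hyp2F1 (\<alpha> + 1) (\<beta> + 1)
              (\<gamma> + 1) z) * ?e D"
        using False by (simp add: add_divide_distrib[symmetric] frac_eq_eq)
      thus ?thesis unfolding ring_hom_funD(4,6)[OF hom] by algebra
    qed (auto simp: ring_hom_funD(4,6)[OF hom])
  qed
  hence "B * D' = B' * D" using D D' by simp
  thus ?thesis using D D' by (simp add: Q Q' eq_fract)
qed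

section \<open>Analytic dependence on the parameters\<close>

text \<open>
  The terms of \<open>F(a, b; c; z) / \<Gamma>(c)\<close>, which is entire in the parameters: this excludes an
  accumulation of zeros at the poles of \<open>F\<close>.
\<close>

definition hyp_term :: "complex \<Rightarrow> complex \<Rightarrow> complex \<Rightarrow> complex
    \<Rightarrow> nat \<Rightarrow> complex" where
  "hyp_term a b c z n = pochhammer a n * pochhammer b n * rGamma (c + of_nat n) * z ^ n / fact n"

text \<open>Stated without division, so that it remains true where c + n = 0.\<close>

lemma hyp_term_Suc:
  "(of_nat n + 1) * (c + of_nat n) * hyp_term a b c z (Suc n) = (a + of_nat n) * (b + of_nat n) * z *
      hyp_term a b c z n"
proof -
  define g where "g = rGamma (c + of_nat (Suc n))"
  have g: "rGamma (c + of_nat n) = (c + of_nat n) * g"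
    using rGamma_plus1[of "c + of_nat n"] by (simp add: g_def add_ac)
  have N: "of_nat (Suc n) = (of_nat n + 1 :: complex)" by simp
  have "(of_nat n + 1 :: complex) \<noteq> 0" unfolding N[symmetric] by (rule of_nat_neq_0)
  thus ?thesis
    unfolding hyp_term_def g_def[symmetric] g pochhammer_Suc fact_Suc of_nat_mult power_Suc unfolding N
    by (simp add: divide_simps)
qed

text \<open>The ratio of consecutive terms has a bound depending only on M and tending to the norm
  of z. Past some \<open>K\<close> it is below a fixed \<rho> < 1, which gives a geometric majorant
  uniform in bounded parameters.\<close>

lemma hyp_term_bound:
  assumes z: "norm z < 1"
  obtains \<rho> K where "0 < \<rho>" "\<rho> < 1"
    "\<forall>a b c n. norm a \<le> M \<longrightarrow> norm b \<le> M \<longrightarrow> norm c \<le> M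
        \<longrightarrow>
      norm (hyp_term a b c z (n + K)) \<le> norm (hyp_term a b c z K) * \<rho> ^ n"
proof -
  define \<rho> where "\<rho> = (1 + norm z) / 2"
  have \<rho>: "0 < \<rho>" "\<rho> < 1" "norm z < \<rho>" using z by (simp_all add: \<rho>_def
      add_pos_nonneg)
  have "((\<lambda>n. (M + real n) * (M + real n) * norm z / ((real n + 1) * (real n - M)))
      \<longlongrightarrow> norm z) at_top"
    by real_asymp
  hence "eventually (\<lambda>n. (M + real n) * (M + real n) * norm z / ((real n + 1) * (real n - M)) <
      \<rho>) at_top"
    using \<rho>(3) by (rule order_tendstoD)
  \<comment> \<open>Beyond this index the lower bound n - M for the norm of c + n is
    positive.\<close>
  moreover have "eventually (\<lambda>n. real n > \<bar>M\<bar>) at_top"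
    using filterlim_real_sequentially by (simp add: filterlim_at_top_dense)
  ultimately have "eventually (\<lambda>n. real n > \<bar>M\<bar> \<and> (M + real n) * (M + real n) *
      norm z / ((real n + 1) * (real n - M)) < \<rho>) at_top"
    by eventually_elim simp
  then obtain K where K: "\<And>n. n \<ge> K \<Longrightarrow> real n > \<bar>M\<bar> \<and> (M + real n)
      * (M + real n) * norm z / ((real n + 1) * (real n - M)) < \<rho>"
    unfolding eventually_at_top_linorder by blast
  have bound: "norm (hyp_term a b c z (n + K)) \<le> norm (hyp_term a b c z K) * \<rho> ^ n"
    if abc: "norm a \<le> M" "norm b \<le> M" "norm c \<le> M" for a b c n
  proof (induction n)
    case (Suc n)
    define N where "N = n + K"
    have N: "real N > \<bar>M\<bar>" "(M + real N) * (M + real N) * norm z / ((real N + 1) * (real N -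
        M)) < \<rho>"
      using K[of N] by (auto simp: N_def)
    hence pos: "(real N + 1) * (real N - M) > 0" by simp
    have "real N - M \<le> norm (c + of_nat N)"
      using abc(3) norm_triangle_ineq4[of "c + of_nat N" c] by (simp add: norm_minus_commute)
    moreover have "norm (a + of_nat N) \<le> M + real N" "norm (b + of_nat N) \<le> M + real N"
      using abc norm_triangle_ineq[of a "of_nat N"] norm_triangle_ineq[of b "of_nat N"] by simp_all
    moreover have "norm (of_nat N + 1 :: complex) = real N + 1"
      using norm_of_nat[of "Suc N", where 'a = complex] by (simp add: add.commute)
    ultimately have le: "(real N + 1) * (real N - M) \<le> norm ((of_nat N + 1) * (c + of_nat N))"
      "norm (a + of_nat N) * norm (b + of_nat N) \<le> (M + real N) * (M + real N)"
      using N(1) unfolding norm_mult by (auto intro!: mult_mono)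
    have "(real N + 1) * (real N - M) * norm (hyp_term a b c z (Suc N)) \<le>
        norm ((of_nat N + 1) * (c + of_nat N) * hyp_term a b c z (Suc N))"
      unfolding norm_mult[of _ "hyp_term a b c z (Suc N)"] by (rule mult_right_mono[OF le(1)]) simp
    also have "\<dots> = norm (a + of_nat N) * norm (b + of_nat N) * norm z * norm (hyp_term a b c z N)"
      unfolding hyp_term_Suc by (simp add: norm_mult)
    also have "\<dots> \<le> (M + real N) * (M + real N) * norm z * norm (hyp_term a b c z N)"
      by (intro mult_right_mono le(2)) auto
    finally have "norm (hyp_term a b c z (Suc N)) \<le>
        (M + real N) * (M + real N) * norm z / ((real N + 1) * (real N - M)) * norm (hyp_term a b c z N)"
      by (simp add: pos_le_divide_eq[OF pos] mult.commute[of "norm (hyp_term a b c z (Suc N))"])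
    also have "\<dots> \<le> \<rho> * norm (hyp_term a b c z N)"
      using N(2) by (intro mult_right_mono) auto
    also have "\<dots> \<le> \<rho> * (norm (hyp_term a b c z K) * \<rho> ^ n)"
      using Suc \<rho>(1) by (simp add: N_def)
    finally show ?case by (simp add: N_def mult_ac)
  qed simp
  show thesis by (rule that[OF \<rho>(1,2), of K]) (intro allI impI bound)
qed

lemma summable_hyp_term:
  assumes "norm z < 1"
  shows "summable (hyp_term a b c z)"
proof -
  define M where "M = max (norm a) (max (norm b) (norm c))"
  have M: "norm a \<le> M" "norm b \<le> M" "norm c \<le> M" by (simp_all add: M_def)
  obtain \<rho> K where \<rho>: "0 < \<rho>" "\<rho> < 1"
    and bound: "\<forall>a b c n. norm a \<le> M \<longrightarrow> norm b \<le> M \<longrightarrow> norm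
        c \<le> M \<longrightarrow>
      norm (hyp_term a b c z (n + K)) \<le> norm (hyp_term a b c z K) * \<rho> ^ n"
    by (rule hyp_term_bound[OF assms, of M])
  note le = bound[rule_format, OF M]
  have "summable (\<lambda>n. norm (hyp_term a b c z K) * \<rho> ^ n)"
    using \<rho> by (intro summable_mult summable_geometric) simp
  hence "summable (\<lambda>n. hyp_term a b c z (n + K))"
    by (rule summable_comparison_test'[where N = 0]) (rule le)
  thus ?thesis by (simp add: summable_iff_shift)
qed

lemma hyp_term_eq:
  assumes "c \<notin> \<int>\<^sub>\<le>\<^sub>0"
  shows "hyp_term a b c z n = rGamma c * (fps_nth (hyp2F1_fps a b c) n * z ^ n)"
proof -
  have "pochhammer c n \<noteq> 0" using add_of_nat_nonzero[OF assms] by (auto simp: pochhammer_eq_0_iff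
      eq_neg_iff_add_eq_0)
  thus ?thesis using pochhammer_rGamma[of c n] by (simp add: hyp_term_def hyp2F1_fps_nth)
qed

lemma suminf_hyp_term:
  assumes "norm z < 1" "c \<notin> \<int>\<^sub>\<le>\<^sub>0"
  shows "(\<Sum>n. hyp_term a b c z n) = rGamma c * hyp2F1 a b c z"
    and "summable (\<lambda>n. fps_nth (hyp2F1_fps a b c) n * z ^ n)"
proof -
  have "rGamma c \<noteq> 0" using assms(2) by (simp add: rGamma_eq_zero_iff)
  moreover have eq: "hyp_term a b c z = (\<lambda>n. rGamma c * (fps_nth (hyp2F1_fps a b c) n * z ^ n))"
    by (rule ext) (rule hyp_term_eq[OF assms(2)])
  ultimately show s: "summable (\<lambda>n. fps_nth (hyp2F1_fps a b c) n * z ^ n)"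
    using summable_hyp_term[OF assms(1), of a b c] by (simp only: eq summable_cmult_iff) auto
  show "(\<Sum>n. hyp_term a b c z n) = rGamma c * hyp2F1 a b c z"
    using suminf_mult[OF s, of "rGamma c"] by (simp add: eq hyp2F1_def eval_fps_def)
qed

lemma fps_conv_radius_hyp2F1_fps:
  assumes "c \<notin> \<int>\<^sub>\<le>\<^sub>0"
  shows "fps_conv_radius (hyp2F1_fps a b c) \<ge> 1"
  unfolding fps_conv_radius_def
proof (rule conv_radius_geI_ex)
  fix r :: real
  assume "0 < r" "ereal r < 1"
  hence "norm (of_real r :: complex) < 1" by simp
  from suminf_hyp_term(2)[OF this assms, of a b] \<open>0 < r\<close>
  show "\<exists>z. norm z = r \<and> summable (\<lambda>n. fps_nth (hyp2F1_fps a b c) n * z ^ n)"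
    by (intro exI[of _ "of_real r"]) auto
qed

text \<open>The parameters are bounded on a closed unit disc, so the tail after \<open>K\<close> has
  a geometric majorant there and the partial sums converge uniformly.\<close>

lemma holomorphic_hyp_term_suminf:
  assumes z: "norm z < 1"
    and hol: "A holomorphic_on UNIV" "B holomorphic_on UNIV" "C holomorphic_on UNIV"
  shows "(\<lambda>w. \<Sum>n. hyp_term (A w) (B w) (C w) z n) holomorphic_on UNIV"
proof (rule holomorphic_uniform_sequence[OF open_UNIV])
  have hol_term: "(\<lambda>w. hyp_term (A w) (B w) (C w) z n) holomorphic_on UNIV" for n
    unfolding hyp_term_def pochhammer_prod by (intro holomorphic_intros hol holomorphic_rGamma') auto
  thus "(\<lambda>w. \<Sum>n<N. hyp_term (A w) (B w) (C w) z n) holomorphic_on UNIV" for N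
    by (intro holomorphic_intros)
  fix w0 :: complex
  have cont: "continuous_on (cball w0 1) A" "continuous_on (cball w0 1) B" "continuous_on (cball w0 1) C"
    using hol by (auto intro!: holomorphic_on_imp_continuous_on intro: holomorphic_on_subset)
  have bnd: "\<exists>M. \<forall>w\<in>cball w0 1. norm (f w) \<le> M" if "continuous_on (cball w0 1) f"
      for f :: "complex \<Rightarrow> complex"
    using compact_imp_bounded[OF compact_continuous_image[OF that compact_cball]] by (auto simp:
        bounded_iff)
  obtain MA MB MC where "\<forall>w\<in>cball w0 1. norm (A w) \<le> MA" "\<forall>w\<in>cball w0 1. norm
      (B w) \<le> MB" "\<forall>w\<in>cball w0 1. norm (C w) \<le> MC"
    using bnd[OF cont(1)] bnd[OF cont(2)] bnd[OF cont(3)] by blast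
  hence M: "\<And>w. w \<in> cball w0 1 \<Longrightarrow> norm (A w) \<le> max MA (max MB MC) \<and> norm
      (B w) \<le> max MA (max MB MC) \<and> norm (C w) \<le> max MA (max MB MC)"
    by (meson max.coboundedI1 max.coboundedI2)
  obtain \<rho> K where \<rho>: "0 < \<rho>" "\<rho> < 1" and bound: "\<forall>a b c n. norm a \<le> max
      MA (max MB MC) \<longrightarrow> norm b \<le> max MA (max MB MC) \<longrightarrow> norm c \<le> max
          MA (max MB MC) \<longrightarrow>
      norm (hyp_term a b c z (n + K)) \<le> norm (hyp_term a b c z K) * \<rho> ^ n"
    by (rule hyp_term_bound[OF z, of "max MA (max MB MC)"])
  have le: "norm (hyp_term (A w) (B w) (C w) z (n + K)) \<le> norm (hyp_term (A w) (B w) (C w) z K) *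
      \<rho> ^ n"
    if "w \<in> cball w0 1" for w n
    using bound M[OF that] by blast
  have contn: "continuous_on (cball w0 1) (\<lambda>w. hyp_term (A w) (B w) (C w) z n)" for n
    using hol_term[of n] by (intro holomorphic_on_imp_continuous_on) (rule holomorphic_on_subset, auto)
  obtain T where T: "\<And>w. w \<in> cball w0 1 \<Longrightarrow> norm (hyp_term (A w) (B w) (C w) z K)
      \<le> T"
    using bnd[OF contn[of K]] by blast
  have u: "uniform_limit (cball w0 1) (\<lambda>N w. \<Sum>n<N. hyp_term (A w) (B w) (C w) z (n + K))
      (\<lambda>w. \<Sum>n. hyp_term (A w) (B w) (C w) z (n + K)) sequentially"
  proof (rule Weierstrass_m_test[where M = "\<lambda>n. T * \<rho> ^ n"])
    fix n w assume w: "w \<in> cball w0 1"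
    show "norm (hyp_term (A w) (B w) (C w) z (n + K)) \<le> T * \<rho> ^ n"
      using order.trans[OF le[OF w] mult_right_mono[OF T[OF w], of "\<rho> ^ n"]] \<rho> by simp
  qed (use \<rho> in \<open>auto intro!: summable_mult summable_geometric\<close>)
  have "uniform_limit (cball w0 1) (\<lambda>N w. (\<Sum>n<K. hyp_term (A w) (B w) (C w) z n) +
      (\<Sum>n<N. hyp_term (A w) (B w) (C w) z (n + K)))
      (\<lambda>w. (\<Sum>n<K. hyp_term (A w) (B w) (C w) z n) + (\<Sum>n. hyp_term (A w) (B w) (C w) z
          (n + K))) sequentially"
    by (intro uniform_limit_add uniform_limit_const u)
  also have "(\<lambda>w. (\<Sum>n<K. hyp_term (A w) (B w) (C w) z n) + (\<Sum>n. hyp_term (A w) (B w) (C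
      w) z (n + K))) =
      (\<lambda>w. \<Sum>n. hyp_term (A w) (B w) (C w) z n)"
    using suminf_split_initial_segment[OF summable_hyp_term[OF z], of _ _ _ K] by (simp add: add.commute)
  also have "(\<lambda>N w. (\<Sum>n<K. hyp_term (A w) (B w) (C w) z n) + (\<Sum>n<N. hyp_term (A w) (B
      w) (C w) z (n + K))) =
      (\<lambda>N w. \<Sum>n<N + K. hyp_term (A w) (B w) (C w) z n)"
    by (intro ext) (induct_tac N, simp_all add: add_ac)
  finally have "uniform_limit (cball w0 1) (\<lambda>N w. \<Sum>n<N. hyp_term (A w) (B w) (C w) z n)
      (\<lambda>w. \<Sum>n. hyp_term (A w) (B w) (C w) z n) sequentially"
    unfolding uniform_limit_iff by (subst eventually_sequentially_seg[symmetric, of _ K])  blast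
  thus "\<exists>d>0. cball w0 d \<subseteq> UNIV \<and> uniform_limit (cball w0 d) (\<lambda>N w.
      \<Sum>n<N. hyp_term (A w) (B w) (C w) z n)
      (\<lambda>w. \<Sum>n. hyp_term (A w) (B w) (C w) z n) sequentially"
    by (intro exI[of _ 1]) auto
qed

lemma contiguous_family_hyp2F1:
  assumes "\<gamma> \<notin> \<int>\<^sub>\<le>\<^sub>0" "norm z < 1"
  shows "contiguous_family \<alpha> \<beta> \<gamma> z (\<lambda>i j k. hyp2F1 (\<alpha> + of_nat i)
      (\<beta> + of_nat j) (\<gamma> + of_nat k) z)"
  unfolding contiguous_family_def Let_def
proof (intro allI)
  fix i j k
  define h where "h = (\<lambda>i j k. hyp2F1_fps (\<alpha> + of_nat i) (\<beta> + of_nat j) (\<gamma> +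
      of_nat k))"
  define a b c where "a = \<alpha> + of_nat i" and "b = \<beta> + of_nat j" and "c = \<gamma> + of_nat k"
  have c: "c \<notin> \<int>\<^sub>\<le>\<^sub>0" unfolding c_def using assms(1) by (rule
      add_of_nat_notin_nonpos_Ints)
  have r: "norm z < fps_conv_radius (h i j k)" for i j k
    unfolding h_def using fps_conv_radius_hyp2F1_fps[OF add_of_nat_notin_nonpos_Ints[OF assms(1)]] assms(2)
    by (meson ereal_less(3) less_le_trans)
  have args: "\<alpha> + of_nat i = a" "\<beta> + of_nat j = b" "\<gamma> + of_nat k = c" "\<alpha> +
      of_nat (Suc i) = a + 1" "\<beta> + of_nat (Suc j) = b + 1"
    "\<gamma> + of_nat (Suc k) = c + 1" "\<gamma> + of_nat (Suc (Suc k)) = c + 2"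
    by (simp_all add: a_def b_def c_def)
  have h: "hyp2F1_fps a b c = h i j k" "hyp2F1_fps (a + 1) (b + 1) (c + 1) = h (Suc i) (Suc j) (Suc k)"
    "hyp2F1_fps (a + 1) b (c + 1) = h (Suc i) j (Suc k)" "hyp2F1_fps a b (c + 1) = h i j (Suc k)"
    "hyp2F1_fps (a + 1) (b + 1) (c + 2) = h (Suc i) (Suc j) (Suc (Suc k))"
    unfolding h_def args by simp_all
  have ev: "eval_fps (fps_const t * f) z = t * eval_fps f z" "eval_fps ((1 - fps_X) * f) z = (1 - z) *
      eval_fps f z"
    "eval_fps (fps_X * f) z = z * eval_fps f z"
    "norm z < fps_conv_radius (fps_const t * f)" "norm z < fps_conv_radius ((1 - fps_X) * f)"
    "norm z < fps_conv_radius (fps_X * f)"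
    if f: "norm z < fps_conv_radius f" for f t
  proof -
    have X: "norm z < fps_conv_radius (1 - fps_X :: complex fps)"
      by (rule less_le_trans[OF _ fps_conv_radius_diff]) simp
    show "eval_fps (fps_const t * f) z = t * eval_fps f z" "eval_fps (fps_X * f) z = z * eval_fps f z"
      using f by (simp_all add: eval_fps_mult)
    show "eval_fps ((1 - fps_X) * f) z = (1 - z) * eval_fps f z"
      using f X by (simp add: eval_fps_mult eval_fps_diff)
    show "norm z < fps_conv_radius (fps_const t * f)" "norm z < fps_conv_radius ((1 - fps_X) * f)"
      "norm z < fps_conv_radius (fps_X * f)"
      using f X by (auto intro!: less_le_trans[OF _ fps_conv_radius_mult])
  qed
  have ev2: "eval_fps (f + g) z = eval_fps f z + eval_fps g z" "eval_fps (f - g) z = eval_fps f z -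
      eval_fps g z"
    "norm z < fps_conv_radius (f - g)"
    if "norm z < fps_conv_radius f" "norm z < fps_conv_radius g" for f g
    using that by (auto intro: eval_fps_add eval_fps_diff less_le_trans[OF _ fps_conv_radius_diff])
  note rel = hyp2F1_fps_shift_112[OF c, of a b] hyp2F1_fps_shift_101[OF c, of a b]
      hyp2F1_fps_shift_001[OF c, of a b]
  note rel = rel[unfolded h, THEN arg_cong[where f = "\<lambda>f. eval_fps f z"]]
  show "(\<gamma> + of_nat k) * (\<gamma> + of_nat k + 1) *
       (hyp2F1 (\<alpha> + of_nat i) (\<beta> + of_nat j) (\<gamma> + of_nat k) z -
        (1 - z) * hyp2F1 (\<alpha> + of_nat (Suc i)) (\<beta> + of_nat (Suc j)) (\<gamma> + of_nat (Suc
            k)) z) =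
       (\<gamma> + of_nat k - (\<alpha> + of_nat i)) * (\<gamma> + of_nat k - (\<beta> + of_nat j)) *
       (z * hyp2F1 (\<alpha> + of_nat (Suc i)) (\<beta> + of_nat (Suc j)) (\<gamma> + of_nat (Suc (Suc
           k))) z) \<and>
       (\<gamma> + of_nat k) * hyp2F1 (\<alpha> + of_nat i) (\<beta> + of_nat j) (\<gamma> + of_nat k) z =
       (\<gamma> + of_nat k - (\<beta> + of_nat j)) * hyp2F1 (\<alpha> + of_nat (Suc i)) (\<beta> +
           of_nat j) (\<gamma> + of_nat (Suc k)) z +
       (\<beta> + of_nat j) * ((1 - z) * hyp2F1 (\<alpha> + of_nat (Suc i)) (\<beta> + of_nat (Suc j))
           (\<gamma> + of_nat (Suc k)) z) \<and>
       (\<gamma> + of_nat k - (\<alpha> + of_nat i)) * (\<gamma> + of_nat k - (\<beta> + of_nat j)) *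
       hyp2F1 (\<alpha> + of_nat i) (\<beta> + of_nat j) (\<gamma> + of_nat (Suc k)) z =
       (\<gamma> + of_nat k) * (\<gamma> + of_nat k - (\<alpha> + of_nat i) - (\<beta> + of_nat j)) *
       hyp2F1 (\<alpha> + of_nat i) (\<beta> + of_nat j) (\<gamma> + of_nat k) z +
       (\<alpha> + of_nat i) * (\<beta> + of_nat j) *
       ((1 - z) * hyp2F1 (\<alpha> + of_nat (Suc i)) (\<beta> + of_nat (Suc j)) (\<gamma> + of_nat (Suc
           k)) z)"
    unfolding args hyp2F1_def h using rel by (simp only: ev ev2 r)
qed

section \<open>Specialisation to the line\<close>

lemma shift_replicate:
  "shiftA (replicate n Step001 @ ss) = shiftA ss" "shiftB (replicate n Step001 @ ss) = shiftB ss"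
  "shiftC (replicate n Step001 @ ss) = n + shiftC ss"
  "shiftA (replicate n Step101 @ ss) = n + shiftA ss" "shiftB (replicate n Step101 @ ss) = shiftB ss"
  "shiftC (replicate n Step101 @ ss) = n + shiftC ss"
  "shiftA (replicate n Step112 @ ss) = n + shiftA ss" "shiftB (replicate n Step112 @ ss) = n + shiftB ss"
  "shiftC (replicate n Step112 @ ss) = 2 * n + shiftC ss"
  by (induction n) auto

lemma subst4_coef:
  assumes "ring_hom_fun h"
  shows "subst4 h (coefU ss var\<alpha> var\<beta> var\<gamma> var_z) \<alpha> \<beta> \<gamma> z = coefU
      ss \<alpha> \<beta> \<gamma> (z :: 'k :: idom)"
    "subst4 h (coefP ss var\<alpha> var\<beta> var\<gamma> var_z) \<alpha> \<beta> \<gamma> z = coefP ss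
        \<alpha> \<beta> \<gamma> z"
    "subst4 h (coefD ss var\<alpha> var\<beta> var\<gamma>) \<alpha> \<beta> \<gamma> z = coefD ss
        \<alpha> \<beta> \<gamma>"
proof -
  let ?\<phi> = "\<lambda>P. subst4 h P \<alpha> \<beta> \<gamma> z"
  note \<phi> = ring_hom_funD[OF ring_hom_fun_subst4[OF assms, of \<alpha> \<beta> \<gamma> z]]
  note hom = coef_hom[where \<phi> = ?\<phi>, OF \<phi>(3,4,2), unfolded subst4_vars[OF assms]]
  show "?\<phi> (coefU ss var\<alpha> var\<beta> var\<gamma> var_z) = coefU ss \<alpha> \<beta> \<gamma> z"
    "?\<phi> (coefP ss var\<alpha> var\<beta> var\<gamma> var_z) = coefP ss \<alpha> \<beta> \<gamma> z"
    "?\<phi> (coefD ss var\<alpha> var\<beta> var\<gamma>) = coefD ss \<alpha> \<beta> \<gamma>"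
    by (simp_all only: hom subst4_vars[OF assms])
qed

lemma poly_coef:
  fixes a b c z :: "'a :: idom poly"
  shows "poly (coefU ss a b c z) w = coefU ss (poly a w) (poly b w) (poly c w) (poly z w)"
    "poly (coefP ss a b c z) w = coefP ss (poly a w) (poly b w) (poly c w) (poly z w)"
    "poly (coefD ss a b c) w = coefD ss (poly a w) (poly b w) (poly c w)"
  by (rule coef_hom[where \<phi> = "\<lambda>p. poly p w"]; simp)+

lemma poly_pochhammer: "poly (pochhammer p n) w = pochhammer (poly p w) n"
  by (induction n) (simp_all add: pochhammer_Suc)

lemma pochhammer_linear_poly:
  fixes p :: "'a :: idom poly"
  assumes "degree p = 1"
  shows "pochhammer p n \<noteq> 0" "degree (pochhammer p n) = n"
proof -
  have deg: "degree (p + of_nat n) = 1" for n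
    using assms degree_add_eq_left[of "of_nat n" p] by (simp add: of_nat_poly)
  hence nz: "p + of_nat n \<noteq> 0" for n by (metis degree_0 zero_neq_one)
  have "pochhammer p n \<noteq> 0 \<and> degree (pochhammer p n) = n"
    using nz deg by (induction n) (simp_all add: pochhammer_Suc degree_mult_eq)
  thus "pochhammer p n \<noteq> 0" "degree (pochhammer p n) = n" by auto
qed

text \<open>Integer shifts turn the quotient of two Gamma normalisations into Pochhammer symbols,
  which become polynomials in w along the line.\<close>

lemma gamma_factor_ratio:
  fixes \<alpha> \<beta> \<gamma> :: complex and l m n :: nat
  assumes gen: "\<alpha> \<notin> \<int>" "\<beta> \<notin> \<int>" "\<gamma> \<notin> \<int>" "\<gamma>
      - \<alpha> \<notin> \<int>" "\<gamma> - \<beta> \<notin> \<int>"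
    and le: "0 < l" "l \<le> n" "0 < m" "m \<le> n"
  shows "gamma_factor (\<alpha> + of_nat l) (\<beta> + of_nat m) (\<gamma> + of_nat n) *
      (pochhammer (\<alpha> + 1) (l - 1) * pochhammer (\<beta> + 1) (m - 1) *
       pochhammer (\<alpha> + of_nat l - (\<gamma> + of_nat n) + 1) (n - l) * pochhammer (\<beta> +
           of_nat m - (\<gamma> + of_nat n) + 1) (n - m)) =
      pochhammer (\<gamma> + 1) (n - 1) * pochhammer (2 - (\<gamma> + of_nat n)) (n - 1) *
      gamma_factor (\<alpha> + 1) (\<beta> + 1) (\<gamma> + 1)"
proof -
  have G: "pochhammer t k = Gamma u / Gamma t" "Gamma t \<noteq> 0" "Gamma u \<noteq> 0"
    if "t \<notin> \<int>" "t + of_nat k = u" for t u :: complex and k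
  proof -
    have "u \<notin> \<int>" using that Ints_add_of_nat_iff by blast
    hence "t \<notin> \<int>\<^sub>\<le>\<^sub>0" "u \<notin> \<int>\<^sub>\<le>\<^sub>0" using that(1)
        nonpos_Ints_subset_Ints by blast+
    thus "pochhammer t k = Gamma u / Gamma t" "Gamma t \<noteq> 0" "Gamma u \<noteq> 0"
      using that(2) by (auto simp: pochhammer_Gamma Gamma_eq_zero_iff)
  qed
  have nat1: "of_nat (k - 1) = (of_nat k - 1 :: complex)" if "0 < k" for k using that by (simp add:
      of_nat_diff)
  have shift: "s + of_nat k \<notin> \<int>" "s - of_nat k \<notin> \<int>" "s + 1 \<notin> \<int>" if "s
      \<notin> \<int>" for s :: complex and k
    using that Ints_add_of_nat_iff[of s k] Ints_add_of_nat_iff[of "s - of_nat k" k]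
        Ints_add_of_nat_iff[of s 1] by simp_all
  have neg: "\<alpha> - \<gamma> \<notin> \<int>" "\<beta> - \<gamma> \<notin> \<int>" "1 - \<gamma>
      \<notin> \<int>"
    using gen Ints_minus[of "\<alpha> - \<gamma>"] Ints_minus[of "\<beta> - \<gamma>"] Ints_diff[of 1 "1
        - \<gamma>"] by auto
  have n: "0 < n" using le by simp
  have "\<alpha> + of_nat l - (\<gamma> + of_nat n) + 1 = \<alpha> - \<gamma> + of_nat (l + 1) - of_nat n"
    "\<beta> + of_nat m - (\<gamma> + of_nat n) + 1 = \<beta> - \<gamma> + of_nat (m + 1) - of_nat n"
    "2 - (\<gamma> + of_nat n) = 1 - \<gamma> + of_nat 1 - of_nat n" by simp_all
  hence notin: "\<alpha> + of_nat l - (\<gamma> + of_nat n) + 1 \<notin> \<int>" "\<beta> + of_nat m -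
      (\<gamma> + of_nat n) + 1 \<notin> \<int>"
    "2 - (\<gamma> + of_nat n) \<notin> \<int>"
    using shift neg by metis+
  have "\<alpha> + 1 - (\<gamma> + 1) + 1 = \<alpha> - \<gamma> + 1" "\<beta> + 1 - (\<gamma> + 1) + 1 =
      \<beta> - \<gamma> + 1" "2 - (\<gamma> + 1) = 1 - \<gamma>"
    by simp_all
  moreover note G1 = G[of "\<alpha> + 1" "l - 1" "\<alpha> + of_nat l"] and G2 = G[of "\<beta> + 1" "m -
      1" "\<beta> + of_nat m"]
    and G3 = G[of "\<alpha> + of_nat l - (\<gamma> + of_nat n) + 1" "n - l" "\<alpha> - \<gamma> + 1"]
    and G4 = G[of "\<beta> + of_nat m - (\<gamma> + of_nat n) + 1" "n - m" "\<beta> - \<gamma> + 1"]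
    and G5 = G[of "\<gamma> + 1" "n - 1" "\<gamma> + of_nat n"] and G6 = G[of "2 - (\<gamma> + of_nat n)"
        "n - 1" "1 - \<gamma>"]
  ultimately show ?thesis
    using notin shift(3)[OF gen(1)] shift(3)[OF gen(2)] shift(3)[OF gen(3)] le n
    by (simp add: gamma_factor_def nat1 of_nat_diff)
qed

lemma poly_truncation: "poly (truncation n \<phi>) z = (\<Sum>k\<le>n. fps_nth \<phi> k * z ^ k)"
proof -
  have "truncation n \<phi> = (\<Sum>k\<le>n. monom (fps_nth \<phi> k) k)"
    by (rule poly_eqI) (simp add: truncation_def coeff_truncate_fps coeff_sum sum.delta less_Suc_eq_le)
  thus ?thesis by (simp add: poly_sum poly_monom)
qed

text \<open>Reflection turns the second denominator, up to sign, into the last j factors of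
  \<open>pochhammer c m\<close>, and the first denominator is its first i factors; the middle
  factors remain.\<close>

lemma pochhammer_split_cancel:
  fixes c :: complex
  assumes "c \<notin> \<int>" "i + j \<le> m"
  shows "pochhammer c m / (pochhammer c i * pochhammer (1 - c - of_nat m) j) =
    (-1) ^ j * pochhammer (c + of_nat i) (m - i - j)"
proof -
  have nz: "pochhammer (c + of_nat k) n \<noteq> 0" for k n
  proof -
    have "c + of_nat k + of_nat i \<noteq> 0" for i using assms(1) by (metis Ints_0 Ints_add_of_nat_iff)
    thus ?thesis by (auto simp: pochhammer_eq_0_iff eq_neg_iff_add_eq_0)
  qed
  have "pochhammer c m = pochhammer c (i + ((m - i - j) + j))" using assms(2) by simp
  also have "\<dots> = pochhammer c i * (pochhammer (c + of_nat i) (m - i - j) * pochhammer (c + of_nat i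
      + of_nat (m - i - j)) j)"
    by (simp only: pochhammer_product')
  also have "c + of_nat i + of_nat (m - i - j) = c + of_nat (m - j)"
    using assms(2) by (simp add: of_nat_diff)
  finally have 1: "pochhammer c m = pochhammer c i * (pochhammer (c + of_nat i) (m - i - j) * pochhammer
      (c + of_nat (m - j)) j)" .
  have "1 - c - of_nat m = - (c + of_nat m - 1)" by simp
  hence "pochhammer (1 - c - of_nat m) j = (-1) ^ j * pochhammer (c + of_nat m - 1 - of_nat j + 1) j"
    by (simp only: pochhammer_minus)
  also have "c + of_nat m - 1 - of_nat j + 1 = c + of_nat (m - j)"
    using assms(2) by (simp add: of_nat_diff)
  finally have 2: "pochhammer (1 - c - of_nat m) j = (-1) ^ j * pochhammer (c + of_nat (m - j)) j" .
  have "(-1) ^ j * (-1) ^ j = (1 :: complex)" by (simp add: power_mult_distrib[symmetric])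
  thus ?thesis unfolding 1 2 using nz[of 0 i] nz[of "m - j" j] by (simp add: divide_simps)
qed

context
  fixes p q r :: int and a b x :: real
  assumes qp: "0 < q" "q \<le> p" "p + q \<le> r" and x: "0 < x" "x < 1"
begin

text \<open>Only q - 1 copies of \<open>Step112\<close> occur, since the empty list already stands
  for a final shift (1, 1, 2).\<close>

definition steps :: "contiguous_step list" where
  "steps = replicate (nat (r - p - q)) Step001 @ replicate (nat (p - q)) Step101 @ replicate (nat (q -
      1)) Step112 @ []"

lemma steps: "shiftA steps = nat p" "shiftB steps = nat q" "shiftC steps = nat r" "length steps = nat (r
    - q - 1)"
  unfolding steps_def shift_replicate using qp by auto

abbreviation "line\<alpha> \<equiv> [:of_real a :: complex, of_int p:]"
abbreviation "line\<beta> \<equiv> [:of_real b :: complex, of_int q:]"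
abbreviation "line\<gamma> \<equiv> [:0 :: complex, of_int r:]"

definition "lineU = coefU steps line\<alpha> line\<beta> line\<gamma> [:of_real x:]"
definition "lineP = coefP steps line\<alpha> line\<beta> line\<gamma> [:of_real x:]"
definition "lineD = coefD steps line\<alpha> line\<beta> line\<gamma>"

lemma of_int_neq_zero: "(of_int p :: complex) \<noteq> 0" "(of_int q :: complex) \<noteq> 0" "(of_int r
    :: complex) \<noteq> 0"
  "(of_int r - of_int p :: complex) \<noteq> 0" "(of_int r - of_int q :: complex) \<noteq> 0"
  using qp by (auto simp: of_int_diff[symmetric] simp del: of_int_diff)

lemma degree_lineD: "degree lineD = coef_degree steps"
  unfolding lineD_def using of_int_neq_zero by (intro degree_coefD) simp_all

lemma coef_degree_pos: "coef_degree ss > 0"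
  by (induction ss rule: contiguous_steps_induct) auto

lemma lineD_neq_0: "lineD \<noteq> 0"
  using degree_lineD coef_degree_pos[of steps] by auto

lemma degree_lineP: "degree lineP \<le> coef_degree steps"
  unfolding lineP_def using degree_coef[of line\<alpha> 1 line\<beta> line\<gamma> "[:of_real x:]" 0
      steps] by simp

lemma contiguous_Q_eq:
  defines "B \<equiv> (1 - var_z) * coefP steps var\<alpha> var\<beta> var\<gamma> var_z"
    and "D \<equiv> coefD steps var\<alpha> var\<beta> var\<gamma> * var_z ^ (nat r - 1)"
  shows "contiguous_Q p q r = Fract B D" "D \<noteq> 0"
    "subst_line p q r a b x B = (1 - [:of_real x:]) * lineP" "subst_line p q r a b x D = lineD *
        [:of_real x:] ^ (nat r - 1)"
proof -
  note sl = ring_hom_funD[OF ring_hom_fun_subst4[OF ring_hom_fun_const_poly]]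
  show B: "subst_line p q r a b x B = (1 - [:of_real x:]) * lineP"
    and D: "subst_line p q r a b x D = lineD * [:of_real x:] ^ (nat r - 1)"
    unfolding subst_line_def B_def D_def sl subst4_vars[OF ring_hom_fun_const_poly]
      subst4_coef[OF ring_hom_fun_const_poly] lineP_def lineD_def by simp_all
  \<comment> \<open>A generic polynomial is nonzero as soon as its specialisation to the line
    is.\<close>
  show "D \<noteq> 0"
  proof
    assume "D = 0"
    hence "lineD * [:of_real x:] ^ (nat r - 1) = 0"
      unfolding D[symmetric] subst_line_def by (simp only: sl)
    thus False using lineD_neq_0 x by simp
  qed
  define A where "A = coefU steps var\<alpha> var\<beta> var\<gamma> var_z"
  have id: "ring_hom_fun (\<lambda>c :: complex. c)" by (simp add: ring_hom_fun_def)
  note ev = ring_hom_funD[OF ring_hom_fun_subst4[OF id]]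
  have "three_term_relation p q r (Fract A D) (Fract B D)"
    unfolding three_term_relation_def
  proof (intro exI conjI allI impI)
    fix \<alpha> \<beta> \<gamma> z :: complex
    assume *: "norm z < 1" "\<gamma> \<notin> \<int>\<^sub>\<le>\<^sub>0" and nz: "eval4 D \<alpha>
        \<beta> \<gamma> z \<noteq> 0"
    have e: "eval4 A \<alpha> \<beta> \<gamma> z = coefU steps \<alpha> \<beta> \<gamma> z" "eval4 B
        \<alpha> \<beta> \<gamma> z = (1 - z) * coefP steps \<alpha> \<beta> \<gamma> z"
      "eval4 D \<alpha> \<beta> \<gamma> z = coefD steps \<alpha> \<beta> \<gamma> * z ^ (nat r - 1)"
      unfolding eval4_def A_def B_def D_def ev subst4_vars[OF id] subst4_coef[OF id] by simp_all
    have "coefD steps \<alpha> \<beta> \<gamma> * (z ^ (nat r - 1) * hyp2F1 (\<alpha> + of_int p)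
        (\<beta> + of_int q) (\<gamma> + of_int r) z) =
        coefU steps \<alpha> \<beta> \<gamma> z * hyp2F1 \<alpha> \<beta> \<gamma> z + (1 - z) * coefP
            steps \<alpha> \<beta> \<gamma> z * hyp2F1 (\<alpha> + 1) (\<beta> + 1) (\<gamma> + 1) z"
      using contiguous_family_relation[OF contiguous_family_hyp2F1[OF *(2,1), of \<alpha> \<beta>], of
          steps] qp
      unfolding steps by simp
    thus "hyp2F1 (\<alpha> + of_int p) (\<beta> + of_int q) (\<gamma> + of_int r) z =
        eval4 A \<alpha> \<beta> \<gamma> z / eval4 D \<alpha> \<beta> \<gamma> z * hyp2F1 \<alpha>
            \<beta> \<gamma> z +
        eval4 B \<alpha> \<beta> \<gamma> z / eval4 D \<alpha> \<beta> \<gamma> z * hyp2F1 (\<alpha> + 1)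
            (\<beta> + 1) (\<gamma> + 1) z"
      using nz unfolding e by (simp add: add_divide_distrib[symmetric] eq_divide_eq mult_ac)
  qed (rule \<open>D \<noteq> 0\<close> refl)+
  thus "contiguous_Q p q r = Fract B D"
    unfolding contiguous_Q_def using three_term_relation_unique by (intro the_equality) blast+
qed

text \<open>An arbitrary fraction representing Q is compared with the explicit one by
  cross-multiplication before specialising; the factor 1 - x and the specialised denominator are
  nonzero.\<close>

lemma from_contiguous_relations_iff: "from_contiguous_relations p q r a b x \<longleftrightarrow> lineP = 0"
proof -
  define B where "B = (1 - var_z) * coefP steps var\<alpha> var\<beta> var\<gamma> var_z"
  define D where "D = coefD steps var\<alpha> var\<beta> var\<gamma> * var_z ^ (nat r - 1)"
  note Q = contiguous_Q_eq[folded B_def D_def]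
  note sl = ring_hom_funD[OF ring_hom_fun_subst4[OF ring_hom_fun_const_poly], folded subst_line_def]
  have zero: "Fract s t = 0 \<longleftrightarrow> s = 0" if "t \<noteq> 0" for s t :: "complex poly"
    using that by (simp add: Zero_fract_def eq_fract)
  have nz: "1 - [:complex_of_real x:] \<noteq> 0" "lineD * [:of_real x:] ^ (nat r - 1) \<noteq> 0"
    using x lineD_neq_0 by (auto simp: one_pCons)
  show ?thesis
  proof
    assume "from_contiguous_relations p q r a b x"
    then obtain N E where NE: "Fract B D = Fract N E" "subst_line p q r a b x E \<noteq> 0"
      "Fract (subst_line p q r a b x N) (subst_line p q r a b x E) = 0"
      unfolding from_contiguous_relations_def Q(1) by blast
    have "E \<noteq> 0" using NE(2) sl(1) by (auto simp: subst_line_def)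
    hence "B * E = N * D" using NE(1) Q(2) by (simp add: eq_fract)
    hence "subst_line p q r a b x B * subst_line p q r a b x E = subst_line p q r a b x N * subst_line p
        q r a b x D"
      unfolding subst_line_def by (metis sl(4))
    moreover have "subst_line p q r a b x N = 0" using NE(2,3) zero by blast
    ultimately show "lineP = 0" using NE(2) nz(1) unfolding Q(3) by simp
  next
    assume "lineP = 0"
    hence "subst_line p q r a b x B = 0" "subst_line p q r a b x D \<noteq> 0" using Q(3,4) nz by simp_all
    thus "from_contiguous_relations p q r a b x"
      unfolding from_contiguous_relations_def using Q(1) zero by blast
  qed
qed


section \<open>\<open>Phi\<close> as a polynomial in w\<close>

lemma Im_imp_notin_Ints: "Im z \<noteq> 0 \<Longrightarrow> z \<notin> \<int>"
  by (auto elim: Ints_cases)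

lemma infinite_Im_neq_0: "infinite {w. Im w \<noteq> 0}"
proof -
  have "(\<lambda>n :: nat. Complex 0 (real n + 1)) ` UNIV \<subseteq> {w. Im w \<noteq> 0}"
    by (auto simp: add_eq_0_iff)
  moreover have "infinite ((\<lambda>n :: nat. Complex 0 (real n + 1)) ` UNIV)"
    by (subst finite_image_iff) (auto simp: inj_on_def)
  ultimately show ?thesis using infinite_super by blast
qed

text \<open>Non-real points suffice for polynomial identities, and at them real linear functions of
  w with nonzero slope take no integer value.\<close>

lemma poly_eq_if_Im_neq_0:
  assumes "\<And>w. Im w \<noteq> 0 \<Longrightarrow> poly s w = poly t w"
  shows "s = t"
proof -
  have "{w. Im w \<noteq> 0} \<subseteq> {w. poly (s - t) w = 0}" using assms by auto
  hence "infinite {w. poly (s - t) w = 0}" using infinite_Im_neq_0 by (rule infinite_super)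
  hence "s - t = 0" by (rule contrapos_np) (rule poly_roots_finite)
  thus ?thesis by simp
qed

lemma Phi_fun_polynomial: "\<exists>P. \<forall>w. of_int r * w \<notin> \<int> \<longrightarrow> poly P
    w = Phi_fun p q r a b x w"
proof -
  define n m where "n = nat (r - q - 1)" and "m = nat (r - 1)"
  define \<xi> where "\<xi> = (of_real x :: complex)"
  define A B A' B' :: "complex poly" where "A = [:- of_real a, of_int (r - p):]" and "B = [:- of_real b,
      of_int (r - q):]"
    and "A' = [:1 + of_real a - of_int (r - p), - of_int (r - p):]" and "B' = [:1 + of_real b - of_int (r
        - q), - of_int (r - q):]"
  \<comment> \<open>The Cauchy product with the denominators cancelled against the leading
    Pochhammer symbol. The line \<open>[:of_nat i, of_int r:]\<close> is r w + i, the start of the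
    remaining middle factors.\<close>
  define P where "P = (\<Sum>k\<le>n. \<Sum>i\<le>k. smult (\<xi> ^ k * (-1) ^ (k - i) / (fact i * fact
      (k - i)))
      (pochhammer A i * pochhammer B i * pochhammer A' (k - i) * pochhammer B' (k - i) * pochhammer
          [:of_nat i, of_int r:] (m - i - (k - i))))"
  have "poly P w = Phi_fun p q r a b x w" if w: "of_int r * w \<notin> \<int>" for w
  proof -
    define c where "c = of_int r * w"
    have m: "(of_nat m :: complex) = of_int r - 1" using qp by (simp add: m_def of_nat_nat)
    define \<alpha> \<beta> \<alpha>' \<beta>' where "\<alpha> = of_int (r - p) * w - of_real a" and
        "\<beta> = of_int (r - q) * w - of_real b"
      and "\<alpha>' = 1 - (of_int (r - p) * (w + 1) - of_real a)" and "\<beta>' = 1 - (of_int (r - q) *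
          (w + 1) - of_real b)"
    have lines: "poly A w = \<alpha>" "poly B w = \<beta>" "poly A' w = \<alpha>'" "poly B' w = \<beta>'"
      by (simp_all add: A_def B_def A'_def B'_def \<alpha>_def \<beta>_def \<alpha>'_def \<beta>'_def
          algebra_simps)
    have c': "2 - of_int r * (w + 1) = 1 - c - of_nat m" unfolding m c_def by (simp add: algebra_simps)
    have "Phi_fun p q r a b x w = pochhammer c m * poly (truncation n (hyp2F1_fps \<alpha> \<beta> c *
        hyp2F1_fps \<alpha>' \<beta>' (1 - c - of_nat m))) \<xi>"
      unfolding c'[symmetric] unfolding Phi_fun_def alpha_star_def Let_def prod.case
        \<alpha>_def \<beta>_def \<alpha>'_def \<beta>'_def c_def m_def n_def \<xi>_def ..
    also have "\<dots> = (\<Sum>k\<le>n. \<Sum>i\<le>k. pochhammer c m * (fps_nth (hyp2F1_fps \<alpha>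
        \<beta> c) i * fps_nth (hyp2F1_fps \<alpha>' \<beta>' (1 - c - of_nat m)) (k - i) * \<xi> ^ k))"
      by (simp add: poly_truncation fps_mult_nth sum_distrib_left sum_distrib_right atLeast0AtMost)
    also have "\<dots> = (\<Sum>k\<le>n. \<Sum>i\<le>k. \<xi> ^ k * (-1) ^ (k - i) / (fact i * fact (k -
        i)) *
      (pochhammer \<alpha> i * pochhammer \<beta> i * pochhammer \<alpha>' (k - i) * pochhammer \<beta>'
          (k - i) * pochhammer (c + of_nat i) (m - i - (k - i))))"
    proof (intro sum.cong refl)
      fix k i assume "k \<in> {..n}" "i \<in> {..k}"
      hence "i + (k - i) \<le> m" using qp by (auto simp: n_def m_def)
      note split = pochhammer_split_cancel[OF w[folded c_def] this]
      have "pochhammer c m * (fps_nth (hyp2F1_fps \<alpha> \<beta> c) i * fps_nth (hyp2F1_fps \<alpha>'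
          \<beta>' (1 - c - of_nat m)) (k - i) * \<xi> ^ k) =
        \<xi> ^ k / (fact i * fact (k - i)) * (pochhammer \<alpha> i * pochhammer \<beta> i * pochhammer
            \<alpha>' (k - i) * pochhammer \<beta>' (k - i)) *
        (pochhammer c m / (pochhammer c i * pochhammer (1 - c - of_nat m) (k - i)))"
        by (simp add: hyp2F1_fps_nth mult_ac)
      thus "pochhammer c m * (fps_nth (hyp2F1_fps \<alpha> \<beta> c) i * fps_nth (hyp2F1_fps \<alpha>'
          \<beta>' (1 - c - of_nat m)) (k - i) * \<xi> ^ k) =
        \<xi> ^ k * (-1) ^ (k - i) / (fact i * fact (k - i)) *
        (pochhammer \<alpha> i * pochhammer \<beta> i * pochhammer \<alpha>' (k - i) * pochhammer
            \<beta>' (k - i) * pochhammer (c + of_nat i) (m - i - (k - i)))"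
        unfolding split by (simp only: times_divide_eq_left times_divide_eq_right mult_ac)
    qed
    also have "\<dots> = poly P w"
      unfolding P_def by (simp add: poly_sum poly_pochhammer lines c_def add.commute mult.commute[of w])
    finally show ?thesis ..
  qed
  thus ?thesis by (intro exI[of _ P]) (intro allI impI)
qed

lemma poly_Phi: "of_int r * w \<notin> \<int> \<Longrightarrow> poly (Phi p q r a b x) w = Phi_fun p q r
    a b x w"
proof -
  obtain P where P: "\<forall>w. of_int r * w \<notin> \<int> \<longrightarrow> poly P w = Phi_fun p q r
      a b x w"
    using Phi_fun_polynomial by blast
  have "Phi p q r a b x = P"
    unfolding Phi_def
  proof (rule the_equality)
    fix P' assume P': "\<forall>w. of_int r * w \<notin> \<int> \<longrightarrow> poly P' w = Phi_fun p q
        r a b x w"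
    show "P' = P"
    proof (rule poly_eq_if_Im_neq_0)
      fix w :: complex assume "Im w \<noteq> 0"
      hence "of_int r * w \<notin> \<int>" using qp by (intro Im_imp_notin_Ints) simp
      thus "poly P' w = poly P w" using P P' by simp
    qed
  qed (rule P)
  thus "of_int r * w \<notin> \<int> \<Longrightarrow> poly (Phi p q r a b x) w = Phi_fun p q r a b x w"
      using P by simp
qed

text \<open>The truncation identity for \<open>coefP\<close> along the line, with denominators
  cleared: \<open>K1\<close> and \<open>K2\<close> are the two sides of the Gamma quotient between
  the shifts (1, 1, 1) and (p, q, r).\<close>

lemma Phi_lineP_relation:
  defines "K1 \<equiv> pochhammer [:1, of_int r:] (nat r - 1) * pochhammer [:2 - of_int r, - of_int r:]
      (nat r - 1)"
    and "K2 \<equiv> pochhammer [:of_real a + 1, of_int p:] (nat p - 1) * pochhammer [:of_real b + 1,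
        of_int q:] (nat q - 1) *
      pochhammer [:of_real a + of_int p - of_int r + 1, of_int p - of_int r:] (nat r - nat p) *
      pochhammer [:of_real b + of_int q - of_int r + 1, of_int q - of_int r:] (nat r - nat q)"
  shows "lineD * K1 * Phi p q r a b x = pochhammer line\<gamma> (nat r - 1) * lineP * K2"
proof (rule poly_eq_if_Im_neq_0)
  fix w :: complex assume w: "Im w \<noteq> 0"
  define \<alpha> \<beta> \<gamma> where "\<alpha> = of_int p * w + of_real a" and "\<beta> = of_int q *
      w + of_real b" and "\<gamma> = of_int r * w"
  have gen: "\<alpha> \<notin> \<int>" "\<beta> \<notin> \<int>" "\<gamma> \<notin> \<int>" "\<gamma> -
      \<alpha> \<notin> \<int>" "\<gamma> - \<beta> \<notin> \<int>"
    using w qp by (auto intro!: Im_imp_notin_Ints simp: \<alpha>_def \<beta>_def \<gamma>_def)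
  define \<alpha>' \<beta>' \<gamma>' where "\<alpha>' = \<alpha> + of_nat (nat p)" and "\<beta>' =
      \<beta> + of_nat (nat q)" and "\<gamma>' = \<gamma> + of_nat (nat r)"
  define N1 Nr where "N1 = gamma_factor (\<alpha> + 1) (\<beta> + 1) (\<gamma> + 1)" and "Nr =
      gamma_factor \<alpha>' \<beta>' \<gamma>'"
  define T where "T = poly (truncation (nat (r - q - 1)) (hyp2F1_fps (\<gamma> - \<alpha>) (\<gamma> -
      \<beta>) \<gamma> *
     hyp2F1_fps (\<alpha>' - \<gamma>' + 1) (\<beta>' - \<gamma>' + 1) (2 - \<gamma>'))) (of_real x)"
  have lines: "poly line\<alpha> w = \<alpha>" "poly line\<beta> w = \<beta>" "poly line\<gamma> w =
      \<gamma>"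
    by (simp_all add: \<alpha>_def \<beta>_def \<gamma>_def mult.commute)
  have D: "poly lineD w = coefD steps \<alpha> \<beta> \<gamma>" and P: "poly lineP w = coefP steps
      \<alpha> \<beta> \<gamma> (of_real x)"
    unfolding lineD_def lineP_def poly_coef lines by simp_all
  have e1: "N1 * poly lineP w = poly lineD w * Nr * T"
    using arg_cong[OF coefP_eq_truncation[OF gen, of steps], of "\<lambda>s. poly s (of_real x)"]
    unfolding steps \<alpha>'_def[symmetric] \<beta>'_def[symmetric] \<gamma>'_def[symmetric] poly_smult
        poly_coef
      N1_def[symmetric] Nr_def[symmetric] T_def[symmetric] D P by simp
  have e2: "Nr * poly K2 w = poly K1 w * N1"
  proof -
    have "poly K2 w = pochhammer (\<alpha> + 1) (nat p - 1) * pochhammer (\<beta> + 1) (nat q - 1) *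
       pochhammer (\<alpha>' - \<gamma>' + 1) (nat r - nat p) * pochhammer (\<beta>' - \<gamma>' + 1)
           (nat r - nat q)"
      using qp by (simp add: K2_def poly_pochhammer \<alpha>'_def \<beta>'_def \<gamma>'_def \<alpha>_def
          \<beta>_def \<gamma>_def algebra_simps of_nat_nat)
    moreover have "poly K1 w = pochhammer (\<gamma> + 1) (nat r - 1) * pochhammer (2 - \<gamma>') (nat r
        - 1)"
      using qp by (simp add: K1_def poly_pochhammer \<gamma>'_def \<gamma>_def algebra_simps of_nat_nat)
    ultimately show ?thesis
      using gamma_factor_ratio[OF gen, of "nat p" "nat r" "nat q"] qp
      unfolding N1_def Nr_def \<alpha>'_def \<beta>'_def \<gamma>'_def by simp
  qed
  have nz: "N1 \<noteq> 0"
    unfolding N1_def using gen Ints_add_of_nat_iff[of _ 1] by (intro gamma_factor_shift(4)) simp_all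
  have "N1 * (poly lineP w * poly K2 w) = (N1 * poly lineP w) * poly K2 w" by (simp only: mult.assoc)
  also have "\<dots> = poly lineD w * T * (Nr * poly K2 w)" unfolding e1 by (simp only: mult_ac)
  also have "\<dots> = N1 * (poly lineD w * poly K1 w * T)" unfolding e2 by (simp only: mult_ac)
  finally have main: "poly lineP w * poly K2 w = poly lineD w * poly K1 w * T" using nz by simp
  have args: "\<alpha>' - \<gamma>' + 1 = 1 - (of_int (r - p) * (w + 1) - of_real a)" "\<beta>' -
      \<gamma>' + 1 = 1 - (of_int (r - q) * (w + 1) - of_real b)"
    "2 - \<gamma>' = 2 - of_int r * (w + 1)" "\<gamma> - \<alpha> = of_int (r - p) * w - of_real a"
        "\<gamma> - \<beta> = of_int (r - q) * w - of_real b"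
    using qp by (simp_all add: \<alpha>'_def \<beta>'_def \<gamma>'_def \<alpha>_def \<beta>_def
        \<gamma>_def algebra_simps of_nat_nat)
  have "Phi_fun p q r a b x w = pochhammer \<gamma> (nat (r - 1)) * T"
    unfolding T_def args Phi_fun_def alpha_star_def by (simp add: \<gamma>_def)
  hence Phi: "poly (Phi p q r a b x) w = pochhammer \<gamma> (nat r - 1) * T"
    using poly_Phi[of w] gen(3) nat_diff_distrib[of 1 r] qp by (simp add: \<gamma>_def)
  have "poly (lineD * K1 * Phi p q r a b x) w = pochhammer \<gamma> (nat r - 1) * (poly lineD w * poly K1
      w * T)"
    unfolding poly_mult Phi by (simp only: mult_ac)
  also have "\<dots> = poly (pochhammer line\<gamma> (nat r - 1) * lineP * K2) w"
    unfolding main[symmetric] poly_mult poly_pochhammer lines by (simp only: mult_ac)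
  finally show "poly (lineD * K1 * Phi p q r a b x) w = poly (pochhammer line\<gamma> (nat r - 1) * lineP
      * K2) w" .
qed

text \<open>Term by term, the explicit sum for \<open>Phi\<close> only gives degree at most 2 r - q
  - 2. The sharper bound comes from the relation with \<open>lineP\<close>: \<open>K1\<close> and
  \<open>K2\<close> have equal degrees and \<open>lineD\<close> has degree at least that of
  \<open>lineP\<close>, so only the r - 1 factors of the remaining Pochhammer symbol are
  left.\<close>

lemma Phi_eq_0_iff: "Phi p q r a b x = 0 \<longleftrightarrow> lineP = 0"
  and degree_Phi: "degree (Phi p q r a b x) < nat r"
proof -
  define K1 :: "complex poly" where "K1 = pochhammer [:1, of_int r:] (nat r - 1) * pochhammer [:2 -
      of_int r, - of_int r:] (nat r - 1)"
  define K2 :: "complex poly" where "K2 = pochhammer [:of_real a + 1, of_int p:] (nat p - 1) * pochhammer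
      [:of_real b + 1, of_int q:] (nat q - 1) *
      pochhammer [:of_real a + of_int p - of_int r + 1, of_int p - of_int r:] (nat r - nat p) *
      pochhammer [:of_real b + of_int q - of_int r + 1, of_int q - of_int r:] (nat r - nat q)"
  note rel = Phi_lineP_relation[folded K1_def K2_def]
  have nz: "(of_int p - of_int r :: complex) \<noteq> 0" "(of_int q - of_int r :: complex) \<noteq> 0"
    using of_int_neq_zero(4,5) by (metis minus_diff_eq neg_equal_0_iff_equal)+
  note poch = pochhammer_linear_poly
  note poch = pochhammer_linear_poly
  have K1: "K1 \<noteq> 0" "degree K1 = 2 * (nat r - 1)"
    unfolding K1_def using of_int_neq_zero by (simp_all add: poch degree_mult_eq)
  have K2: "K2 \<noteq> 0" "degree K2 = (nat p - 1) + (nat q - 1) + (nat r - nat p) + (nat r - nat q)"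
    unfolding K2_def using of_int_neq_zero nz by (simp_all add: poch degree_mult_eq)
  have nat_le: "1 \<le> nat p" "1 \<le> nat q" "nat p \<le> nat r" "nat q \<le> nat r" using qp by simp_all
  have "nat p - 1 + (nat q - 1) + (nat r - nat p) + (nat r - nat q) = 2 * (nat r - 1)"
    using nat_le by linarith
  note K2 = K2(1) K2(2)[unfolded this]
  have L: "pochhammer line\<gamma> (nat r - 1) \<noteq> 0" "degree (pochhammer line\<gamma> (nat r - 1))
      = nat r - 1"
    using of_int_neq_zero by (simp_all add: poch)
  show iff: "Phi p q r a b x = 0 \<longleftrightarrow> lineP = 0"
  proof
    assume "Phi p q r a b x = 0"
    hence "pochhammer line\<gamma> (nat r - 1) * lineP * K2 = 0" using rel by simp
    thus "lineP = 0" using K2(1) L(1) by simp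
  next
    assume "lineP = 0"
    hence "lineD * K1 * Phi p q r a b x = 0" using rel by simp
    thus "Phi p q r a b x = 0" using K1(1) lineD_neq_0 by simp
  qed
  show "degree (Phi p q r a b x) < nat r"
  proof (cases "Phi p q r a b x = 0")
    case False
    have "degree (lineD * K1 * Phi p q r a b x) = degree lineD + degree K1 + degree (Phi p q r a b x)"
      using False K1(1) lineD_neq_0 by (simp add: degree_mult_eq)
    moreover have "degree (pochhammer line\<gamma> (nat r - 1) * lineP * K2) \<le> (nat r - 1) +
        coef_degree steps + degree K2"
      using degree_lineP L(2) by (intro degree_bounds(1)) simp_all
    ultimately have "degree (Phi p q r a b x) \<le> nat r - 1"
      unfolding rel degree_lineD K1(2) K2(2) by linarith
    thus ?thesis using nat_le by linarith
  qed (use qp in simp)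
qed

text \<open>With the second coefficient gone, the three-term relation reads f(w + 1) = R(w) f(w).
  Dividing by Gamma(r w) makes f entire, so its exceptional points form a closed discrete set unless
  it vanishes identically.\<close>

lemma closed_form_solution_if_lineP_eq_0:
  assumes "lineP = 0"
  shows "closed_form_solution p q r a b x"
proof -
  define \<xi> where "\<xi> = (of_real x :: complex)"
  have \<xi>: "norm \<xi> < 1" "\<xi> \<noteq> 0" using x by (simp_all add: \<xi>_def)
  define f where "f = hyp_f p q r a b x"
  define G where "G = (\<lambda>w. \<Sum>n. hyp_term (of_int p * w + of_real a) (of_int q * w + of_real
      b) (of_int r * w) \<xi> n)"
  have hol: "G holomorphic_on UNIV"
    unfolding G_def by (intro holomorphic_hyp_term_suminf \<xi>(1) holomorphic_intros)
  have f: "G w = rGamma (of_int r * w) * f w" if "of_int r * w \<notin> \<int>\<^sub>\<le>\<^sub>0" for w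
    unfolding G_def f_def hyp_f_def \<xi>_def[symmetric] by (rule suminf_hyp_term(1)[OF \<xi>(1) that])
  have ev: "\<forall>\<^sub>\<approx>w\<in>UNIV. h w \<noteq> 0" if "h holomorphic_on UNIV" "h w0
      \<noteq> 0" for h :: "complex \<Rightarrow> complex" and w0
    using non_zero_neighbour_alt[OF that(1) open_UNIV connected_UNIV _ UNIV_I that(2)]
    by (simp add: eventually_cosparse_open_eq)
  \<comment> \<open>The point 1 / r gives the reciprocal Gamma function at 1, which is
    nonzero.\<close>
  have ev_rGamma: "\<forall>\<^sub>\<approx>w\<in>UNIV. rGamma (of_int r * w :: complex) \<noteq> 0"
    by (rule ev[of _ "1 / of_int r"]) (use of_int_neq_zero in \<open>auto intro!:
        holomorphic_intros\<close>)
  show ?thesis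
  proof (cases "\<forall>w. G w = 0")
    \<comment> \<open>Then f is zero away from the poles, and division by zero yields 0, so the zero
      polynomial over 1 is a witness.\<close>
    case True
    have "\<forall>\<^sub>\<approx>w\<in>UNIV. f (w + 1) / f w = poly 0 w / poly 1 w"
      using ev_rGamma
    proof eventually_elim
      case (elim w)
      hence "f w = 0" using f[of w] True by (simp add: rGamma_eq_zero_iff)
      thus ?case by simp
    qed
    thus ?thesis unfolding closed_form_solution_def f_def
      by (intro exI[of _ "0 :: complex poly"] exI[of _ "1 :: complex poly"] conjI) simp_all
  next
    case False
    then obtain w0 where "G w0 \<noteq> 0" by blast
    note evG = ev[OF hol this]
    obtain w1 where "poly lineD w1 \<noteq> 0" using lineD_neq_0 poly_all_0_iff_0 by blast
    hence evD: "\<forall>\<^sub>\<approx>w\<in>UNIV. poly lineD w \<noteq> 0" by (intro ev) (auto intro!: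
        holomorphic_intros)
    have "\<forall>\<^sub>\<approx>w\<in>UNIV. f (w + 1) / f w = poly lineU w / poly (smult (\<xi> ^ (nat
        r - 1)) lineD) w"
      using ev_rGamma evG evD
    proof eventually_elim
      case (elim w)
      have w: "of_int r * w \<notin> \<int>\<^sub>\<le>\<^sub>0" using elim(1) by (simp add:
          rGamma_eq_zero_iff)
      hence fw: "f w \<noteq> 0" using f[of w] elim(2) by auto
      define \<alpha> \<beta> \<gamma> where "\<alpha> = of_int p * w + of_real a" and "\<beta> = of_int
          q * w + of_real b" and "\<gamma> = of_int r * w"
      have lines: "poly line\<alpha> w = \<alpha>" "poly line\<beta> w = \<beta>" "poly line\<gamma> w =
          \<gamma>"
        by (simp_all add: \<alpha>_def \<beta>_def \<gamma>_def mult.commute)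
      have coefs: "coefD steps \<alpha> \<beta> \<gamma> = poly lineD w" "coefU steps \<alpha> \<beta>
          \<gamma> \<xi> = poly lineU w" "coefP steps \<alpha> \<beta> \<gamma> \<xi> = 0"
        using arg_cong[OF assms, of "\<lambda>s. poly s w"]
        unfolding lineD_def lineU_def lineP_def poly_coef lines \<xi>_def by simp_all
      have "f (w + 1) = hyp2F1 (\<alpha> + of_nat (nat p)) (\<beta> + of_nat (nat q)) (\<gamma> + of_nat
          (nat r)) \<xi>"
        using qp by (simp add: f_def hyp_f_def \<alpha>_def \<beta>_def \<gamma>_def \<xi>_def
            algebra_simps of_nat_nat)
      moreover have "f w = hyp2F1 \<alpha> \<beta> \<gamma> \<xi>"
        by (simp add: f_def hyp_f_def \<alpha>_def \<beta>_def \<gamma>_def \<xi>_def)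
      ultimately have "poly lineD w * (\<xi> ^ (nat r - 1) * f (w + 1)) = poly lineU w * f w"
        using contiguous_family_relation[OF contiguous_family_hyp2F1[OF w[folded \<gamma>_def] \<xi>(1),
            of \<alpha> \<beta>], of steps]
        unfolding steps coefs by simp
      thus ?case using fw elim(3) \<xi>(2) by (simp add: divide_simps mult_ac)
    qed
    moreover have "smult (\<xi> ^ (nat r - 1)) lineD \<noteq> 0" using \<xi>(2) lineD_neq_0 by simp
    ultimately show ?thesis unfolding closed_form_solution_def f_def
      by (intro exI[of _ lineU] exI[of _ "smult (\<xi> ^ (nat r - 1)) lineD"] conjI)
  qed
qed

end

theorem theorem2p9:
  fixes p q r :: int and a b x :: real
  assumes "0 < q" and "q \<le> p" and "p + q \<le> r" and "0 < x" and "x < 1"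
  shows "(closed_form_solution p q r a b x \<and> from_contiguous_relations p q r a b x
            \<longleftrightarrow> Phi p q r a b x = 0) \<and>
         (Phi p q r a b x = 0 \<longleftrightarrow> (\<forall>k<nat r. coeff (Phi p q r a b x) k = 0))"
proof
  show "closed_form_solution p q r a b x \<and> from_contiguous_relations p q r a b x
      \<longleftrightarrow> Phi p q r a b x = 0"
    \<comment> \<open>Vanishing of Q is equivalent to vanishing of \<open>Phi\<close> and implies
      the closed form, so the conjunction collapses.\<close>
    unfolding from_contiguous_relations_iff[OF assms] Phi_eq_0_iff[OF assms]
    using closed_form_solution_if_lineP_eq_0[OF assms] by blast
  \<comment> \<open>By the degree bound, the r listed coefficients are all that can be
    nonzero.\<close>
  have "coeff (Phi p q r a b x) k = 0" if "\<not> k < nat r" for k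
    using degree_Phi[OF assms, of a b] that by (intro coeff_eq_0) simp
  thus "Phi p q r a b x = 0 \<longleftrightarrow> (\<forall>k<nat r. coeff (Phi p q r a b x) k = 0)"
    by (metis coeff_0 leading_coeff_0_iff)
qed

end
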